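(* Let $\Omega\subset\mathbb{R}^n$ ($n\ge 2$) be a bounded domain, $T>0$, $N\ge1$, $p>1$, let $f\in L^2(\Omega_T,\mathbb{R}^N)$ and $g\in C^0([0,T];L^2(\Omega,\mathbb{R}^N))\cap L^p(0,T;W^{1,p}(\Omega,\mathbb{R}^N))$. Let $A$ be the vector field associated, as in the context, with a function $F$ satisfying the structural assumptions there. Then the Cauchy–Dirichlet problem $$\begin{cases}\partial_tu-\operatorname{div}A(x,t,Du)=f&\text{in }\Omega_T,\\ u=g&\text{on }\partial_{\mathrm{par}}\Omega_T\end{cases}$$ admits at most one weak solution.
   Context: $\Omega_T:=\Omega\times(0,T)$; $\partial_{\mathrm{par}}\Omega_T:=(\overline\Omega\times\{0\})\cup(\partial\Omega\times(0,T))$; $Du\in\mathbb{R}^{Nn}$ is the spatial gradient. Structural assumptions. $F:\Omega_T\times[0,\infty)\to[0,\infty)$, $(x,t,s)\mapsto F(x,t,s)$, is convex in $s$ and $F(x,t,s)=0$ for all $s\in[0,1]$. For a.e. $(x,t)\in\Omega_T$ the map $s\mapsto F(x,t,s)$ is in $C^1(\mathbb{R}^+)\cap C^2(\mathbb{R}^+\setminus\{1\})$; for every $(t,s)\in(0,T)\times[0,\infty)$ the map $x\mapsto F(x,t,s)$ is differentiable a.e. There are $p>1$ and positive constants $L$, $C_1>1$, $K$ such that for all $s>1$ and a.e. $x,y\in\Omega$, $t\in(0,T)$: (i) $\frac1L(s-1)^p\le F(x,t,s)\le Ls^p$; (ii) $\frac1{C_1}(s-1)^{p-1}\le\partial_sF(x,t,s)\le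 C_1(s-1)^{p-1}$; (iii) $\frac1{C_1}(s-1)^{p-2}\le\partial_{ss}F(x,t,s)\le C_1(s-1)^{p-2}$; (iv) $|\partial_sF(x,t,s)-\partial_sF(y,t,s)|\le K|x-y|s^{p-1}$. The vector field $A:\Omega_T\times\mathbb{R}^{Nn}\to\mathbb{R}^{Nn}$ is $A(x,t,\xi):=\frac{\partial_sF(x,t,|\xi|)}{|\xi|}\,\xi$ for $\xi\ne0$ and $A(x,t,0):=0$. Weak solution of the Cauchy–Dirichlet problem: a function $u\in C^0([0,T];L^2(\Omega,\mathbb{R}^N))\cap L^p(0,T;W^{1,p}(\Omega,\mathbb{R}^N))$ such that $\int_{\Omega_T}(u\cdot\partial_t\phi-\langle A(x,t,Du),D\phi\rangle)\,dz=-\int_{\Omega_T}f\cdot\phi\,dz$ for all $\phi\in C_0^\infty(\Omega_T,\mathbb{R}^N)$, $u\in g+L^p(0,T;W^{1,p}_0(\Omega,\mathbb{R}^N))$, and $\lim_{t\searrow0}\|u(\cdot,t)-g(\cdot,0)\|_{L^2(\Omega)}=0$. *)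

theory Defs
  imports "HOL-Analysis.Analysis"
begin

text \<open>
  Elements of function spaces are represented by functions (not equivalence classes); two
  representatives are identified when they agree almost everywhere.
  Vector values lie in \<open>real^'m\<close> (so \<open>N = CARD('m)\<close>), points of space in \<open>real^'n\<close>, and spatial
  gradients in \<open>real^'n^'m\<close> (\<open>N\<close> rows, \<open>n\<close> columns), whose norm and inner product in the library
  are the Euclidean (Frobenius) ones. Points of space-time are pairs \<open>(x, t)\<close>.
\<close>

definition cylinder :: "(real^'n) set \<Rightarrow> real \<Rightarrow> ((real^'n) \<times> real) set"
  where "cylinder \<Omega> T = \<Omega> \<times> {0<..<T}"

definition domain :: "'a::euclidean_space set \<Rightarrow> bool"
  where "domain \<Omega> \<longleftrightarrow> open \<Omega> \<and> connected \<Omega> \<and> \<Omega> \<noteq> {}"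


subsection \<open>Test functions\<close>

primrec Ck :: "nat \<Rightarrow> ('a::euclidean_space \<Rightarrow> 'b::real_normed_vector) \<Rightarrow> bool"
  where
    "Ck 0 f \<longleftrightarrow> continuous_on UNIV f"
  | "Ck (Suc k) f \<longleftrightarrow> (\<forall>x. f differentiable (at x)) \<and>
       (\<forall>b\<in>Basis. Ck k (\<lambda>x. frechet_derivative f (at x) b))"

text \<open>\<open>C\<^sub>0\<^sup>\<infinity>(U)\<close>: the functions are extended by zero to the whole space.\<close>

definition test_functions :: "'a::euclidean_space set \<Rightarrow> ('a \<Rightarrow> 'b::real_normed_vector) set"
  where "test_functions U =
    {\<phi>. (\<forall>k. Ck k \<phi>) \<and> compact (closure {x. \<phi> x \<noteq> 0}) \<and> closure {x. \<phi> x \<noteq> 0} \<subseteq> U}"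


subsection \<open>Lebesgue and Sobolev spaces\<close>

definition Lp_space :: "real \<Rightarrow> 'a::euclidean_space set \<Rightarrow> ('a \<Rightarrow> 'b::euclidean_space) set"
  where "Lp_space p U =
    {v. v \<in> borel_measurable (lebesgue_on U) \<and> integrable (lebesgue_on U) (\<lambda>x. norm (v x) powr p)}"

definition Lp_norm :: "real \<Rightarrow> 'a::euclidean_space set \<Rightarrow> ('a \<Rightarrow> 'b::euclidean_space) \<Rightarrow> real"
  where "Lp_norm p U v = (LINT x|lebesgue_on U. norm (v x) powr p) powr (1 / p)"

definition L1_loc :: "'a::euclidean_space set \<Rightarrow> ('a \<Rightarrow> 'b::euclidean_space) set"
  where "L1_loc U = {v. \<forall>K. compact K \<and> K \<subseteq> U \<longrightarrow> integrable (lebesgue_on K) v}"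

definition has_weak_gradient ::
    "(real^'n) set \<Rightarrow> (real^'n \<Rightarrow> real^'m) \<Rightarrow> (real^'n \<Rightarrow> real^'n^'m) \<Rightarrow> bool"
  where "has_weak_gradient \<Omega> v G \<longleftrightarrow> v \<in> L1_loc \<Omega> \<and> G \<in> L1_loc \<Omega> \<and>
    (\<forall>(\<phi> :: real^'n \<Rightarrow> real) \<in> test_functions \<Omega>. \<forall>i j.
      (LINT x|lebesgue_on \<Omega>. v x $ j * frechet_derivative \<phi> (at x) (axis i 1)) =
      - (LINT x|lebesgue_on \<Omega>. G x $ j $ i * \<phi> x))"

definition weak_gradient ::
    "(real^'n) set \<Rightarrow> (real^'n \<Rightarrow> real^'m) \<Rightarrow> (real^'n \<Rightarrow> real^'n^'m)"
  where "weak_gradient \<Omega> v = (SOME G. has_weak_gradient \<Omega> v G)"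

definition W1p :: "real \<Rightarrow> (real^'n) set \<Rightarrow> (real^'n \<Rightarrow> real^'m) set"
  where "W1p p \<Omega> =
    {v. v \<in> Lp_space p \<Omega> \<and> (\<exists>G. has_weak_gradient \<Omega> v G \<and> G \<in> Lp_space p \<Omega>)}"

definition W1p_norm :: "real \<Rightarrow> (real^'n) set \<Rightarrow> (real^'n \<Rightarrow> real^'m) \<Rightarrow> real"
  where "W1p_norm p \<Omega> v =
    (Lp_norm p \<Omega> v powr p + Lp_norm p \<Omega> (weak_gradient \<Omega> v) powr p) powr (1 / p)"

text \<open>\<open>W\<^sub>0\<^sup>1\<^sup>,\<^sup>p(\<Omega>)\<close>: the closure of the test functions in \<open>W\<^sup>1\<^sup>,\<^sup>p(\<Omega>)\<close>.\<close>

definition W1p0 :: "real \<Rightarrow> (real^'n) set \<Rightarrow> (real^'n \<Rightarrow> real^'m) set"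
  where "W1p0 p \<Omega> =
    {v \<in> W1p p \<Omega>. \<forall>\<epsilon>>0. \<exists>\<phi>\<in>test_functions \<Omega>. W1p_norm p \<Omega> (\<lambda>x. v x - \<phi> x) < \<epsilon>}"


subsection \<open>Spaces of functions of time\<close>

text \<open>
  The Bochner space \<open>L\<^sup>p(0,T;X)\<close> for a space \<open>X\<close> of functions with norm \<open>\<nu>\<close>. The middle condition
  is strong measurability.
\<close>

definition Bochner_Lp ::
    "real \<Rightarrow> real \<Rightarrow> ('a \<Rightarrow> 'b::real_vector) set \<Rightarrow> (('a \<Rightarrow> 'b) \<Rightarrow> real) \<Rightarrow> (real \<Rightarrow> 'a \<Rightarrow> 'b) set"
  where "Bochner_Lp p T X \<nu> =
    {U. (AE t in lebesgue_on {0<..<T}. U t \<in> X) \<and>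
        (\<exists>S :: nat \<Rightarrow> real \<Rightarrow> 'a \<Rightarrow> 'b.
           (\<forall>k. simple_function (lebesgue_on {0<..<T}) (S k) \<and> S k ` {0<..<T} \<subseteq> X) \<and>
           (AE t in lebesgue_on {0<..<T}. (\<lambda>k. \<nu> (\<lambda>x. U t x - S k t x)) \<longlonglongrightarrow> 0)) \<and>
        integrable (lebesgue_on {0<..<T}) (\<lambda>t. \<nu> (U t) powr p)}"

definition C0_L2 :: "real \<Rightarrow> 'a::euclidean_space set \<Rightarrow> (real \<Rightarrow> 'a \<Rightarrow> 'b::euclidean_space) set"
  where "C0_L2 T \<Omega> =
    {U. \<forall>t\<in>{0..T}. U t \<in> Lp_space 2 \<Omega> \<and>
          ((\<lambda>s. Lp_norm 2 \<Omega> (\<lambda>x. U s x - U t x)) \<longlongrightarrow> 0) (at t within {0..T})}"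

abbreviation (input) slice :: "('a \<times> real \<Rightarrow> 'b) \<Rightarrow> real \<Rightarrow> 'a \<Rightarrow> 'b"
  where "slice u \<equiv> (\<lambda>t x. u (x, t))"

definition has_spatial_gradient ::
    "(real^'n) set \<Rightarrow> real \<Rightarrow> ((real^'n) \<times> real \<Rightarrow> real^'m) \<Rightarrow>
     ((real^'n) \<times> real \<Rightarrow> real^'n^'m) \<Rightarrow> bool"
  where "has_spatial_gradient \<Omega> T u G \<longleftrightarrow>
    G \<in> borel_measurable (lebesgue_on (cylinder \<Omega> T)) \<and>
    (AE t in lebesgue_on {0<..<T}. has_weak_gradient \<Omega> (slice u t) (slice G t))"


subsection \<open>Structural assumptions and the vector field\<close>

text \<open>
  \<open>F x t s\<close> is only meaningful for \<open>(x, t)\<close> in the cylinder and \<open>s \<ge> 0\<close>; accordingly, \<open>\<partial>\<^sub>sF\<close> and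
  \<open>\<partial>\<^sub>s\<^sub>sF\<close> are used for \<open>s > 0\<close> only. As \<open>F\<close> vanishes on \<open>[0,1]\<close>, regularity in \<open>s\<close> on the open
  half line is the same as on \<open>[0,\<infinity>)\<close>.
\<close>

definition Fs :: "('a \<Rightarrow> real \<Rightarrow> real \<Rightarrow> real) \<Rightarrow> 'a \<Rightarrow> real \<Rightarrow> real \<Rightarrow> real"
  where "Fs F x t s = deriv (F x t) s"

definition Fss :: "('a \<Rightarrow> real \<Rightarrow> real \<Rightarrow> real) \<Rightarrow> 'a \<Rightarrow> real \<Rightarrow> real \<Rightarrow> real"
  where "Fss F x t s = deriv (Fs F x t) s"

definition structural_assumptions ::
    "(real^'n) set \<Rightarrow> real \<Rightarrow> real \<Rightarrow> real \<Rightarrow> real \<Rightarrow> real \<Rightarrow>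
     (real^'n \<Rightarrow> real \<Rightarrow> real \<Rightarrow> real) \<Rightarrow> bool"
  where "structural_assumptions \<Omega> T p L C\<^sub>1 K F \<longleftrightarrow>
    p > 1 \<and> L > 0 \<and> C\<^sub>1 > 1 \<and> K > 0 \<and>
    (\<forall>(x, t)\<in>cylinder \<Omega> T.
       (\<forall>s\<ge>0. F x t s \<ge> 0) \<and> convex_on {0..} (F x t) \<and> (\<forall>s\<in>{0..1}. F x t s = 0)) \<and>
    (AE (x, t) in lebesgue_on (cylinder \<Omega> T).
       F x t C1_differentiable_on {0<..} \<and> Fs F x t C1_differentiable_on ({0<..} - {1})) \<and>
    (\<forall>t\<in>{0<..<T}. \<forall>s\<ge>0. AE x in lebesgue_on \<Omega>. (\<lambda>y. F y t s) differentiable (at x)) \<and>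
    (\<forall>s>1.
       (AE (x, t) in lebesgue_on (cylinder \<Omega> T).
          1 / L * (s - 1) powr p \<le> F x t s \<and> F x t s \<le> L * s powr p) \<and>
       (AE (x, t) in lebesgue_on (cylinder \<Omega> T).
          1 / C\<^sub>1 * (s - 1) powr (p - 1) \<le> Fs F x t s \<and>
          Fs F x t s \<le> C\<^sub>1 * (s - 1) powr (p - 1)) \<and>
       (AE (x, t) in lebesgue_on (cylinder \<Omega> T).
          1 / C\<^sub>1 * (s - 1) powr (p - 2) \<le> Fss F x t s \<and>
          Fss F x t s \<le> C\<^sub>1 * (s - 1) powr (p - 2)) \<and>
       (AE (x, y, t) in lebesgue_on (\<Omega> \<times> \<Omega> \<times> {0<..<T}).
          \<bar>Fs F x t s - Fs F y t s\<bar> \<le> K * norm (x - y) * s powr (p - 1)))"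

definition vector_field ::
    "('a \<Rightarrow> real \<Rightarrow> real \<Rightarrow> real) \<Rightarrow> 'a \<Rightarrow> real \<Rightarrow> real^'n^'m \<Rightarrow> real^'n^'m"
  where "vector_field F x t \<xi> = (if \<xi> = 0 then 0 else (Fs F x t (norm \<xi>) / norm \<xi>) *\<^sub>R \<xi>)"


subsection \<open>Weak solutions of the Cauchy--Dirichlet problem\<close>

text \<open>
  The joint measurability of \<open>u\<close> is no restriction: every element of \<open>C\<^sup>0([0,T];L\<^sup>2(\<Omega>))\<close> has a
  jointly measurable representative. The integrability requirement in the weak formulation
  expresses that the integral on the left-hand side exists; it cannot be omitted, because the
  integral operator returns 0 for non-integrable functions.
\<close>

definition weak_solution ::
    "(real^'n) set \<Rightarrow> real \<Rightarrow> real \<Rightarrow>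
     (real^'n \<Rightarrow> real \<Rightarrow> real^'n^'m \<Rightarrow> real^'n^'m) \<Rightarrow>
     ((real^'n) \<times> real \<Rightarrow> real^'m) \<Rightarrow> ((real^'n) \<times> real \<Rightarrow> real^'m) \<Rightarrow>
     ((real^'n) \<times> real \<Rightarrow> real^'m) \<Rightarrow> bool"
  where "weak_solution \<Omega> T p A f g u \<longleftrightarrow>
    u \<in> borel_measurable (lebesgue_on (cylinder \<Omega> T)) \<and>
    slice u \<in> C0_L2 T \<Omega> \<and>
    slice u \<in> Bochner_Lp p T (W1p p \<Omega>) (W1p_norm p \<Omega>) \<and>
    (\<exists>Du. has_spatial_gradient \<Omega> T u Du \<and>
      (\<forall>\<phi>\<in>test_functions (cylinder \<Omega> T).
        let I = (\<lambda>(x, t). u (x, t) \<bullet> vector_derivative (\<lambda>s. \<phi> (x, s)) (at t)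
                   - A x t (Du (x, t)) \<bullet> jacobian (\<lambda>y. \<phi> (y, t)) (at x))
        in integrable (lebesgue_on (cylinder \<Omega> T)) I \<and>
           (LINT z|lebesgue_on (cylinder \<Omega> T). I z) =
             - (LINT z|lebesgue_on (cylinder \<Omega> T). f z \<bullet> \<phi> z))) \<and>
    slice (\<lambda>z. u z - g z) \<in> Bochner_Lp p T (W1p0 p \<Omega>) (W1p_norm p \<Omega>) \<and>
    ((\<lambda>t. Lp_norm 2 \<Omega> (\<lambda>x. u (x, t) - g (x, 0))) \<longlongrightarrow> 0) (at_right 0)"

end

theory Submission
  imports Defs
begin

text \<open>
  Let \<open>w = u - v\<close>, and let \<open>B\<close> and \<open>G\<close> be the differences of the fluxes and of the gradients of two
  solutions. Product test functions turn the weak form into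
  \<open>\<integral>\<^sub>\<Omega> (w(t) - w(s)) \<bullet> \<phi> = - \<integral>\<^sub>s\<^sup>t \<integral>\<^sub>\<Omega> B \<bullet> D\<phi>\<close>, and for almost every \<open>t\<close> one may take \<open>\<phi> = w(t)\<close>.
  With \<open>s = t - h\<close> and \<open>2 (a - b) \<bullet> a \<ge> |a|\<^sup>2 - |b|\<^sup>2\<close>, an integration over \<open>t \<in> (0, \<tau>)\<close> gives
  \<open>\<integral> \<parallel>w(t)\<parallel>\<^sup>2 dt \<le> - 2 \<integral>\<^sub>0\<^sup>h \<integral> B(x, t - r) \<bullet> G(x, t) d(x, t) dr\<close>, where \<open>t\<close> ranges over \<open>(\<tau> - h, \<tau>)\<close> on the left.
  After division by \<open>h\<close> the right-hand side tends to \<open>- 2 \<integral> B \<bullet> G \<le> 0\<close> as \<open>h \<rightarrow> 0\<close>, because translations are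
  continuous in Lebesgue spaces and the vector field is monotone. Hence \<open>w(\<tau>) = 0\<close>. Working with
  differences in time avoids any time derivative of \<open>w\<close>.
\<close>

subsection \<open>Smooth functions\<close>

text \<open>The spatial regularity of \<open>w\<close> and its regularity in time live in different
  spaces: for small p a function in \<open>W1p\<close> need not be square integrable, so no duality
  pairing between the distributional time derivative and \<open>w\<close> is at hand. Freezing one
  time avoids this: the increment identity then only involves an L2 pairing on one side and an
  L^p-L^q pairing on the other, and both extend from test functions to \<open>w t\<close>. The
  vector field vanishes for small gradients, so monotonicity is not strict and \<open>G\<close>
  cannot be shown to vanish directly; only the L2 norm of \<open>w\<close> is controlled. Moreover
  monotonicity compares flux and gradient at the same point of space-time. The product of
  \<open>B\<close> at time t - r with \<open>G\<close> at time t has no sign, and one is recovered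
  only as r tends to 0. Integrating the backward differences over time telescopes. What remains is a
  window of length h below \<tau> and a window of length h before time 0, and the initial condition
  lets the second one be filled with zeros.\<close>

lemma Ck_SucI:
  assumes "\<And>x. (f has_derivative f' x) (at x)"
    and "\<And>b. b \<in> Basis \<Longrightarrow> Ck k (\<lambda>x. f' x b)"
  shows "Ck (Suc k) f"
proof -
  have "frechet_derivative f (at x) = f' x" for x
    using frechet_derivative_at[OF assms(1)] by simp
  moreover have "f differentiable (at x)" for x
    using assms(1) unfolding differentiable_def by blast
  ultimately show ?thesis
    using assms(2) by simp
qed

lemma Ck_has_derivative:
  "Ck (Suc k) f \<Longrightarrow> (f has_derivative frechet_derivative f (at x)) (at x)"
  by (simp add: frechet_derivative_works[symmetric])

lemma Ck_SucD: "Ck (Suc k) f \<Longrightarrow> Ck k f"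
proof (induction k arbitrary: f)
  case 0
  then show ?case
    by (auto simp: continuous_on_eq_continuous_at intro: differentiable_imp_continuous_within)
next
  case (Suc k)
  then show ?case by simp
qed

lemma Ck_continuous: "Ck k f \<Longrightarrow> continuous_on UNIV f"
  by (induction k) (auto dest: Ck_SucD simp del: Ck.simps(2))

lemma Ck_const: "Ck k (\<lambda>x. c)"
proof (induction k arbitrary: c)
  case (Suc k)
  show ?case
    by (rule Ck_SucI[where f' = "\<lambda>x h. 0"]) (auto intro: Suc)
qed simp

lemma Ck_add: "Ck k f \<Longrightarrow> Ck k g \<Longrightarrow> Ck k (\<lambda>x. f x + g x)"
proof (induction k arbitrary: f g)
  case (Suc k)
  show ?case
    by (rule Ck_SucI[OF has_derivative_add[OF Ck_has_derivative[OF Suc(2)] Ck_has_derivative[OF Suc(3)]]])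
       (use Suc in auto)
qed (simp add: continuous_on_add)

lemma Ck_sum: "(\<And>i. i \<in> I \<Longrightarrow> Ck k (f i)) \<Longrightarrow> Ck k (\<lambda>x. \<Sum>i\<in>I. f i x)"
  by (induction I rule: infinite_finite_induct) (auto simp: Ck_const Ck_add)

lemma Ck_bounded_linear:
  assumes "bounded_linear L"
  shows "Ck k f \<Longrightarrow> Ck k (\<lambda>x. L (f x))"
proof (induction k arbitrary: f)
  case 0
  then show ?case
    using bounded_linear.continuous_on[OF assms] by simp
next
  case (Suc k)
  show ?case
    by (rule Ck_SucI[OF bounded_linear.has_derivative[OF assms Ck_has_derivative[OF Suc(2)]]])
       (use Suc in auto)
qed

lemma Ck_linear:
  fixes L :: "'a::euclidean_space \<Rightarrow> 'b::real_normed_vector"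
  assumes "bounded_linear L"
  shows "Ck k L"
proof (cases k)
  case 0
  then show ?thesis using linear_continuous_on[OF assms] by simp
next
  case (Suc k')
  then show ?thesis
    using Ck_SucI[OF bounded_linear_imp_has_derivative[OF assms], OF Ck_const] by blast
qed

lemma (in bounded_bilinear) Ck:
  fixes f :: "'d::euclidean_space \<Rightarrow> 'a" and g :: "'d \<Rightarrow> 'b"
  shows "Ck k f \<Longrightarrow> Ck k g \<Longrightarrow> Ck k (\<lambda>x. prod (f x) (g x))"
proof (induction k arbitrary: f g)
  case 0
  then show ?case by (simp add: continuous_on)
next
  case (Suc k)
  show ?case
    by (rule Ck_SucI[OF FDERIV[OF Ck_has_derivative[OF Suc(2)] Ck_has_derivative[OF Suc(3)]]])
       (intro Ck_add Suc.IH Ck_SucD[OF Suc(2)] Ck_SucD[OF Suc(3)], use Suc in auto)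
qed

lemmas Ck_scaleR = bounded_bilinear.Ck[OF bounded_bilinear_scaleR]
lemmas Ck_inner = bounded_bilinear.Ck[OF bounded_bilinear_inner]
lemmas Ck_mult = bounded_bilinear.Ck[OF bounded_bilinear_mult]

text \<open>\<open>Ck\<close> only speaks of derivatives along basis vectors, whereas the chain rule
  feeds the derivative of \<open>g\<close> a varying direction. Expanding that direction in the
  basis turns the derivative into a sum of products, to which the induction hypothesis
  applies.\<close>

lemma Ck_compose:
  fixes g :: "'b::euclidean_space \<Rightarrow> 'c::real_normed_vector"
    and h :: "'a::euclidean_space \<Rightarrow> 'b"
  shows "Ck k g \<Longrightarrow> Ck k h \<Longrightarrow> Ck k (\<lambda>x. g (h x))"
proof (induction k arbitrary: g h)
  case 0
  then show ?case using continuous_on_compose2[of UNIV g UNIV h] by simp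
next
  case (Suc k)
  have lin: "linear (frechet_derivative g (at y))" for y
    using Suc(2) by (simp add: linear_frechet_derivative)
  have eq: "frechet_derivative g (at (h x)) (frechet_derivative h (at x) b) =
     (\<Sum>i\<in>Basis. (frechet_derivative h (at x) b \<bullet> i) *\<^sub>R frechet_derivative g (at (h x)) i)" for x b
  proof -
    have "frechet_derivative g (at (h x)) (frechet_derivative h (at x) b) =
      frechet_derivative g (at (h x)) (\<Sum>i\<in>Basis. (frechet_derivative h (at x) b \<bullet> i) *\<^sub>R i)"
      by (simp add: euclidean_representation)
    then show ?thesis
      by (simp add: linear_sum[OF lin] linear_scale[OF lin])
  qed
  show ?case
  proof (rule Ck_SucI)
    show "((\<lambda>x. g (h x)) has_derivative
       (\<lambda>b. frechet_derivative g (at (h x)) (frechet_derivative h (at x) b))) (at x)" for x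
      by (rule has_derivative_compose[OF Ck_has_derivative[OF Suc(3)] Ck_has_derivative[OF Suc(2)]])
    show "Ck k (\<lambda>x. frechet_derivative g (at (h x)) (frechet_derivative h (at x) b))"
      if "b \<in> Basis" for b
      unfolding eq
    proof (intro Ck_sum Ck_scaleR)
      fix i :: 'b assume i: "i \<in> Basis"
      show "Ck k (\<lambda>x. frechet_derivative h (at x) b \<bullet> i)"
        using Suc(3) that by (intro Ck_inner Ck_const) simp
      show "Ck k (\<lambda>x. frechet_derivative g (at (h x)) i)"
        using Suc.IH[of "\<lambda>y. frechet_derivative g (at y) i" h] Suc(2) Ck_SucD[OF Suc(3)] i by simp
    qed
  qed
qed

lemma Ck_prod:
  fixes f :: "'i \<Rightarrow> 'a::euclidean_space \<Rightarrow> real"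
  shows "(\<And>i. i \<in> I \<Longrightarrow> Ck k (f i)) \<Longrightarrow> Ck k (\<lambda>x. \<Prod>i\<in>I. f i x)"
  by (induction I rule: infinite_finite_induct) (auto simp: Ck_const Ck_mult)

lemma Ck_exp: "Ck k (exp :: real \<Rightarrow> real)"
proof (induction k)
  case (Suc k)
  have "(exp has_derivative (\<lambda>h. h * exp x)) (at x)" for x :: real
    by (auto intro!: derivative_eq_intros)
  then show ?case
    by (rule Ck_SucI) (use Suc in simp)
qed (simp add: continuous_on_exp)

text \<open>Derivatives of members of this family are linear combinations of members, hence smoothness.\<close>

definition flat :: "nat \<Rightarrow> real \<Rightarrow> real"
  where "flat n y = (if y > 0 then exp (- (1 / y)) / y ^ n else 0)"

text \<open>Taking the m-th power of s/m \<le> exp (s/m) with s = 1/y and m = n + 2 gives exp (1/y)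
  \<ge> (1/(m y))^m. Division by y^n uses up n of the m powers of y; the two that remain make
  \<open>flat n\<close> differentiable at 0.\<close>

lemma flat_le_square: "flat n y \<le> real (n + 2) ^ (n + 2) * y\<^sup>2"
proof (cases "y > 0")
  case True
  define m where "m = n + 2"
  have "(1 / y / real m) ^ m \<le> exp (1 / y / real m) ^ m"
    using exp_ge_add_one_self[of "1 / y / real m"] True
    by (intro power_mono) (linarith, simp)
  also have "\<dots> = exp (1 / y)"
    using True by (subst exp_of_nat_mult[symmetric]) (simp add: m_def)
  also have "(1 / y / real m) ^ m = 1 / (real m ^ m * y ^ m)"
    by (simp add: power_divide power_mult_distrib mult.commute)
  finally have "1 \<le> exp (1 / y) * (real m ^ m * y ^ m)"
    using True by (simp add: pos_divide_le_eq m_def)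
  then have "exp (- (1 / y)) \<le> exp (- (1 / y)) * (exp (1 / y) * (real m ^ m * y ^ m))"
    by simp
  also have "\<dots> = real m ^ m * y ^ m"
    by (simp flip: mult.assoc exp_add)
  also have "\<dots> = real m ^ m * y\<^sup>2 * y ^ n"
    by (simp add: m_def power_add power2_eq_square)
  finally show ?thesis
    using True unfolding flat_def m_def by (simp add: pos_divide_le_eq)
qed (simp add: flat_def)

lemma flat_nonneg: "flat n y \<ge> 0"
  by (simp add: flat_def)

lemma has_field_derivative_zero_at_square_bound:
  fixes f :: "real \<Rightarrow> real"
  assumes "\<And>y. \<bar>f y\<bar> \<le> C * y\<^sup>2"
  shows "(f has_field_derivative 0) (at 0)"
proof -
  have f0: "f 0 = 0" using assms[of 0] by simp
  have "((\<lambda>y. f y / y) \<longlongrightarrow> 0) (at 0)"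
  proof (rule Lim_null_comparison)
    show "\<forall>\<^sub>F y in at 0. norm (f y / y) \<le> C * \<bar>y\<bar>"
    proof (rule eventuallyI)
      fix y
      show "norm (f y / y) \<le> C * \<bar>y\<bar>"
      proof (cases "y = 0")
        case False
        have "norm (f y / y) \<le> C * y\<^sup>2 / \<bar>y\<bar>"
          using assms[of y] by (simp add: divide_right_mono)
        also have "\<dots> = C * \<bar>y\<bar>"
          using False by (cases "y > 0") (simp_all add: power2_eq_square)
        finally show ?thesis .
      qed simp
    qed
    have "((\<lambda>y::real. C * \<bar>y\<bar>) \<longlongrightarrow> C * \<bar>0\<bar>) (at 0)"
      by (intro tendsto_intros)
    then show "((\<lambda>y::real. C * \<bar>y\<bar>) \<longlongrightarrow> 0) (at 0)" by simp
  qed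
  then show ?thesis
    by (simp add: has_field_derivative_iff f0)
qed

text \<open>For positive y this is the quotient rule; the factor 1/y^2 from the exponent raises the
  index by two, the denominator raises it by one. At the origin every member is squeezed by a
  multiple of y^2.\<close>

lemma flat_has_field_derivative:
  "(flat n has_field_derivative (flat (n + 2) y - real n * flat (n + 1) y)) (at y)"
proof -
  consider "y > 0" | "y < 0" | "y = 0" by linarith
  then show ?thesis
  proof cases
    case 1
    have ev: "\<forall>\<^sub>F x in nhds y. flat n x = exp (- (1 / x)) / x ^ n"
      using eventually_nhds_in_open[of "{0<..}" y] 1 by (auto elim: eventually_mono simp: flat_def)
    have "((\<lambda>x. exp (- (1 / x)) / x ^ n) has_field_derivative
       (exp (- (1 / y)) * (1 / y\<^sup>2) * y ^ n - exp (- (1 / y)) * (real n * y ^ (n - 1))) / (y ^ n * y ^ n)) (at y)"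
      using 1 by (auto intro!: derivative_eq_intros simp: power2_eq_square)
    moreover have "(exp (- (1 / y)) * (1 / y\<^sup>2) * y ^ n - exp (- (1 / y)) * (real n * y ^ (n - 1))) / (y ^ n * y ^ n)
      = flat (n + 2) y - real n * flat (n + 1) y"
      using 1 by (cases n) (simp_all add: flat_def field_simps power2_eq_square)
    ultimately show ?thesis
      using DERIV_cong_ev[OF refl ev refl] by simp
  next
    case 2
    have ev: "\<forall>\<^sub>F x in nhds y. flat n x = 0"
      using eventually_nhds_in_open[of "{..<0}" y] 2 by (auto elim: eventually_mono simp: flat_def)
    then show ?thesis
      using DERIV_cong_ev[OF refl ev refl, of 0] 2 by (simp add: flat_def[of _ y])
  next
    case 3
    have "\<bar>flat n y\<bar> \<le> real (n + 2) ^ (n + 2) * y\<^sup>2" for y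
      unfolding abs_of_nonneg[OF flat_nonneg] by (rule flat_le_square)
    then have "(flat n has_field_derivative 0) (at 0)"
      by (rule has_field_derivative_zero_at_square_bound)
    then show ?thesis by (simp add: 3 flat_def)
  qed
qed

lemma Ck_flat: "Ck k (flat n)"
proof (induction k arbitrary: n)
  case 0
  have "isCont (flat n) x" for x
    using flat_has_field_derivative by (rule DERIV_isCont)
  then show ?case by (simp add: continuous_at_imp_continuous_on)
next
  case (Suc k)
  have "(flat n has_derivative (\<lambda>h. h * (flat (n + 2) y - real n * flat (n + 1) y))) (at y)" for y
    using flat_has_field_derivative[of n y] unfolding has_field_derivative_def
    by (simp add: mult.commute[of _ "_ - _"])
  then show ?case
  proof (rule Ck_SucI)
    fix b :: real assume "b \<in> Basis"
    have "Ck k (\<lambda>y. flat (n + 2) y + (- real n) * flat (n + 1) y)"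
      by (intro Ck_add Ck_mult Ck_const Suc)
    then show "Ck k (\<lambda>y. b * (flat (n + 2) y - real n * flat (n + 1) y))"
      using \<open>b \<in> Basis\<close> by simp
  qed
qed

lemma flat_0_le_1: "flat 0 y \<le> 1"
  by (simp add: flat_def)

text \<open>\<open>flat 0\<close> is a smooth Heaviside function. For y \<le> 0 the value is exactly
  0 as soon as the scaling is positive, which is why the limit is the indicator of the open half
  line.\<close>

lemma flat_0_tendsto:
  assumes "filterlim c at_top F"
  shows "((\<lambda>k. flat 0 (c k * y)) \<longlongrightarrow> indicat_real {0<..} y) F"
proof (cases "y > 0")
  case True
  have "filterlim (\<lambda>k. c k * y) at_top F"
    using assms True by (rule filterlim_at_top_mult_tendsto_pos[OF tendsto_const, rotated])
  then have "((\<lambda>k. inverse (c k * y)) \<longlongrightarrow> 0) F"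
    by (rule tendsto_inverse_0_at_top)
  then have "((\<lambda>k. exp (- inverse (c k * y))) \<longlongrightarrow> exp (- 0)) F"
    by (intro tendsto_intros)
  moreover have "\<forall>\<^sub>F k in F. exp (- inverse (c k * y)) = flat 0 (c k * y)"
    using filterlim_at_top_dense[THEN iffD1, OF assms, rule_format, of 0]
    by eventually_elim (use True in \<open>simp add: flat_def inverse_eq_divide\<close>)
  ultimately show ?thesis
    using True by (simp add: tendsto_cong)
next
  case False
  have "\<forall>\<^sub>F k in F. 0 = flat 0 (c k * y)"
    using filterlim_at_top_dense[THEN iffD1, OF assms, rule_format, of 0]
    by eventually_elim (use False in \<open>simp add: flat_def zero_less_mult_iff\<close>)
  then show ?thesis
    using False by (simp add: tendsto_eventually eventually_mono)
qed

text \<open>One smooth Heaviside factor for each of the two faces in every coordinate direction. The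
  result is positive exactly on the open box when k > 0, and k controls the steepness of the flanks;
  no normalisation is made because only the limit k \<rightarrow> \<infinity>, the indicator of the
  box, is used.\<close>

definition bump :: "real \<Rightarrow> 'a::euclidean_space \<Rightarrow> 'a \<Rightarrow> 'a \<Rightarrow> real"
  where "bump k a b x = (\<Prod>i\<in>Basis. flat 0 (k * ((x - a) \<bullet> i)) * flat 0 (k * ((b - x) \<bullet> i)))"

lemma Ck_bump: "Ck j (bump k a b)"
proof -
  have lin: "Ck j (\<lambda>x. (x + - a) \<bullet> i)" "Ck j (\<lambda>x. (b + (- 1) *\<^sub>R x) \<bullet> i)" for i
    by (rule Ck_inner[OF Ck_add[OF Ck_linear[OF bounded_linear_ident] Ck_const] Ck_const],
        rule Ck_inner[OF Ck_add[OF Ck_const Ck_scaleR[OF Ck_const Ck_linear[OF bounded_linear_ident]]] Ck_const])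
  have "Ck j (\<lambda>x. flat 0 (k * ((x + - a) \<bullet> i)))" "Ck j (\<lambda>x. flat 0 (k * ((b + (- 1) *\<^sub>R x) \<bullet> i)))" for i
    by (rule Ck_compose[OF Ck_flat Ck_mult[OF Ck_const lin(1)]],
        rule Ck_compose[OF Ck_flat Ck_mult[OF Ck_const lin(2)]])
  then show ?thesis
    unfolding bump_def by (intro Ck_prod Ck_mult) simp_all
qed

lemma bump_nonneg: "bump k a b x \<ge> 0"
  unfolding bump_def by (intro prod_nonneg mult_nonneg_nonneg ballI flat_nonneg)

lemma bump_le_1: "bump k a b x \<le> 1"
  unfolding bump_def by (intro prod_le_1 conjI mult_nonneg_nonneg mult_le_one flat_nonneg flat_0_le_1)

lemma bump_eq_0_iff: "k > 0 \<Longrightarrow> bump k a b x = 0 \<longleftrightarrow> x \<notin> box a b"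
  by (auto simp: bump_def flat_def box_def inner_diff_left zero_less_mult_iff)

lemma bump_tendsto: "((\<lambda>k. bump (real k) a b x) \<longlonglongrightarrow> indicat_real (box a b) x)"
proof -
  have "(\<lambda>k. bump (real k) a b x) \<longlonglongrightarrow>
     (\<Prod>i\<in>Basis. indicat_real {0<..} ((x - a) \<bullet> i) * indicat_real {0<..} ((b - x) \<bullet> i))"
    unfolding bump_def
    by (intro tendsto_prod tendsto_mult flat_0_tendsto filterlim_real_sequentially)
  also have "(\<Prod>i\<in>Basis. indicat_real {0<..} ((x - a) \<bullet> i) * indicat_real {0<..} ((b - x) \<bullet> i))
      = indicat_real (box a b) x"
  proof (cases "x \<in> box a b")
    case True
    then show ?thesis by (simp add: box_def inner_diff_left)
  next
    case False
    then obtain i where "i \<in> Basis" "\<not> ((x - a) \<bullet> i > 0 \<and> (b - x) \<bullet> i > 0)"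
      by (auto simp: box_def inner_diff_left)
    then show ?thesis
      using False by (auto simp: prod_zero_iff indicator_def)
  qed
  finally show ?thesis .
qed

section \<open>Closure properties of test functions\<close>

lemma test_functionsI:
  assumes "\<And>k. Ck k \<phi>" "compact K" "K \<subseteq> U" "\<And>x. x \<notin> K \<Longrightarrow> \<phi> x = 0"
  shows "\<phi> \<in> test_functions U"
proof -
  have "closure {x. \<phi> x \<noteq> 0} \<subseteq> K"
    using assms by (intro closure_minimal compact_imp_closed) auto
  moreover from this have "compact (closure {x. \<phi> x \<noteq> 0})"
    using assms(2) by (metis closed_closure compact_Int_closed inf.absorb_iff2)
  ultimately show ?thesis
    using assms by (auto simp: test_functions_def)
qed

lemma test_functionsE:
  assumes "\<phi> \<in> test_functions U"
  obtains K where "compact K" "K \<subseteq> U" "\<And>x. x \<notin> K \<Longrightarrow> \<phi> x = 0"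
proof
  show "compact (closure {x. \<phi> x \<noteq> 0})" "closure {x. \<phi> x \<noteq> 0} \<subseteq> U"
    using assms by (auto simp: test_functions_def)
  show "\<phi> x = 0" if "x \<notin> closure {x. \<phi> x \<noteq> 0}" for x
    using that closure_subset[of "{x. \<phi> x \<noteq> 0}"] by blast
qed

lemma test_functions_Ck: "\<phi> \<in> test_functions U \<Longrightarrow> Ck k \<phi>"
  by (simp add: test_functions_def)

lemma test_functions_has_derivative:
  "\<phi> \<in> test_functions U \<Longrightarrow> (\<phi> has_derivative frechet_derivative \<phi> (at x)) (at x)"
  by (rule Ck_has_derivative[OF test_functions_Ck])

text \<open>A smooth function that vanishes wherever \<phi> does has its support inside that of
  \<phi>. This is the way new test functions are made from old ones by products, linear maps and
  truncation.\<close>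

lemma test_functions_vanish:
  assumes "\<phi> \<in> test_functions U" and "\<And>k. Ck k \<psi>" and "\<And>x. \<phi> x = 0 \<Longrightarrow> \<psi> x = 0"
  shows "\<psi> \<in> test_functions U"
  using assms(1) by (rule test_functionsE) (rule test_functionsI, use assms in auto)

lemma test_functions_scaleR:
  assumes "\<phi> \<in> test_functions U" and "\<And>k. Ck k \<psi>"
  shows "(\<lambda>x. \<phi> x *\<^sub>R \<psi> x) \<in> test_functions U"
  using assms(1) by (rule test_functions_vanish)
    (use assms in \<open>auto intro: Ck_scaleR test_functions_Ck\<close>)

lemma test_functions_diff:
  assumes "\<phi> \<in> test_functions U" "\<psi> \<in> test_functions U"
  shows "(\<lambda>x. \<phi> x - \<psi> x) \<in> test_functions U"
proof -
  obtain K where K: "compact K" "K \<subseteq> U" "\<And>x. x \<notin> K \<Longrightarrow> \<phi> x = 0"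
    using assms(1) by (rule test_functionsE) auto
  obtain K' where K': "compact K'" "K' \<subseteq> U" "\<And>x. x \<notin> K' \<Longrightarrow> \<psi> x = 0"
    using assms(2) by (rule test_functionsE) auto
  have "Ck k (\<lambda>x. \<phi> x + (- 1) *\<^sub>R \<psi> x)" for k
    by (intro Ck_add Ck_scaleR Ck_const test_functions_Ck[OF assms(1)] test_functions_Ck[OF assms(2)])
  then show ?thesis
    by (intro test_functionsI[of _ "K \<union> K'"]) (use K K' in auto)
qed

lemma test_functions_bounded_linear:
  assumes "\<phi> \<in> test_functions U" "bounded_linear L"
  shows "(\<lambda>x. L (\<phi> x)) \<in> test_functions U"
  by (rule test_functions_vanish[OF assms(1) Ck_bounded_linear[OF assms(2) test_functions_Ck[OF assms(1)]]])
     (simp add: linear_0 bounded_linear.linear assms(2))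

lemma bump_test_function:
  assumes "k > 0" "cbox a b \<subseteq> U"
  shows "bump k a b \<in> test_functions U"
  by (rule test_functionsI[of _ "cbox a b"])
     (use assms box_subset_cbox[of a b] in \<open>auto simp: Ck_bump bump_eq_0_iff\<close>)

lemma frechet_derivative_eq_0_outside:
  assumes "closed K" "\<And>x. x \<notin> K \<Longrightarrow> \<phi> x = 0" "x \<notin> K"
  shows "frechet_derivative \<phi> (at x) = (\<lambda>h. 0)"
proof -
  have "(\<phi> has_derivative (\<lambda>h. 0)) (at x)"
    by (rule has_derivative_transform_within_open[of "\<lambda>x. 0" "\<lambda>h. 0" x UNIV "- K"]) (use assms in auto)
  then show ?thesis
    using frechet_derivative_at by metis
qed

text \<open>An arbitrary direction is expanded in the basis, since \<open>Ck\<close> covers basis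
  directions only; off the closed set K the function is locally constant, so the derivative vanishes
  there too.\<close>

lemma test_functions_frechet_derivative:
  assumes "\<phi> \<in> test_functions U"
  shows "(\<lambda>x. frechet_derivative \<phi> (at x) h) \<in> test_functions U"
proof -
  obtain K where K: "compact K" "K \<subseteq> U" "\<And>x. x \<notin> K \<Longrightarrow> \<phi> x = 0"
    using assms(1) by (rule test_functionsE) auto
  have lin: "linear (frechet_derivative \<phi> (at x))" for x
    using test_functions_has_derivative[OF assms] by (rule has_derivative_linear)
  have eq: "frechet_derivative \<phi> (at x) h = (\<Sum>i\<in>Basis. (h \<bullet> i) *\<^sub>R frechet_derivative \<phi> (at x) i)" for x
    by (subst euclidean_representation[of h, symmetric])
       (simp add: linear_sum[OF lin] linear_scale[OF lin] del: euclidean_representation)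
  have "Ck k (\<lambda>x. frechet_derivative \<phi> (at x) i)" if "i \<in> Basis" for i k
    using test_functions_Ck[OF assms, of "Suc k"] that by simp
  then have "Ck k (\<lambda>x. frechet_derivative \<phi> (at x) h)" for k
    unfolding eq by (intro Ck_sum Ck_scaleR Ck_const)
  then show ?thesis
    by (rule test_functionsI[OF _ K(1,2)])
       (use K(3) frechet_derivative_eq_0_outside[OF compact_imp_closed[OF K(1)], of \<phi>] in simp)
qed

lemma test_functions_bounded:
  assumes "\<phi> \<in> test_functions U"
  obtains C where "C > 0" "\<And>x. norm (\<phi> x) \<le> C"
proof -
  obtain K where K: "compact K" "\<And>x. x \<notin> K \<Longrightarrow> \<phi> x = 0"
    using assms(1) by (rule test_functionsE) auto
  have "compact (\<phi> ` K)"
    using K(1) Ck_continuous[OF test_functions_Ck[OF assms]]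
    by (intro compact_continuous_image) (auto intro: continuous_on_subset)
  then obtain C where "C > 0" "\<And>y. y \<in> \<phi> ` K \<Longrightarrow> norm y \<le> C"
    using bounded_pos compact_imp_bounded by metis
  then show thesis
    using K by (intro that[of C]) (metis imageI norm_zero less_imp_le)+
qed

lemma test_functions_product:
  fixes \<phi> :: "real^'n \<Rightarrow> 'b::real_normed_vector"
  assumes "\<phi> \<in> test_functions \<Omega>" "\<eta> \<in> test_functions {0<..<T}"
  shows "(\<lambda>z. \<eta> (snd z) *\<^sub>R \<phi> (fst z)) \<in> test_functions (cylinder \<Omega> T)"
proof -
  obtain K where K: "compact K" "K \<subseteq> \<Omega>" "\<And>x. x \<notin> K \<Longrightarrow> \<phi> x = 0"
    using assms(1) by (rule test_functionsE) auto
  obtain J where J: "compact J" "J \<subseteq> {0<..<T}" "\<And>x. x \<notin> J \<Longrightarrow> \<eta> x = 0"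
    using assms(2) by (rule test_functionsE) auto
  show ?thesis
  proof (rule test_functionsI)
    show "Ck k (\<lambda>z. \<eta> (snd z) *\<^sub>R \<phi> (fst z))" for k
      by (intro Ck_scaleR Ck_compose[OF test_functions_Ck[OF assms(1)] Ck_linear[OF bounded_linear_fst]]
          Ck_compose[OF test_functions_Ck[OF assms(2)] Ck_linear[OF bounded_linear_snd]])
    show "compact (K \<times> J)" by (intro compact_Times K J)
    show "K \<times> J \<subseteq> cylinder \<Omega> T" using K J by (auto simp: cylinder_def)
    show "\<eta> (snd z) *\<^sub>R \<phi> (fst z) = 0" if "z \<notin> K \<times> J" for z
      using that K(3)[of "fst z"] J(3)[of "snd z"] by (auto simp: mem_Times_iff)
  qed
qed

subsection \<open>Weak gradients\<close>

text \<open>The function spaces are formulated with Lebesgue measurable functions, while product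
  measures and translations are handled for Borel functions on \<open>lborel\<close>. This is the
  passage from the former to the latter, coordinate by coordinate.\<close>

lemma completion_ex_borel_measurable_euclidean:
  fixes g :: "'a \<Rightarrow> 'b::euclidean_space"
  assumes "g \<in> borel_measurable (completion M)"
  obtains g' where "g' \<in> borel_measurable M" "AE x in M. g x = g' x"
proof -
  have "\<exists>g'\<in>borel_measurable M. (AE x in M. g x \<bullet> i = g' x)" for i
    using assms by (intro completion_ex_borel_measurable_real) auto
  then obtain c where c: "\<And>i. c i \<in> borel_measurable M" "\<And>i. AE x in M. g x \<bullet> i = c i x"
    by metis
  show thesis
  proof
    show "(\<lambda>x. \<Sum>i\<in>Basis. c i x *\<^sub>R i) \<in> borel_measurable M"
      using c(1) by measurable
    have "AE x in M. \<forall>i\<in>Basis. g x \<bullet> i = c i x"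
      using c(2) by (intro AE_finite_allI) auto
    then show "AE x in M. g x = (\<Sum>i\<in>Basis. c i x *\<^sub>R i)"
      by eventually_elim (metis (no_types, lifting) euclidean_representation sum.cong)
  qed
qed

text \<open>The positive and the negative part of h are densities of two measures that agree on
  boxes. Boxes are stable under intersection and generate the Borel sets, so the measures and hence
  the densities coincide, which forces both parts to vanish.\<close>

lemma AE_zero_if_box_integrals_zero:
  fixes h :: "'a::euclidean_space \<Rightarrow> real"
  assumes int: "integrable lborel h"
    and zero: "\<And>a b. (LINT x|lborel. indicator (box a b) x *\<^sub>R h x) = 0"
  shows "AE x in lborel. h x = 0"
proof -
  have [measurable]: "h \<in> borel_measurable borel"
    using int by auto
  let ?p = "\<lambda>x. max 0 (h x)" and ?n = "\<lambda>x. max 0 (- h x)"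
  have intp: "integrable lborel ?p" and intn: "integrable lborel ?n"
    using int by auto
  let ?M = "\<lambda>f. density lborel (\<lambda>x. ennreal (f x))"
  have em: "emeasure (?M f) X = ennreal (LINT x|lborel. indicator X x *\<^sub>R f x)"
    if "integrable lborel f" "\<And>x. f x \<ge> 0" "X \<in> sets borel" for f :: "'a \<Rightarrow> real" and X
  proof -
    have [measurable]: "f \<in> borel_measurable borel" using that by auto
    have "emeasure (?M f) X = (\<integral>\<^sup>+x. ennreal (indicator X x *\<^sub>R f x) \<partial>lborel)"
      using that by (subst emeasure_density) (auto intro!: nn_integral_cong split: split_indicator)
    also have "\<dots> = ennreal (LINT x|lborel. indicator X x *\<^sub>R f x)"
      using that by (intro nn_integral_eq_integral integrable_mult_indicator) auto
    finally show ?thesis .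
  qed
  have "?M ?p = ?M ?n"
  proof (rule measure_eqI_generator_eq)
    show "Int_stable (range (\<lambda>(a, b). box a b :: 'a set))"
      by (auto simp: Int_stable_def box_Int_box)
    show "emeasure (?M ?p) X = emeasure (?M ?n) X" if "X \<in> range (\<lambda>(a, b). box a b)" for X
    proof -
      obtain a b where X: "X = box a b" using \<open>X \<in> _\<close> by auto
      have "(LINT x|lborel. indicator X x *\<^sub>R ?p x) - (LINT x|lborel. indicator X x *\<^sub>R ?n x)
         = (LINT x|lborel. indicator X x *\<^sub>R h x)"
      proof -
        have "integrable lborel (\<lambda>x. indicator X x *\<^sub>R ?p x)" "integrable lborel (\<lambda>x. indicator X x *\<^sub>R ?n x)"
          using X by (auto intro: integrable_mult_indicator[OF _ intp] integrable_mult_indicator[OF _ intn] simp del: real_scaleR_def)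
        from Bochner_Integration.integral_diff[OF this] show ?thesis
          by (simp add: max_def right_diff_distrib[symmetric] if_distrib cong: if_cong)
      qed
      then show ?thesis
        using zero X by (simp add: em intp intn)
    qed
    show "sets (?M ?p) = sigma_sets UNIV (range (\<lambda>(a, b). box a b))"
      "sets (?M ?n) = sigma_sets UNIV (range (\<lambda>(a, b). box a b))"
      by (simp_all add: borel_eq_box)
    show "range (\<lambda>i. box (- real i *\<^sub>R One) (real i *\<^sub>R One)) \<subseteq> range (\<lambda>(a, b). box a b :: 'a set)"
      by auto
    show "(\<Union>i. box (- real i *\<^sub>R One) (real i *\<^sub>R One)) = (UNIV :: 'a set)"
      using UN_box_eq_UNIV by simp
    show "emeasure (?M ?p) (box (- real i *\<^sub>R One) (real i *\<^sub>R One)) \<noteq> \<infinity>" for i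
      by (simp add: em intp)
  qed auto
  then have "AE x in lborel. ennreal (?p x) = ennreal (?n x)"
    by (subst (asm) sigma_finite_measure.density_unique_iff[OF sigma_finite_lborel]) auto
  then show ?thesis
    by eventually_elim (auto simp: max_def split: if_splits)
qed

lemma borel_measurable_lebesgueI:
  fixes f :: "'a::euclidean_space \<Rightarrow> 'b::topological_space"
  shows "f \<in> borel_measurable borel \<Longrightarrow> f \<in> borel_measurable lebesgue"
  by (rule measurable_completion) simp

lemma test_functions_borel_measurable:
  "\<phi> \<in> test_functions U \<Longrightarrow> \<phi> \<in> borel_measurable borel"
  using Ck_continuous[OF test_functions_Ck] borel_measurable_continuous_onI by blast

lemma L1_loc_test_function_integrable:
  fixes v :: "'a::euclidean_space \<Rightarrow> 'b::euclidean_space"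
  assumes v: "v \<in> L1_loc U" and \<phi>: "\<phi> \<in> test_functions U" and U: "U \<in> sets borel"
  shows "integrable (lebesgue_on U) (\<lambda>x. (\<phi> x :: real) *\<^sub>R v x)"
proof -
  obtain K where K: "compact K" "K \<subseteq> U" "\<And>x. x \<notin> K \<Longrightarrow> \<phi> x = 0"
    using \<phi> by (rule test_functionsE) auto
  obtain C where C: "C > 0" "\<And>x. norm (\<phi> x) \<le> C"
    using test_functions_bounded[OF \<phi>] by auto
  have KS: "K \<in> sets lebesgue" using K by (simp add: fmeasurableD lmeasurable_compact)
  have "integrable lebesgue (\<lambda>x. indicator K x *\<^sub>R v x)"
    using v K KS by (subst (asm) L1_loc_def) (auto simp: integrable_restrict_space)
  then have "integrable lebesgue (\<lambda>x. \<phi> x *\<^sub>R (indicator K x *\<^sub>R v x))"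
  proof (rule Bochner_Integration.integrable_bound[OF integrable_scaleR_right[of C]])
    have "\<phi> \<in> borel_measurable lebesgue"
      using test_functions_borel_measurable[OF \<phi>] by (simp add: measurable_completion)
    then show "(\<lambda>x. \<phi> x *\<^sub>R (indicator K x *\<^sub>R v x)) \<in> borel_measurable lebesgue"
      by (rule borel_measurable_scaleR)
        (rule borel_measurable_integrable[OF \<open>integrable lebesgue (\<lambda>x. indicator K x *\<^sub>R v x)\<close>])
  qed (use C in \<open>auto intro!: AE_I2 mult_right_mono split: split_indicator\<close>)
  moreover have "(\<lambda>x. \<phi> x *\<^sub>R (indicator K x *\<^sub>R v x)) = (\<lambda>x. indicator U x *\<^sub>R (\<phi> x *\<^sub>R v x))"
    using K by (auto simp: fun_eq_iff split: split_indicator)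
  ultimately show ?thesis
    using U by (simp add: integrable_restrict_space)
qed

lemma AE_lebesgue_on_iff:
  "S \<in> sets lebesgue \<Longrightarrow> (AE x in lebesgue_on S. P x) \<longleftrightarrow> (AE x in lborel. x \<in> S \<longrightarrow> P x)"
  by (subst AE_restrict_space_iff) (auto simp: AE_completion_iff)

text \<open>No mollification is used: bumps converge to the indicator of a box, so v has zero
  integral over every box whose closure lies in U. Such boxes determine v almost everywhere, and
  countably many of them cover U.\<close>

lemma fundamental_lemma_calculus_of_variations:
  fixes v :: "'a::euclidean_space \<Rightarrow> real"
  assumes U: "open U" and v: "v \<in> L1_loc U"
    and zero: "\<And>\<phi>. \<phi> \<in> test_functions U \<Longrightarrow> (LINT x|lebesgue_on U. v x * \<phi> x) = 0"
  shows "AE x in lebesgue_on U. v x = 0"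
proof -
  have box_zero: "(LINT x|lebesgue. indicator (box a b) x *\<^sub>R v x) = 0" if ab: "cbox a b \<subseteq> U" for a b
  proof -
    have int: "integrable lebesgue (\<lambda>x. indicator (cbox a b) x *\<^sub>R v x)"
    proof -
      have "integrable (lebesgue_on (cbox a b)) v"
        using v ab by (simp add: L1_loc_def)
      then show ?thesis by (subst (asm) integrable_restrict_space) simp_all
    qed
    \<comment> \<open>The indicator of the closed box changes nothing where the bump is nonzero, but
      it makes v globally integrable and thus provides the majorant.\<close>
    have "(\<lambda>k. LINT x|lebesgue. bump (real k) a b x * (indicator (cbox a b) x *\<^sub>R v x))
       \<longlonglongrightarrow> (LINT x|lebesgue. indicator (box a b) x * (indicator (cbox a b) x *\<^sub>R v x))"
    proof (rule integral_dominated_convergence[where w = "\<lambda>x. norm (indicator (cbox a b) x *\<^sub>R v x)"])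
      have meas: "bump (real k) a b \<in> borel_measurable lebesgue" for k
        by (intro borel_measurable_lebesgueI borel_measurable_continuous_onI[OF Ck_continuous[OF Ck_bump]])
      show "(\<lambda>x. bump (real k) a b x * (indicator (cbox a b) x *\<^sub>R v x)) \<in> borel_measurable lebesgue" for k
        using int by (intro borel_measurable_times meas) auto
      show "(\<lambda>x. indicator (box a b) x * (indicator (cbox a b) x *\<^sub>R v x)) \<in> borel_measurable lebesgue"
        using int by (intro borel_measurable_times borel_measurable_indicator borel_measurable_integrable) auto
      show "AE x in lebesgue. (\<lambda>k. bump (real k) a b x * (indicator (cbox a b) x *\<^sub>R v x))
          \<longlonglongrightarrow> indicator (box a b) x * (indicator (cbox a b) x *\<^sub>R v x)"
        by (intro AE_I2 tendsto_mult bump_tendsto tendsto_const)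
      show "AE x in lebesgue. norm (bump (real k) a b x * (indicator (cbox a b) x *\<^sub>R v x))
          \<le> norm (indicator (cbox a b) x *\<^sub>R v x)" for k
        by (intro AE_I2) (simp add: abs_mult abs_of_nonneg[OF bump_nonneg] mult_left_le_one_le bump_le_1 bump_nonneg)
    qed (use int in auto)
    moreover have "(LINT x|lebesgue. bump (real k) a b x * (indicator (cbox a b) x *\<^sub>R v x)) = 0" if "k > 0" for k
    proof -
      have "(LINT x|lebesgue. bump (real k) a b x * (indicator (cbox a b) x *\<^sub>R v x)) =
        (LINT x|lebesgue. indicator U x *\<^sub>R (v x * bump (real k) a b x))"
        using ab \<open>k > 0\<close> box_subset_cbox[of a b]
        by (intro Bochner_Integration.integral_cong) (auto simp: bump_eq_0_iff split: split_indicator)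
      also have "\<dots> = (LINT x|lebesgue_on U. v x * bump (real k) a b x)"
        using U by (simp add: integral_restrict_space)
      also have "\<dots> = 0"
        using \<open>k > 0\<close> ab by (intro zero bump_test_function) auto
      finally show ?thesis .
    qed
    then have "(\<lambda>k. LINT x|lebesgue. bump (real k) a b x * (indicator (cbox a b) x *\<^sub>R v x)) \<longlonglongrightarrow> 0"
      by (intro tendsto_eventually eventually_sequentiallyI[of 1]) auto
    ultimately have "(LINT x|lebesgue. indicator (box a b) x * (indicator (cbox a b) x *\<^sub>R v x)) = 0"
      using LIMSEQ_unique by blast
    also have "(\<lambda>x. indicator (box a b) x * (indicator (cbox a b) x *\<^sub>R v x)) = (\<lambda>x. indicator (box a b) x *\<^sub>R v x)"
      using box_subset_cbox[of a b] by (auto simp: fun_eq_iff split: split_indicator)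
    finally show ?thesis .
  qed
  have cbox_zero: "AE x in lborel. x \<in> cbox a b \<longrightarrow> v x = 0" if ab: "cbox a b \<subseteq> U" for a b
  proof -
    have int: "integrable lebesgue (\<lambda>x. indicator (cbox a b) x *\<^sub>R v x)"
    proof -
      have "integrable (lebesgue_on (cbox a b)) v"
        using v ab by (simp add: L1_loc_def)
      then show ?thesis by (subst (asm) integrable_restrict_space) simp_all
    qed
    have "integrable lebesgue (\<lambda>x. indicator (box a b) x *\<^sub>R (indicator (cbox a b) x *\<^sub>R v x))"
      by (rule integrable_mult_indicator[OF _ int]) simp
    also have "(\<lambda>x. indicator (box a b) x *\<^sub>R (indicator (cbox a b) x *\<^sub>R v x)) = (\<lambda>x. indicator (box a b) x *\<^sub>R v x)"
      using box_subset_cbox[of a b] by (auto simp: fun_eq_iff split: split_indicator)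
    finally have intb: "integrable lebesgue (\<lambda>x. indicator (box a b) x *\<^sub>R v x)" .
    obtain h where h [measurable]: "h \<in> borel_measurable lborel"
      and hv: "AE x in lborel. indicator (box a b) x *\<^sub>R v x = h x"
      using completion_ex_borel_measurable_euclidean[OF borel_measurable_integrable[OF intb]] by auto
    have hv': "AE x in lebesgue. indicator (box a b) x *\<^sub>R v x = h x"
      using hv by (rule AE_completion)
    have hint: "integrable lborel h"
    proof -
      have "integrable lebesgue h"
        using integrable_cong_AE_imp[OF intb measurable_completion[OF h]] hv' by auto
      then show ?thesis using h by (simp add: integrable_completion)
    qed
    have "AE x in lborel. h x = 0"
    proof (rule AE_zero_if_box_integrals_zero[OF hint])
      fix c d
      \<comment> \<open>The intersection of two boxes is again a box. An empty intersection is
        represented by the corners \<open>One\<close> and \<open>0\<close>, for which the closed box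
        is empty as well and hence lies in U.\<close>
      obtain c' d' where cd: "box c d \<inter> box a b = box c' d'" "cbox c' d' \<subseteq> U"
      proof (cases "box c d \<inter> box a b = {}")
        case True
        then show ?thesis
          using that[of One 0] nonempty_Basis box_eq_empty[of One "0::'a"] by auto
      next
        case False
        obtain c' d' where *: "box c d \<inter> box a b = box c' d'"
          using box_Int_box by blast
        then have "closure (box c' d') \<subseteq> closure (box a b)"
          by (metis closure_mono inf_le2)
        then have "cbox c' d' \<subseteq> cbox a b"
          using False * by (metis closure_box closure_subset inf_bot_right order_trans)
        then show ?thesis using that * ab by blast
      qed
      have "(LINT x|lborel. indicator (box c d) x *\<^sub>R h x) = (LINT x|lebesgue. indicator (box c d) x *\<^sub>R h x)"
        by (rule integral_completion[symmetric]) measurable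
      also have "\<dots> = (LINT x|lebesgue. indicator (box c d) x *\<^sub>R (indicator (box a b) x *\<^sub>R v x))"
      proof (rule integral_cong_AE)
        show "(\<lambda>x. indicator (box c d) x *\<^sub>R h x) \<in> borel_measurable lebesgue"
          by (rule borel_measurable_lebesgueI) (use h in measurable)
        show "(\<lambda>x. indicator (box c d) x *\<^sub>R (indicator (box a b) x *\<^sub>R v x)) \<in> borel_measurable lebesgue"
          by (rule borel_measurable_integrable[OF integrable_mult_indicator[OF _ intb]]) simp
        show "AE x in lebesgue. indicator (box c d) x *\<^sub>R h x = indicator (box c d) x *\<^sub>R (indicator (box a b) x *\<^sub>R v x)"
          using hv' by eventually_elim simp
      qed
      also have "\<dots> = (LINT x|lebesgue. indicator (box c' d') x *\<^sub>R v x)"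
        unfolding cd(1)[symmetric] by (simp add: indicator_inter_arith mult.assoc)
      also have "\<dots> = 0" by (rule box_zero[OF cd(2)])
      finally show "(LINT x|lborel. indicator (box c d) x *\<^sub>R h x) = 0" .
    qed
    \<comment> \<open>Vanishing is known on the open box so far; its boundary is a null set.\<close>
    moreover have "cbox a b - box a b \<in> null_sets lebesgue"
      using negligible_frontier_interval negligible_iff_null_sets by blast
    then have "AE x in lborel. x \<notin> cbox a b - box a b"
      using AE_not_in AE_completion_iff by blast
    ultimately show ?thesis
      using hv by eventually_elim auto
  qed
  obtain D where D: "countable D" "D \<subseteq> Pow U" "\<And>X. X \<in> D \<Longrightarrow> \<exists>a b. X = cbox a b" "\<Union>D = U"
    using open_countable_Union_open_cbox[OF U] by metis
  have "AE x in lborel. \<forall>X\<in>D. x \<in> X \<longrightarrow> v x = 0"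
    using D by (subst AE_ball_countable) (metis PowD cbox_zero subsetD)+
  then have "AE x in lborel. x \<in> U \<longrightarrow> v x = 0"
    by eventually_elim (use D in auto)
  then show ?thesis
    using U by (simp add: AE_lebesgue_on_iff)
qed

text \<open>Each entry of the difference is annihilated by all test functions. This makes the
  arbitrary choice in \<open>weak_gradient\<close> harmless: any weak gradient at hand may replace
  it under an integral.\<close>

lemma has_weak_gradient_unique:
  assumes U: "open U" and "has_weak_gradient U v G" "has_weak_gradient U v G'"
  shows "AE x in lebesgue_on U. G x = G' x"
proof -
  have "AE x in lebesgue_on U. G x $ j $ i - G' x $ j $ i = 0" for j i
  proof (rule fundamental_lemma_calculus_of_variations[OF U])
    have L1: "(\<lambda>x. G x $ j $ i) \<in> L1_loc U" "(\<lambda>x. G' x $ j $ i) \<in> L1_loc U"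
      using assms by (auto simp: has_weak_gradient_def L1_loc_def
        intro!: integrable_bounded_linear[OF bounded_linear_compose[OF bounded_linear_vec_nth bounded_linear_vec_nth]])
    then show "(\<lambda>x. G x $ j $ i - G' x $ j $ i) \<in> L1_loc U"
      by (auto simp: L1_loc_def)
    fix \<phi> :: "real^'a \<Rightarrow> real" assume \<phi>: "\<phi> \<in> test_functions U"
    have "(LINT x|lebesgue_on U. (G x $ j $ i - G' x $ j $ i) * \<phi> x) =
       (LINT x|lebesgue_on U. G x $ j $ i * \<phi> x) - (LINT x|lebesgue_on U. G' x $ j $ i * \<phi> x)"
      using L1_loc_test_function_integrable[OF L1(1) \<phi>] L1_loc_test_function_integrable[OF L1(2) \<phi>] U
      by (subst Bochner_Integration.integral_diff[symmetric]) (auto simp: algebra_simps)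
    also have "\<dots> = 0"
    proof -
      have "(LINT x|lebesgue_on U. v x $ j * frechet_derivative \<phi> (at x) (axis i 1)) = - (LINT x|lebesgue_on U. H x $ j $ i * \<phi> x)"
        if "has_weak_gradient U v H" for H
        using that \<phi> by (simp add: has_weak_gradient_def)
      from this[OF assms(2)] this[OF assms(3)] show ?thesis by simp
    qed
    finally show "(LINT x|lebesgue_on U. (G x $ j $ i - G' x $ j $ i) * \<phi> x) = 0" .
  qed
  then have "AE x in lebesgue_on U. \<forall>j i. G x $ j $ i - G' x $ j $ i = 0"
    by (simp add: AE_all_countable)
  then show ?thesis
    by eventually_elim (simp add: vec_eq_iff)
qed

lemma has_weak_gradient_diff:
  assumes U: "open U" and "has_weak_gradient U v G" "has_weak_gradient U v' G'"
  shows "has_weak_gradient U (\<lambda>x. v x - v' x) (\<lambda>x. G x - G' x)"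
  unfolding has_weak_gradient_def
proof (intro conjI ballI allI)
  have L1: "v \<in> L1_loc U" "G \<in> L1_loc U" "v' \<in> L1_loc U" "G' \<in> L1_loc U"
    using assms by (auto simp: has_weak_gradient_def)
  then show "(\<lambda>x. v x - v' x) \<in> L1_loc U" "(\<lambda>x. G x - G' x) \<in> L1_loc U"
    by (auto simp: L1_loc_def)
  fix \<phi> :: "real^'a \<Rightarrow> real" and i :: 'a and j :: 'b assume \<phi>: "\<phi> \<in> test_functions U"
  have comp: "(\<lambda>x. G x $ j $ i) \<in> L1_loc U" if "G \<in> L1_loc U" for G :: "real^'a \<Rightarrow> real^'a^'b"
    using that by (auto simp: L1_loc_def
        intro!: integrable_bounded_linear[OF bounded_linear_compose[OF bounded_linear_vec_nth bounded_linear_vec_nth]])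
  have comp': "(\<lambda>x. v x $ j) \<in> L1_loc U" if "v \<in> L1_loc U" for v :: "real^'a \<Rightarrow> real^'b"
    using that by (auto simp: L1_loc_def intro!: integrable_bounded_linear[OF bounded_linear_vec_nth])
  note test = test_functions_frechet_derivative[OF \<phi>, of "axis i 1"]
  note int = L1_loc_test_function_integrable[OF comp[OF L1(2)] \<phi>] L1_loc_test_function_integrable[OF comp[OF L1(4)] \<phi>]
    L1_loc_test_function_integrable[OF comp'[OF L1(1)] test] L1_loc_test_function_integrable[OF comp'[OF L1(3)] test]
  have "(LINT x|lebesgue_on U. (v x - v' x) $ j * frechet_derivative \<phi> (at x) (axis i 1)) =
     (LINT x|lebesgue_on U. v x $ j * frechet_derivative \<phi> (at x) (axis i 1)) -
     (LINT x|lebesgue_on U. v' x $ j * frechet_derivative \<phi> (at x) (axis i 1))"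
    using int U by (subst Bochner_Integration.integral_diff[symmetric]) (auto simp: algebra_simps)
  also have "\<dots> = - (LINT x|lebesgue_on U. G x $ j $ i * \<phi> x) + (LINT x|lebesgue_on U. G' x $ j $ i * \<phi> x)"
    using assms \<phi> by (simp add: has_weak_gradient_def)
  also have "\<dots> = - ((LINT x|lebesgue_on U. G x $ j $ i * \<phi> x) - (LINT x|lebesgue_on U. G' x $ j $ i * \<phi> x))"
    by simp
  also have "(LINT x|lebesgue_on U. G x $ j $ i * \<phi> x) - (LINT x|lebesgue_on U. G' x $ j $ i * \<phi> x) =
     (LINT x|lebesgue_on U. (G x - G' x) $ j $ i * \<phi> x)"
    using int U by (subst Bochner_Integration.integral_diff[symmetric]) (auto simp: algebra_simps)
  finally show "(LINT x|lebesgue_on U. (v x - v' x) $ j * frechet_derivative \<phi> (at x) (axis i 1)) =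
     - (LINT x|lebesgue_on U. (G x - G' x) $ j $ i * \<phi> x)" .
qed

section \<open>Integration by parts for test functions\<close>

lemma test_functions_integrable:
  fixes \<phi> :: "'a::euclidean_space \<Rightarrow> 'b::euclidean_space"
  assumes \<phi>: "\<phi> \<in> test_functions U"
  shows "integrable lborel \<phi>"
proof -
  obtain K where K: "compact K" "\<And>x. x \<notin> K \<Longrightarrow> \<phi> x = 0"
    using \<phi> by (rule test_functionsE) auto
  obtain C where C: "C > 0" "\<And>x. norm (\<phi> x) \<le> C"
    using test_functions_bounded[OF \<phi>] by auto
  have "integrable lborel (\<lambda>x. C * indicator K x)"
    using K(1) by (intro integrable_mult_right integrable_real_indicator)
      (use emeasure_compact_finite[OF K(1)] in \<open>auto simp: borel_compact\<close>)
  then show ?thesis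
    by (rule Bochner_Integration.integrable_bound)
       (use test_functions_borel_measurable[OF \<phi>] C K in \<open>auto intro!: AE_I2 split: split_indicator\<close>)
qed

lemma integral_lborel_translation:
  fixes f :: "'a::euclidean_space \<Rightarrow> 'b::{banach, second_countable_topology}"
  assumes "f \<in> borel_measurable borel"
  shows "(LINT x|lborel. f (c + x)) = (LINT x|lborel. f x)"
    and "integrable lborel (\<lambda>x. f (c + x)) \<longleftrightarrow> integrable lborel f"
proof -
  have "(LINT x|distr lborel borel ((+) c). f x) = (LINT x|lborel. f (c + x))"
    using assms by (intro integral_distr) auto
  then show "(LINT x|lborel. f (c + x)) = (LINT x|lborel. f x)"
    by (simp add: lborel_distr_plus)
  have "integrable (distr lborel borel ((+) c)) f \<longleftrightarrow> integrable lborel (\<lambda>x. f (c + x))"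
    using assms by (intro integrable_distr_eq) auto
  then show "integrable lborel (\<lambda>x. f (c + x)) \<longleftrightarrow> integrable lborel f"
    by (simp add: lborel_distr_plus)
qed

text \<open>By translation invariance every difference quotient of h has integral zero. The
  quotients converge to the directional derivative, and the mean value theorem bounds them by a
  constant on a fixed ball, so the limit has integral zero as well.\<close>

lemma integral_derivative_test_function:
  fixes h :: "'a::euclidean_space \<Rightarrow> real"
  assumes h: "h \<in> test_functions U"
  shows "(LINT x|lborel. frechet_derivative h (at x) e) = 0"
proof -
  obtain K where K: "compact K" "\<And>x. x \<notin> K \<Longrightarrow> h x = 0"
    using h by (rule test_functionsE) auto
  obtain R where R: "\<And>x. x \<in> K \<Longrightarrow> norm x \<le> R"
    using compact_imp_bounded[OF K(1)] unfolding bounded_iff by auto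
  obtain C where C: "C > 0" "\<And>x. norm (frechet_derivative h (at x) e) \<le> C"
    using test_functions_bounded[OF test_functions_frechet_derivative[OF h]] by auto
  note int = test_functions_integrable[OF h]
  have [measurable]: "h \<in> borel_measurable borel"
    by (rule test_functions_borel_measurable[OF h])
  have lin: "linear (frechet_derivative h (at x))" for x
    using test_functions_has_derivative[OF h] by (rule has_derivative_linear)
  have line: "((\<lambda>s. h (x + s *\<^sub>R e)) has_field_derivative frechet_derivative h (at (x + s *\<^sub>R e)) e) (at s)" for x s
  proof -
    have "((\<lambda>s. x + s *\<^sub>R e) has_derivative (\<lambda>s. s *\<^sub>R e)) (at s)"
      by (auto intro!: derivative_eq_intros)
    from has_derivative_compose[OF this test_functions_has_derivative[OF h]]
    show ?thesis
      unfolding has_field_derivative_def by (simp add: linear_scale[OF lin] mult_commute_abs)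
  qed
  define d where "d k x = (h (x + (1 / real (Suc k)) *\<^sub>R e) - h x) * real (Suc k)" for k x
  \<comment> \<open>The step lengths 1/(k + 1) are at most 1, so outside the ball of radius R + |e|
    neither x nor the shifted point can lie in K.\<close>
  have d_le: "norm (d k x) \<le> C * indicator (cball 0 (R + norm e)) x" for k x
  proof (cases "x \<in> cball 0 (R + norm e)")
    case True
    obtain s where s: "h (x + (1 / real (Suc k)) *\<^sub>R e) - h (x + 0 *\<^sub>R e)
       = (1 / real (Suc k) - 0) * frechet_derivative h (at (x + s *\<^sub>R e)) e"
      using MVT2[of 0 "1 / real (Suc k)" "\<lambda>s. h (x + s *\<^sub>R e)", OF _ line] by auto
    then have "d k x = frechet_derivative h (at (x + s *\<^sub>R e)) e"
      by (simp add: d_def)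
    then show ?thesis
      using C True by simp
  next
    case False
    then have "x \<notin> K" "x + (1 / real (Suc k)) *\<^sub>R e \<notin> K"
    proof -
      have "norm ((1 / real (Suc k)) *\<^sub>R e) \<le> norm e"
        by (simp add: mult_left_le_one_le field_simps)
      moreover have "norm x \<le> norm (x + (1 / real (Suc k)) *\<^sub>R e) + norm ((1 / real (Suc k)) *\<^sub>R e)"
        by (metis add_diff_cancel_right' norm_triangle_ineq4)
      ultimately show "x + (1 / real (Suc k)) *\<^sub>R e \<notin> K"
        using False R[of "x + (1 / real (Suc k)) *\<^sub>R e"] by auto
      show "x \<notin> K"
        using False R[of x] norm_ge_zero[of e] by auto
    qed
    then show ?thesis by (simp add: d_def K(2) C(1) less_imp_le)
  qed
  have "(\<lambda>k. LINT x|lborel. d k x) \<longlonglongrightarrow> (LINT x|lborel. frechet_derivative h (at x) e)"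
  proof (rule integral_dominated_convergence)
    show "(\<lambda>x. frechet_derivative h (at x) e) \<in> borel_measurable lborel"
      using test_functions_borel_measurable[OF test_functions_frechet_derivative[OF h]] by simp
    show "d k \<in> borel_measurable lborel" for k
      unfolding d_def by measurable
    show "integrable lborel (\<lambda>x. C * indicator (cball 0 (R + norm e)) x)"
      by (intro integrable_mult_right integrable_real_indicator)
        (use emeasure_compact_finite[OF compact_cball] in auto)
    show "AE x in lborel. norm (d k x) \<le> C * indicator (cball 0 (R + norm e)) x" for k
      by (rule AE_I2) (rule d_le)
    have "(\<lambda>k. d k x) \<longlonglongrightarrow> frechet_derivative h (at x) e" for x
    proof -
      have "((\<lambda>s. (h (x + s *\<^sub>R e) - h x) / s) \<longlongrightarrow> frechet_derivative h (at x) e) (at 0)"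
        using line[of x 0] by (simp add: has_field_derivative_iff)
      moreover have "filterlim (\<lambda>k. 1 / real (Suc k)) (at 0) sequentially"
        using LIMSEQ_inverse_real_of_nat by (auto simp: filterlim_at inverse_eq_divide)
      ultimately have "(\<lambda>k. (h (x + (1 / real (Suc k)) *\<^sub>R e) - h x) / (1 / real (Suc k))) \<longlonglongrightarrow> frechet_derivative h (at x) e"
        by (rule filterlim_compose)
      then show ?thesis by (simp add: d_def)
    qed
    then show "AE x in lborel. (\<lambda>k. d k x) \<longlonglongrightarrow> frechet_derivative h (at x) e"
      by simp
  qed
  moreover have "(LINT x|lborel. d k x) = 0" for k
  proof -
    have "(LINT x|lborel. d k x) = (LINT x|lborel. h ((1 / real (Suc k)) *\<^sub>R e + x) - h x) * real (Suc k)"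
      unfolding d_def by (subst add.commute) (rule integral_mult_left_zero)
    also have "(LINT x|lborel. h ((1 / real (Suc k)) *\<^sub>R e + x) - h x) = 0"
      using int by (subst Bochner_Integration.integral_diff) (auto simp: integral_lborel_translation)
    finally show ?thesis by simp
  qed
  ultimately show ?thesis
    by (simp add: LIMSEQ_const_iff)
qed

lemma frechet_derivative_component:
  fixes \<phi> :: "'a::real_normed_vector \<Rightarrow> real^'m"
  assumes "(\<phi> has_derivative frechet_derivative \<phi> (at x)) (at x)"
  shows "frechet_derivative (\<lambda>x. \<phi> x $ j) (at x) h = frechet_derivative \<phi> (at x) h $ j"
proof -
  have "((\<lambda>x. \<phi> x $ j) has_derivative (\<lambda>h. frechet_derivative \<phi> (at x) h $ j)) (at x)"
    using assms by (rule bounded_linear.has_derivative[OF bounded_linear_vec_nth])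
  from fun_cong[OF frechet_derivative_at[OF this], of h] show ?thesis by simp
qed

lemma integrable_imp_L1_loc:
  fixes f :: "'a::euclidean_space \<Rightarrow> 'b::euclidean_space"
  assumes "integrable (lebesgue_on U) f" "U \<in> sets lebesgue"
  shows "f \<in> L1_loc U"
  unfolding L1_loc_def
proof (safe)
  fix K assume K: "compact K" "K \<subseteq> U"
  then have KS: "K \<in> sets lebesgue" by (simp add: fmeasurableD lmeasurable_compact)
  have "integrable lebesgue (\<lambda>x. indicator K x *\<^sub>R (indicator U x *\<^sub>R f x))"
  proof (rule integrable_mult_indicator[OF KS])
    show "integrable lebesgue (\<lambda>x. indicator U x *\<^sub>R f x)"
      using assms(1) by (subst (asm) integrable_restrict_space) (use assms(2) in simp_all)
  qed
  also have "(\<lambda>x. indicator K x *\<^sub>R (indicator U x *\<^sub>R f x)) = (\<lambda>x. indicator K x *\<^sub>R f x)"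
    using K by (auto simp: fun_eq_iff split: split_indicator)
  finally show "integrable (lebesgue_on K) f"
    using KS by (simp add: integrable_restrict_space)
qed

lemma integral_lebesgue_on_eq_lborel:
  fixes f :: "'a::euclidean_space \<Rightarrow> 'b::euclidean_space"
  assumes "f \<in> borel_measurable borel" "\<And>x. x \<notin> U \<Longrightarrow> f x = 0" "U \<in> sets lebesgue"
  shows "(LINT x|lebesgue_on U. f x) = (LINT x|lborel. f x)"
    and "integrable (lebesgue_on U) f \<longleftrightarrow> integrable lborel f"
proof -
  have "(\<lambda>x. indicator U x *\<^sub>R f x) = f"
    using assms by (auto simp: fun_eq_iff split: split_indicator)
  then show "(LINT x|lebesgue_on U. f x) = (LINT x|lborel. f x)"
     "integrable (lebesgue_on U) f \<longleftrightarrow> integrable lborel f"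
    using assms by (simp_all add: integral_restrict_space integrable_restrict_space
      integral_completion integrable_completion)
qed

lemma test_functions_zero_outside: "\<phi> \<in> test_functions U \<Longrightarrow> x \<notin> U \<Longrightarrow> \<phi> x = 0"
  by (metis test_functionsE subsetD)

lemma test_functions_integral_lebesgue_on:
  fixes \<phi> :: "'a::euclidean_space \<Rightarrow> 'b::euclidean_space"
  assumes "\<phi> \<in> test_functions U" "U \<in> sets lebesgue"
  shows "(LINT x|lebesgue_on U. \<phi> x) = (LINT x|lborel. \<phi> x)"
  using test_functions_borel_measurable[OF assms(1)] test_functions_zero_outside[OF assms(1)] assms(2)
  by (rule integral_lebesgue_on_eq_lborel)

lemma jacobian_test_function:
  fixes \<phi> :: "real^'n \<Rightarrow> real^'m"
  assumes \<phi>: "\<phi> \<in> test_functions U"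
  shows "(\<lambda>x. jacobian \<phi> (at x)) \<in> borel_measurable borel"
    and "x \<notin> U \<Longrightarrow> jacobian \<phi> (at x) = 0"
    and "jacobian \<phi> (at x) $ j $ i = frechet_derivative \<phi> (at x) (axis i 1) $ j"
    and "\<exists>C>0. \<forall>x. norm (jacobian \<phi> (at x)) \<le> C"
    and "integrable lborel (\<lambda>x. jacobian \<phi> (at x))"
proof -
  show comp: "jacobian \<phi> (at x) $ j $ i = frechet_derivative \<phi> (at x) (axis i 1) $ j" for x i j
    by (simp add: jacobian_def matrix_def)
  note test = test_functions_frechet_derivative[OF \<phi>]
  show zero: "jacobian \<phi> (at x) = 0" if "x \<notin> U" for x
    using test_functions_zero_outside[OF test that] by (simp add: vec_eq_iff comp)
  \<comment> \<open>Expansion along the matrix units reduces measurability, integrability and the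
    bound to the entries, each of which is a scalar test function.\<close>
  have eq: "jacobian \<phi> (at x) = (\<Sum>i\<in>UNIV. \<Sum>j\<in>UNIV. frechet_derivative \<phi> (at x) (axis i 1) $ j *\<^sub>R axis j (axis i 1))" for x
    by (simp add: vec_eq_iff comp axis_def sum.delta if_distrib if_distribR cong: if_cong)
  have t: "(\<lambda>x. frechet_derivative \<phi> (at x) (axis i 1) $ j) \<in> test_functions U" for i j
    by (rule test_functions_bounded_linear[OF test bounded_linear_vec_nth])
  show "(\<lambda>x. jacobian \<phi> (at x)) \<in> borel_measurable borel"
    unfolding eq using test_functions_borel_measurable[OF t] by measurable
  show "integrable lborel (\<lambda>x. jacobian \<phi> (at x))"
    unfolding eq using test_functions_integrable[OF t]
    by (intro Bochner_Integration.integrable_sum integrable_scaleR_left) auto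
  have "\<exists>C>0. \<forall>x. norm (frechet_derivative \<phi> (at x) (axis i 1) $ j) \<le> C" for i j
    using test_functions_bounded[OF t] by metis
  then obtain C where C: "\<And>i j. C i j > 0" "\<And>i j x. norm (frechet_derivative \<phi> (at x) (axis i 1) $ j) \<le> C i j"
    by metis
  have "norm (jacobian \<phi> (at x)) \<le> 1 + (\<Sum>i\<in>UNIV. \<Sum>j\<in>UNIV. C i j)" for x
  proof -
    have "norm (jacobian \<phi> (at x)) \<le> (\<Sum>i\<in>UNIV. \<Sum>j\<in>UNIV. C i j)"
      unfolding eq
      by (intro order_trans[OF norm_sum] sum_mono) (use C(2) in \<open>simp add: norm_eq_sqrt_inner inner_axis_axis\<close>)
    then show ?thesis by simp
  qed
  moreover have "1 + (\<Sum>i\<in>UNIV. \<Sum>j\<in>UNIV. C i j) > 0"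
    using C(1) by (intro add_pos_nonneg sum_nonneg) (auto intro: less_imp_le)
  ultimately show "\<exists>C>0. \<forall>x. norm (jacobian \<phi> (at x)) \<le> C"
    by blast
qed

text \<open>The product of a component of \<phi> with \<psi> is a test function, so its derivative
  has integral zero; the product rule splits this into the two sides of the defining
  identity.\<close>

lemma has_weak_gradient_test_function:
  fixes \<phi> :: "real^'n \<Rightarrow> real^'m"
  assumes U: "open U" and \<phi>: "\<phi> \<in> test_functions U"
  shows "has_weak_gradient U \<phi> (\<lambda>x. jacobian \<phi> (at x))"
  unfolding has_weak_gradient_def
proof (intro conjI ballI allI)
  have S: "U \<in> sets lebesgue" using U by simp
  show "\<phi> \<in> L1_loc U"
    using S test_functions_integrable[OF \<phi>] test_functions_borel_measurable[OF \<phi>] test_functions_zero_outside[OF \<phi>]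
    by (intro integrable_imp_L1_loc) (auto simp: integral_lebesgue_on_eq_lborel)
  show "(\<lambda>x. jacobian \<phi> (at x)) \<in> L1_loc U"
    using S jacobian_test_function[OF \<phi>]
    by (intro integrable_imp_L1_loc) (auto simp: integral_lebesgue_on_eq_lborel)
  fix \<psi> :: "real^'n \<Rightarrow> real" and i :: 'n and j :: 'm assume \<psi>: "\<psi> \<in> test_functions U"
  let ?f = "\<lambda>x. \<phi> x $ j"
  let ?D = "\<lambda>f x. frechet_derivative f (at x) (axis i 1) :: real"
  have f: "?f \<in> test_functions U"
    by (rule test_functions_bounded_linear[OF \<phi> bounded_linear_vec_nth])
  have Df: "?D ?f x = jacobian \<phi> (at x) $ j $ i" for x
    using test_functions_has_derivative[OF \<phi>]
    by (simp add: jacobian_test_function(3)[OF \<phi>] frechet_derivative_component)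
  have t1: "(\<lambda>x. ?f x * ?D \<psi> x) \<in> test_functions U"
    using test_functions_scaleR[OF f test_functions_Ck[OF test_functions_frechet_derivative[OF \<psi>]]] by simp
  have t2: "(\<lambda>x. ?D ?f x * \<psi> x) \<in> test_functions U"
    using test_functions_scaleR[OF test_functions_frechet_derivative[OF f] test_functions_Ck[OF \<psi>]] by simp
  have t: "(\<lambda>x. ?f x * \<psi> x) \<in> test_functions U"
    using test_functions_scaleR[OF f test_functions_Ck[OF \<psi>]] by simp
  have "((\<lambda>x. ?f x * \<psi> x) has_derivative
      (\<lambda>h. ?f x * frechet_derivative \<psi> (at x) h + frechet_derivative ?f (at x) h * \<psi> x)) (at x)" for x
    by (rule has_derivative_mult[OF test_functions_has_derivative[OF f] test_functions_has_derivative[OF \<psi>]])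
  from fun_cong[OF frechet_derivative_at[OF this], of _ "axis i 1", symmetric]
  have "?D (\<lambda>x. ?f x * \<psi> x) x = ?f x * ?D \<psi> x + ?D ?f x * \<psi> x" for x .
  then have "(LINT x|lborel. ?f x * ?D \<psi> x + ?D ?f x * \<psi> x) = 0"
    using integral_derivative_test_function[OF t, of "axis i 1"] by simp
  then have "(LINT x|lborel. ?f x * ?D \<psi> x) = - (LINT x|lborel. ?D ?f x * \<psi> x)"
    using test_functions_integrable[OF t1] test_functions_integrable[OF t2] by simp
  then show "(LINT x|lebesgue_on U. ?f x * ?D \<psi> x) = - (LINT x|lebesgue_on U. jacobian \<phi> (at x) $ j $ i * \<psi> x)"
    using test_functions_integral_lebesgue_on[OF t1 S] test_functions_integral_lebesgue_on[OF t2 S] Df by simp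
qed

subsection \<open>Continuity of translations\<close>

text \<open>Young's inequality for l b and a / l, with the factors 1/p and 1/q dropped. The free
  weight l shifts smallness from one term to the other, so an additive bound can do the work of
  Hoelder's inequality.\<close>

lemma Youngs_inequality_scaled:
  fixes p q :: real
  assumes "p > 1" "q > 1" "1 / p + 1 / q = 1" "a \<ge> 0" "b \<ge> 0" "l > 0"
  shows "a * b \<le> l powr (- q) * a powr q + l powr p * b powr p"
proof -
  have "a * b = (l * b) * (a / l)"
    using assms by simp
  also have "\<dots> \<le> (l * b) powr p / p + (a / l) powr q / q"
    using assms by (intro Youngs_inequality) auto
  also have "\<dots> \<le> (l * b) powr p + (a / l) powr q"
    using assms by (intro add_mono) (auto simp: divide_le_eq mult_left_le intro: mult_le_cancel_left1[THEN iffD2])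
  also have "\<dots> = l powr (- q) * a powr q + l powr p * b powr p"
    using assms by (simp add: powr_mult powr_divide powr_minus field_simps)
  finally show ?thesis .
qed

lemma integral_lborel_shift:
  fixes f :: "'a::euclidean_space \<Rightarrow> 'b::{banach, second_countable_topology}"
  assumes "integrable lborel f"
  shows "integrable lborel (\<lambda>z. f (z - y))" and "(LINT z|lborel. f (z - y)) = (LINT z|lborel. f z)"
  using integral_lborel_translation[of f "- y"] assms by auto

text \<open>
  For open \<open>V\<close> the product of \<open>1\<^sub>V(z - y)\<close> and \<open>1\<^sub>V(z)\<close> tends to \<open>1\<^sub>V(z)\<close> for every \<open>z\<close>; outer regularity
  reduces the general case to this one.
\<close>

lemma tendsto_integral_indicator_translation:
  fixes Y :: "nat \<Rightarrow> 'a::euclidean_space"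
  assumes Y: "Y \<longlonglongrightarrow> 0" and A: "A \<in> sets borel" "emeasure lborel A < \<infinity>"
  shows "(\<lambda>k. LINT z|lborel. \<bar>indicat_real A (z - Y k) - indicat_real A z\<bar>) \<longlonglongrightarrow> 0"
proof (rule LIMSEQ_I)
  fix e :: real assume e: "e > 0"
  have iA: "integrable lborel (indicat_real A)"
    using A by (auto simp: less_top)
  note tr = integral_lborel_shift[where f = "indicat_real _"]
  obtain V where V: "open V" "A \<subseteq> V" "V - A \<in> lmeasurable" "emeasure lebesgue (V - A) < ennreal (e / 4)"
    using sets_lebesgue_outer_open[of A "e / 4"] A(1) e by auto
  have [measurable]: "V \<in> sets borel" "A \<in> sets borel" using V A by auto
  have VA: "emeasure lborel (V - A) < ennreal (e / 4)"
    using V(4) by (simp add: emeasure_completion main_part_sets)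
  have "V = A \<union> (V - A)" using V(2) by auto
  then have "emeasure lborel V \<le> emeasure lborel A + emeasure lborel (V - A)"
    by (metis emeasure_subadditive \<open>A \<in> sets borel\<close> \<open>V \<in> sets borel\<close> sets.Diff sets_lborel)
  also have "\<dots> < \<infinity>"
    using A(2) order_less_trans[OF VA ennreal_less_top] by simp
  finally have iV: "integrable lborel (indicat_real V)"
    by (auto simp: less_top)
  have conv: "(\<lambda>k. LINT z|lborel. indicat_real V (z - Y k) * indicat_real V z) \<longlonglongrightarrow> (LINT z|lborel. indicat_real V z)"
  proof (rule integral_dominated_convergence[where w = "indicat_real V"])
    show "AE z in lborel. (\<lambda>k. indicat_real V (z - Y k) * indicat_real V z) \<longlonglongrightarrow> indicat_real V z"
    proof (rule AE_I2)
      fix z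
      show "(\<lambda>k. indicat_real V (z - Y k) * indicat_real V z) \<longlonglongrightarrow> indicat_real V z"
      proof (cases "z \<in> V")
        case True
        have "(\<lambda>k. z - Y k) \<longlonglongrightarrow> z - 0"
          by (intro tendsto_intros Y)
        then have "\<forall>\<^sub>F k in sequentially. z - Y k \<in> V"
          using topological_tendstoD[of "\<lambda>k. z - Y k" z sequentially V] V(1) True by simp
        then show ?thesis
          using True by (intro tendsto_eventually) (auto elim: eventually_mono)
      qed simp
    qed
  qed (use iV in \<open>auto split: split_indicator\<close>)
  have iVV: "integrable lborel (\<lambda>z. indicat_real V (z - Y k) * indicat_real V z)" for k
    by (rule Bochner_Integration.integrable_bound[OF iV]) (auto split: split_indicator)
  \<comment> \<open>For values 0 and 1 one has |a - b| = a + b - 2 a b, and both single terms have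
    the same integral by translation invariance.\<close>
  have eqV: "(LINT z|lborel. \<bar>indicat_real V (z - Y k) - indicat_real V z\<bar>) =
     2 * (LINT z|lborel. indicat_real V z) - 2 * (LINT z|lborel. indicat_real V (z - Y k) * indicat_real V z)" for k
  proof -
    have "(LINT z|lborel. \<bar>indicat_real V (z - Y k) - indicat_real V z\<bar>) =
      (LINT z|lborel. (indicat_real V (z - Y k) + indicat_real V z) - 2 * (indicat_real V (z - Y k) * indicat_real V z))"
      by (intro Bochner_Integration.integral_cong) (auto split: split_indicator)
    also have "\<dots> = (LINT z|lborel. indicat_real V (z - Y k) + indicat_real V z) - (LINT z|lborel. 2 * (indicat_real V (z - Y k) * indicat_real V z))"
      using tr(1)[OF iV] iV iVV by (intro Bochner_Integration.integral_diff) auto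
    also have "(LINT z|lborel. indicat_real V (z - Y k) + indicat_real V z) = (LINT z|lborel. indicat_real V (z - Y k)) + (LINT z|lborel. indicat_real V z)"
      using tr(1)[OF iV] iV by (intro Bochner_Integration.integral_add) auto
    finally show ?thesis using tr(2)[OF iV] by simp
  qed
  have "(\<lambda>k. LINT z|lborel. \<bar>indicat_real V (z - Y k) - indicat_real V z\<bar>) \<longlonglongrightarrow> 2 * (LINT z|lborel. indicat_real V z) - 2 * (LINT z|lborel. indicat_real V z)"
    unfolding eqV by (intro tendsto_intros conv)
  then have "(\<lambda>k. LINT z|lborel. \<bar>indicat_real V (z - Y k) - indicat_real V z\<bar>) \<longlonglongrightarrow> 0"
    by simp
  then have "\<forall>\<^sub>F k in sequentially. (LINT z|lborel. \<bar>indicat_real V (z - Y k) - indicat_real V z\<bar>) < e / 4"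
    by (rule order_tendstoD(2)) (use e in simp)
  then obtain k0 where k0: "\<And>k. k \<ge> k0 \<Longrightarrow> (LINT z|lborel. \<bar>indicat_real V (z - Y k) - indicat_real V z\<bar>) < e / 4"
    by (auto simp: eventually_sequentially)
  have iD: "integrable lborel (indicat_real (V - A))"
    using order_less_trans[OF VA ennreal_less_top] by simp
  have D: "(LINT z|lborel. indicat_real (V - A) z) < e / 4"
  proof -
    have "measure lborel (V - A) < e / 4"
      using VA e emeasure_eq_ennreal_measure[of lborel "V - A"] order_less_trans[OF VA ennreal_less_top]
      by (metis ennreal_less_iff measure_nonneg less_top)
    then show ?thesis by simp
  qed
  have "norm ((LINT z|lborel. \<bar>indicat_real A (z - Y k) - indicat_real A z\<bar>) - 0) < e" if "k \<ge> k0" for k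
  proof -
    \<comment> \<open>Replacing A by the open set V costs the excess V - A once at z and once at its
      translate. Together with the term for V these are three contributions below e / 4.\<close>
    have "(LINT z|lborel. \<bar>indicat_real A (z - Y k) - indicat_real A z\<bar>) \<le>
      (LINT z|lborel. (\<bar>indicat_real V (z - Y k) - indicat_real V z\<bar> + indicat_real (V - A) (z - Y k)) + indicat_real (V - A) z)"
      by (rule integral_mono)
        (use tr(1)[OF iA] iA tr(1)[OF iV] iV tr(1)[OF iD] iD V(2) in \<open>auto split: split_indicator\<close>)
    also have "\<dots> = (LINT z|lborel. \<bar>indicat_real V (z - Y k) - indicat_real V z\<bar> + indicat_real (V - A) (z - Y k)) + (LINT z|lborel. indicat_real (V - A) z)"
      using tr(1)[OF iV] iV tr(1)[OF iD] iD by (intro Bochner_Integration.integral_add) auto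
    also have "(LINT z|lborel. \<bar>indicat_real V (z - Y k) - indicat_real V z\<bar> + indicat_real (V - A) (z - Y k)) =
       (LINT z|lborel. \<bar>indicat_real V (z - Y k) - indicat_real V z\<bar>) + (LINT z|lborel. indicat_real (V - A) (z - Y k))"
      using tr(1)[OF iV] iV tr(1)[OF iD] by (intro Bochner_Integration.integral_add) auto
    finally have "(LINT z|lborel. \<bar>indicat_real A (z - Y k) - indicat_real A z\<bar>) < e"
      using k0[OF that] D tr(2)[OF iD, of "Y k"] e by linarith
    moreover have "(LINT z|lborel. \<bar>indicat_real A (z - Y k) - indicat_real A z\<bar>) \<ge> 0"
      by simp
    ultimately show ?thesis by simp
  qed
  then show "\<exists>k0. \<forall>k\<ge>k0. norm ((LINT z|lborel. \<bar>indicat_real A (z - Y k) - indicat_real A z\<bar>) - 0) < e"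
    by blast
qed

text \<open>Approximation by simple functions: the statement holds for indicators, is stable under
  sums, and passes to dominated limits because the approximation error enters twice with the same
  size, translations being isometries of L^1.\<close>

lemma tendsto_integral_translation:
  fixes f :: "'a::euclidean_space \<Rightarrow> 'b::euclidean_space"
  assumes Y: "Y \<longlonglongrightarrow> 0" and f: "integrable lborel f"
  shows "(\<lambda>k. LINT z|lborel. norm (f (z - Y k) - f z)) \<longlonglongrightarrow> 0"
  using f
proof (induction rule: integrable_induct)
  case (base A c)
  have "(\<lambda>k. (LINT z|lborel. \<bar>indicat_real A (z - Y k) - indicat_real A z\<bar>) * norm c) \<longlonglongrightarrow> 0 * norm c"
    using base by (intro tendsto_intros tendsto_integral_indicator_translation Y) (auto simp: less_top)
  then show ?case
    by (simp flip: scaleR_diff_left)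
next
  case (add f g)
  note fi = integral_lborel_shift(1)[OF add(1)] and gi = integral_lborel_shift(1)[OF add(2)]
  show ?case
  proof (rule tendsto_sandwich[OF _ _ tendsto_const])
    show "\<forall>\<^sub>F k in sequentially. 0 \<le> (LINT z|lborel. norm (f (z - Y k) + g (z - Y k) - (f z + g z)))"
      by simp
    show "\<forall>\<^sub>F k in sequentially. (LINT z|lborel. norm (f (z - Y k) + g (z - Y k) - (f z + g z)))
      \<le> (LINT z|lborel. norm (f (z - Y k) - f z)) + (LINT z|lborel. norm (g (z - Y k) - g z))"
    proof (rule always_eventually, rule allI)
      fix k
      have "(LINT z|lborel. norm (f (z - Y k) + g (z - Y k) - (f z + g z)))
        \<le> (LINT z|lborel. norm (f (z - Y k) - f z) + norm (g (z - Y k) - g z))"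
        using fi gi add(1,2) by (intro integral_mono norm_diff_triangle_ineq) auto
      then show "(LINT z|lborel. norm (f (z - Y k) + g (z - Y k) - (f z + g z)))
        \<le> (LINT z|lborel. norm (f (z - Y k) - f z)) + (LINT z|lborel. norm (g (z - Y k) - g z))"
        using fi gi add(1,2) by simp
    qed
    show "(\<lambda>k. (LINT z|lborel. norm (f (z - Y k) - f z)) + (LINT z|lborel. norm (g (z - Y k) - g z))) \<longlonglongrightarrow> 0"
      using tendsto_add[OF add(3,4)] by simp
  qed
next
  case (lim f s)
  show ?case
  proof (rule LIMSEQ_I)
    fix e :: real assume e: "e > 0"
    have "(\<lambda>i. LINT z|lborel. norm (s i z - f z)) \<longlonglongrightarrow> (LINT z|(lborel :: 'a measure). norm (0 :: 'b))"
    proof (rule integral_dominated_convergence[where w = "\<lambda>z. 3 * norm (f z)"])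
      show "AE z in lborel. (\<lambda>i. norm (s i z - f z)) \<longlonglongrightarrow> norm (0 :: 'b)"
        using lim(2) by (intro AE_I2 tendsto_norm) (simp add: LIM_zero)
      \<comment> \<open>The approximating functions obey |s i| \<le> 2 |f|, hence the factor
        3.\<close>
      show "AE z in lborel. norm (norm (s i z - f z)) \<le> 3 * norm (f z)" for i
      proof (rule AE_I2)
        fix z :: 'a
        show "norm (norm (s i z - f z)) \<le> 3 * norm (f z)"
          using lim(3)[of z i] norm_triangle_ineq4[of "s i z" "f z"] by simp
      qed
    qed (use lim in auto)
    then have "(\<lambda>i. LINT z|lborel. norm (s i z - f z)) \<longlonglongrightarrow> 0"
      by simp
    then have "\<forall>\<^sub>F i in sequentially. (LINT z|lborel. norm (s i z - f z)) < e / 3"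
      by (rule order_tendstoD(2)) (use e in simp)
    then obtain i where i: "(LINT z|lborel. norm (s i z - f z)) < e / 3"
      by (auto simp: eventually_sequentially)
    have "\<forall>\<^sub>F k in sequentially. (LINT z|lborel. norm (s i (z - Y k) - s i z)) < e / 3"
      using e by (intro order_tendstoD(2)[OF lim(5)]) simp
    then obtain k0 where k0: "\<And>k. k \<ge> k0 \<Longrightarrow> (LINT z|lborel. norm (s i (z - Y k) - s i z)) < e / 3"
      by (auto simp: eventually_sequentially)
    have int: "integrable lborel (\<lambda>z. norm (s i z - f z))"
      using lim by auto
    have "norm ((LINT z|lborel. norm (f (z - Y k) - f z)) - 0) < e" if "k \<ge> k0" for k
    proof -
      note fi = integral_lborel_shift(1)[OF lim(4), of "Y k"]
      note si = integral_lborel_shift(1)[OF lim(1), of i "Y k"]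
      note di = integral_lborel_shift[OF int, of "Y k"]
      have "(LINT z|lborel. norm (f (z - Y k) - f z)) \<le>
        (LINT z|lborel. (norm (s i (z - Y k) - s i z) + norm (s i (z - Y k) - f (z - Y k))) + norm (s i z - f z))"
      proof (rule integral_mono)
        fix z
        have "f (z - Y k) - f z = (s i (z - Y k) - s i z) - (s i (z - Y k) - f (z - Y k)) + (s i z - f z)"
          by simp
        then show "norm (f (z - Y k) - f z) \<le>
          (norm (s i (z - Y k) - s i z) + norm (s i (z - Y k) - f (z - Y k))) + norm (s i z - f z)"
          by (metis norm_triangle_mono norm_triangle_ineq4 order_refl)
      qed (use fi si di int lim in auto)
      also have "\<dots> = (LINT z|lborel. norm (s i (z - Y k) - s i z) + norm (s i (z - Y k) - f (z - Y k))) + (LINT z|lborel. norm (s i z - f z))"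
        using fi si di int lim by (intro Bochner_Integration.integral_add) auto
      also have "(LINT z|lborel. norm (s i (z - Y k) - s i z) + norm (s i (z - Y k) - f (z - Y k))) =
        (LINT z|lborel. norm (s i (z - Y k) - s i z)) + (LINT z|lborel. norm (s i (z - Y k) - f (z - Y k)))"
        using fi si di int lim by (intro Bochner_Integration.integral_add) auto
      also have "\<dots> + (LINT z|lborel. norm (s i z - f z)) < e"
        using k0[OF that] i di(2) by linarith
      finally show ?thesis by simp
    qed
    then show "\<exists>k0. \<forall>k\<ge>k0. norm ((LINT z|lborel. norm (f (z - Y k) - f z)) - 0) < e"
      by blast
  qed
qed

section \<open>The pairing of conjugate Lebesgue spaces under translation\<close>

lemma inner_integral_le_Lp:
  fixes f g :: "'a \<Rightarrow> 'b::euclidean_space"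
  assumes pq: "p > 1" "q > 1" "1 / p + 1 / q = 1"
    and [measurable]: "f \<in> borel_measurable M" "g \<in> borel_measurable M"
    and f: "integrable M (\<lambda>z. norm (f z) powr q)" and g: "integrable M (\<lambda>z. norm (g z) powr p)"
  shows "integrable M (\<lambda>z. norm (f z) * norm (g z))"
    and "integrable M (\<lambda>z. f z \<bullet> g z)"
    and "l > 0 \<Longrightarrow> \<bar>LINT z|M. f z \<bullet> g z\<bar> \<le>
       l powr (- q) * (LINT z|M. norm (f z) powr q) + l powr p * (LINT z|M. norm (g z) powr p)"
proof -
  have le: "norm (f z) * norm (g z) \<le> l powr (- q) * norm (f z) powr q + l powr p * norm (g z) powr p" if "l > 0" for z l
    using pq that by (intro Youngs_inequality_scaled) auto
  show int: "integrable M (\<lambda>z. norm (f z) * norm (g z))"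
  proof (rule Bochner_Integration.integrable_bound)
    show "integrable M (\<lambda>z. norm (f z) powr q + norm (g z) powr p)" using f g by simp
  qed (use le[of 1] in auto)
  show int': "integrable M (\<lambda>z. f z \<bullet> g z)"
    by (rule Bochner_Integration.integrable_bound[OF int]) (auto simp: Cauchy_Schwarz_ineq2)
  show "\<bar>LINT z|M. f z \<bullet> g z\<bar> \<le>
       l powr (- q) * (LINT z|M. norm (f z) powr q) + l powr p * (LINT z|M. norm (g z) powr p)" if "l > 0"
  proof -
    have "\<bar>LINT z|M. f z \<bullet> g z\<bar> \<le> (LINT z|M. \<bar>f z \<bullet> g z\<bar>)"
      by (rule integral_abs_bound)
    also have "\<dots> \<le> (LINT z|M. l powr (- q) * norm (f z) powr q + l powr p * norm (g z) powr p)"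
      using int' f g le[OF that] Cauchy_Schwarz_ineq2 order_trans
      by (intro integral_mono) (auto, blast)
    also have "\<dots> = l powr (- q) * (LINT z|M. norm (f z) powr q) + l powr p * (LINT z|M. norm (g z) powr p)"
      using f g by simp
    finally show ?thesis .
  qed
qed

text \<open>Cutting off both the values and the domain makes the truncations bounded and integrable,
  so that continuity of translations in L^1 can be applied to them. The truncation enters through an
  equation so that the caller can name it.\<close>

lemma truncation_tendsto_Lp:
  fixes f :: "'a::euclidean_space \<Rightarrow> 'b::euclidean_space"
  assumes "p > 0" and [measurable]: "f \<in> borel_measurable borel" and f: "integrable lborel (\<lambda>z. norm (f z) powr p)"
    and t_def: "t = (\<lambda>m z. indicat_real {z. norm (f z) \<le> real m \<and> norm z \<le> real m} z *\<^sub>R f z)"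
  shows "(\<lambda>m. LINT z|lborel. norm (f z - t m z) powr p) \<longlonglongrightarrow> 0"
    and "t m \<in> borel_measurable borel" and "norm (t m z) \<le> real m" and "integrable lborel (t m)"
    and "norm (t m z) \<le> norm (f z)"
    and "integrable lborel (\<lambda>z. norm (f z - t m z) powr p)"
    and "integrable lborel (\<lambda>z. norm (t m z) powr p)"
proof -
  show meas [measurable]: "t m \<in> borel_measurable borel" for m
    unfolding t_def by measurable
  show bd: "norm (t m z) \<le> real m" "norm (t m z) \<le> norm (f z)" for m z
    by (auto simp: t_def split: split_indicator)
  have D: "norm (f z - t m z) powr p \<le> norm (f z) powr p" for z m
    using assms(1) by (auto simp: t_def split: split_indicator)
  show "integrable lborel (t m)"
  proof (rule Bochner_Integration.integrable_bound)
    show "integrable lborel (\<lambda>z. real m * indicator (cball (0::'a) (real m)) z)"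
      using emeasure_compact_finite[OF compact_cball] by (intro integrable_mult_right integrable_real_indicator) auto
    show "AE z in lborel. norm (t m z) \<le> norm (real m * indicator (cball (0::'a) (real m)) z)"
      by (intro AE_I2) (auto simp: t_def split: split_indicator)
  qed simp
  show "integrable lborel (\<lambda>z. norm (f z - t m z) powr p)"
    by (rule Bochner_Integration.integrable_bound[OF f]) (use D in auto)
  show "integrable lborel (\<lambda>z. norm (t m z) powr p)"
    by (rule Bochner_Integration.integrable_bound[OF f]) (use bd(2) assms(1) in \<open>auto intro!: powr_mono2\<close>)
  have "(\<lambda>m. LINT z|lborel. norm (f z - t m z) powr p) \<longlonglongrightarrow> (LINT z|(lborel :: 'a measure). 0)"
  proof (rule integral_dominated_convergence[OF _ _ f])
    show "AE z in lborel. (\<lambda>m. norm (f z - t m z) powr p) \<longlonglongrightarrow> 0"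
    proof (rule AE_I2)
      fix z
      have "\<forall>\<^sub>F m in sequentially. norm (f z) \<le> real m \<and> norm z \<le> real m"
      proof (rule eventually_sequentiallyI)
        fix m assume "nat \<lceil>max (norm (f z)) (norm z)\<rceil> \<le> m"
        then show "norm (f z) \<le> real m \<and> norm z \<le> real m" by linarith
      qed
      then have "\<forall>\<^sub>F m in sequentially. norm (f z - t m z) powr p = 0"
        by eventually_elim (simp add: t_def)
      then show "(\<lambda>m. norm (f z - t m z) powr p) \<longlonglongrightarrow> 0"
        by (rule tendsto_eventually)
    qed
    show "AE z in lborel. norm (norm (f z - t m z) powr p) \<le> norm (f z) powr p" for m
      using D by auto
  qed auto
  then show "(\<lambda>m. LINT z|lborel. norm (f z - t m z) powr p) \<longlonglongrightarrow> 0" by simp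
qed

text \<open>Both functions are truncated. The resulting error is bounded uniformly in the
  translation, since translating f does not change its norm; for the truncated pair a bounded
  function is paired with an L^1 function, whose translations are continuous.\<close>

lemma tendsto_integral_inner_translation:
  fixes f g :: "'a::euclidean_space \<Rightarrow> 'b::euclidean_space"
  assumes pq: "p > 1" "q > 1" "1 / p + 1 / q = 1"
    and [measurable]: "f \<in> borel_measurable borel" "g \<in> borel_measurable borel"
    and f: "integrable lborel (\<lambda>z. norm (f z) powr q)" and g: "integrable lborel (\<lambda>z. norm (g z) powr p)"
    and Y: "Y \<longlonglongrightarrow> 0"
  shows "(\<lambda>k. LINT z|lborel. f (z - Y k) \<bullet> g z) \<longlonglongrightarrow> (LINT z|lborel. f z \<bullet> g z)"
proof (rule LIMSEQ_I)
  fix e :: real assume e: "e > 0"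
  define If Ig where "If = (LINT z|lborel. norm (f z) powr q)" and "Ig = (LINT z|lborel. norm (g z) powr p)"
  have I0: "If \<ge> 0" "Ig \<ge> 0" by (auto simp: If_def Ig_def)
  \<comment> \<open>The total error is at most 4 d for the shift \<open>Y k\<close>, 4 d for the
    shift 0 and less than d in between, thus less than 12 d = e.\<close>
  define d where "d = e / 12"
  have d: "d > 0" using e by (simp add: d_def)
  \<comment> \<open>The weights l and m are fixed first: they make the terms with the full integrals
    \<open>Ig\<close> and \<open>If\<close> at most d. Only then is the truncation level i chosen to
    make the remaining, small integrals beat the other power of the weight. Adding 1 in the
    denominators avoids a division by zero.\<close>
  define l where "l = (d / (1 + Ig)) powr (1 / p)"
  have l: "l > 0" "l powr p * Ig \<le> d"
    using I0 d pq by (auto simp: l_def powr_powr field_simps)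
  define m where "m = (d / (1 + If)) powr (- 1 / q)"
  have m: "m > 0" "m powr (- q) * If \<le> d"
    using I0 d pq by (auto simp: m_def powr_powr field_simps)
  define tf where "tf = (\<lambda>i z. indicat_real {z. norm (f z) \<le> real i \<and> norm z \<le> real i} z *\<^sub>R f z)"
  define tg where "tg = (\<lambda>i z. indicat_real {z. norm (g z) \<le> real i \<and> norm z \<le> real i} z *\<^sub>R g z)"
  have q0: "q > 0" "p > 0" using pq by auto
  note tf = truncation_tendsto_Lp[OF q0(1) assms(4) f tf_def]
  note tg = truncation_tendsto_Lp[OF q0(2) assms(5) g tg_def]
  have [measurable]: "tf i \<in> borel_measurable borel" "tg i \<in> borel_measurable borel" for i
    using tf(2) tg(2) by auto
  have "(\<lambda>i. l powr (- q) * (LINT z|lborel. norm (f z - tf i z) powr q)) \<longlonglongrightarrow> l powr (- q) * 0"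
    "(\<lambda>i. m powr p * (LINT z|lborel. norm (g z - tg i z) powr p)) \<longlonglongrightarrow> m powr p * 0"
    by (intro tendsto_intros tf(1) tg(1))+
  then have "\<forall>\<^sub>F i in sequentially. l powr (- q) * (LINT z|lborel. norm (f z - tf i z) powr q) < d
     \<and> m powr p * (LINT z|lborel. norm (g z - tg i z) powr p) < d"
    using d by (intro eventually_conj; (simp add: order_tendstoD(2)))
  then obtain i where i: "l powr (- q) * (LINT z|lborel. norm (f z - tf i z) powr q) < d"
     "m powr p * (LINT z|lborel. norm (g z - tg i z) powr p) < d"
    by (auto simp: eventually_sequentially)
  note tfi = tf(2-)[of i] note tgi = tg(2-)[of i]
  have sh: "integrable lborel (\<lambda>z. norm (h (z - y)) powr q)" "(LINT z|lborel. norm (h (z - y)) powr q) = (LINT z|lborel. norm (h z) powr q)"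
    if "integrable lborel (\<lambda>z. norm (h z) powr q)" for h :: "'a \<Rightarrow> 'b" and y
    using integral_lborel_shift[OF that, of y] by auto
  have approx: "\<bar>(LINT z|lborel. f (z - y) \<bullet> g z) - (LINT z|lborel. tf i (z - y) \<bullet> tg i z)\<bar> \<le> 4 * d" for y
  proof -
    have int: "integrable lborel (\<lambda>z. f (z - y) \<bullet> g z)" "integrable lborel (\<lambda>z. tf i (z - y) \<bullet> tg i z)"
      "integrable lborel (\<lambda>z. (f (z - y) - tf i (z - y)) \<bullet> g z)" "integrable lborel (\<lambda>z. tf i (z - y) \<bullet> (g z - tg i z))"
      using sh[OF f] sh[OF tfi(6)] sh[of "\<lambda>z. f z - tf i z", OF tfi(5)] tgi g
      by (auto intro!: inner_integral_le_Lp(2)[OF pq])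
    have "(LINT z|lborel. f (z - y) \<bullet> g z) - (LINT z|lborel. tf i (z - y) \<bullet> tg i z) =
      (LINT z|lborel. (f (z - y) - tf i (z - y)) \<bullet> g z) + (LINT z|lborel. tf i (z - y) \<bullet> (g z - tg i z))"
      using int by (simp flip: Bochner_Integration.integral_diff Bochner_Integration.integral_add) (simp add: algebra_simps)
    moreover have "\<bar>LINT z|lborel. (f (z - y) - tf i (z - y)) \<bullet> g z\<bar> \<le>
        l powr (- q) * (LINT z|lborel. norm (f z - tf i z) powr q) + l powr p * Ig"
      using inner_integral_le_Lp(3)[OF pq _ _ sh(1)[of "\<lambda>z. f z - tf i z", OF tfi(5)] g l(1), of y]
        sh(2)[of "\<lambda>z. f z - tf i z", OF tfi(5)] by (simp add: Ig_def)
    moreover have "\<bar>LINT z|lborel. tf i (z - y) \<bullet> (g z - tg i z)\<bar> \<le>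
        m powr (- q) * (LINT z|lborel. norm (tf i z) powr q) + m powr p * (LINT z|lborel. norm (g z - tg i z) powr p)"
      using inner_integral_le_Lp(3)[OF pq _ _ sh(1)[OF tfi(6)] tgi(5) m(1), of y] sh(2)[OF tfi(6)] by simp
    moreover have "m powr (- q) * (LINT z|lborel. norm (tf i z) powr q) \<le> m powr (- q) * If"
      unfolding If_def using tfi f q0 by (intro mult_left_mono integral_mono powr_mono2) auto
    ultimately show ?thesis
      using i l(2) m(2) by linarith
  qed
  have conv: "(\<lambda>k. (LINT z|lborel. norm (tf i (z - Y k) - tf i z)) * real i) \<longlonglongrightarrow> 0 * real i"
    using tfi by (intro tendsto_intros tendsto_integral_translation Y)
  then have "\<forall>\<^sub>F k in sequentially. (LINT z|lborel. norm (tf i (z - Y k) - tf i z)) * real i < d"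
    using d by (simp add: order_tendstoD(2))
  then obtain k0 where k0: "\<And>k. k \<ge> k0 \<Longrightarrow> (LINT z|lborel. norm (tf i (z - Y k) - tf i z)) * real i < d"
    by (auto simp: eventually_sequentially)
  have "norm ((LINT z|lborel. f (z - Y k) \<bullet> g z) - (LINT z|lborel. f z \<bullet> g z)) < e" if "k \<ge> k0" for k
  proof -
    have int: "integrable lborel (\<lambda>z. tf i (z - y) \<bullet> tg i z)" for y
      using sh[OF tfi(6)] tgi by (auto intro!: inner_integral_le_Lp(2)[OF pq])
    have nint: "integrable lborel (\<lambda>z. norm (tf i (z - Y k) - tf i z) * real i)"
      using integral_lborel_shift(1)[OF tfi(3)] tfi by auto
    have "\<bar>(LINT z|lborel. tf i (z - Y k) \<bullet> tg i z) - (LINT z|lborel. tf i (z - 0) \<bullet> tg i z)\<bar>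
       = \<bar>LINT z|lborel. (tf i (z - Y k) - tf i z) \<bullet> tg i z\<bar>"
      using int[of "Y k"] int[of 0] by (simp flip: Bochner_Integration.integral_diff add: inner_diff_left)
    also have "\<dots> \<le> (LINT z|lborel. \<bar>(tf i (z - Y k) - tf i z) \<bullet> tg i z\<bar>)"
      by (rule integral_abs_bound)
    also have "\<dots> \<le> (LINT z|lborel. norm (tf i (z - Y k) - tf i z) * real i)"
    proof (rule integral_mono[OF _ nint])
      show "integrable lborel (\<lambda>z. \<bar>(tf i (z - Y k) - tf i z) \<bullet> tg i z\<bar>)"
        using int[of "Y k"] int[of 0] by (simp add: inner_diff_left)
      show "\<bar>(tf i (z - Y k) - tf i z) \<bullet> tg i z\<bar> \<le> norm (tf i (z - Y k) - tf i z) * real i" for z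
        by (rule order_trans[OF Cauchy_Schwarz_ineq2 mult_left_mono]) (use tgi in auto)
    qed
    also have "\<dots> < d" using k0[OF that] by simp
    finally show ?thesis
      using approx[of "Y k"] approx[of 0] d d_def unfolding real_norm_def diff_0_right abs_less_iff abs_le_iff
      by linarith
  qed
  then show "\<exists>k0. \<forall>k\<ge>k0. norm ((LINT z|lborel. f (z - Y k) \<bullet> g z) - (LINT z|lborel. f z \<bullet> g z)) < e"
    by blast
qed

subsection \<open>Null sets and dominated subsequences\<close>

text \<open>Fubini for null sets, with the second coordinate (time) frozen. The exceptional set is
  enlarged to a Borel null set because exchanging the order of the two quantifiers requires
  measurability.\<close>

lemma AE_lborel_prod_slices:
  fixes P :: "'a::euclidean_space \<times> 'b::euclidean_space \<Rightarrow> bool"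
  assumes "AE z in lborel. P z"
  shows "AE t in lborel. AE x in lborel. P (x, t)"
proof -
  obtain N where N: "N \<in> null_sets lborel" "{z. \<not> P z} \<subseteq> N"
    using assms by (auto elim!: AE_E3 simp: eventually_ae_filter)
  have [measurable]: "N \<in> sets (lborel \<Otimes>\<^sub>M lborel)"
    using N(1) by (subst lborel_prod) auto
  have "AE z in lborel \<Otimes>\<^sub>M lborel. z \<notin> N"
    using AE_not_in[OF N(1)] unfolding lborel_prod .
  then have "AE x in lborel. AE t in lborel. (x, t) \<notin> N"
    by (rule lborel_pair.AE_pair)
  moreover have "{z \<in> space (lborel \<Otimes>\<^sub>M lborel). (fst z, snd z) \<notin> N} \<in> sets (lborel \<Otimes>\<^sub>M lborel)"
    using sets.compl_sets[OF \<open>N \<in> sets (lborel \<Otimes>\<^sub>M lborel)\<close>] by (simp add: set_diff_eq)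
  ultimately have "AE t in lborel. AE x in lborel. (x, t) \<notin> N"
    using lborel_pair.AE_commute[of "\<lambda>x t. (x, t) \<notin> N"] by blast
  then show ?thesis
    by eventually_elim (rule AE_mp, assumption, use N(2) in auto)
qed

text \<open>The argument behind the Riesz-Fischer theorem: the sum of all D j has finite integral,
  so it is finite almost everywhere, forces D j \<rightarrow> 0 there and serves as the common
  majorant S.\<close>

lemma integrals_summable_imp_dominated:
  fixes D :: "nat \<Rightarrow> 'a \<Rightarrow> real"
  assumes int: "\<And>j. integrable M (D j)" and nonneg: "\<And>j x. D j x \<ge> 0"
    and le: "\<And>j. (LINT x|M. D j x) \<le> (1 / 2) ^ j"
  obtains S where "integrable M S" "\<And>x. S x \<ge> 0" "AE x in M. (\<lambda>j. D j x) \<longlonglongrightarrow> 0 \<and> (\<forall>j. D j x \<le> S x)"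
proof -
  have [measurable]: "D j \<in> borel_measurable M" for j using int by auto
  have sm: "summable (\<lambda>j. LINT x|M. D j x)"
    by (rule summable_comparison_test[OF _ summable_geometric[of "1/2"]])
       (use le nonneg in \<open>auto simp: abs_of_nonneg integral_nonneg\<close>)
  have "(\<integral>\<^sup>+x. (\<Sum>j. ennreal (D j x)) \<partial>M) = (\<Sum>j. \<integral>\<^sup>+x. ennreal (D j x) \<partial>M)"
    by (rule nn_integral_suminf) measurable
  also have "\<dots> = (\<Sum>j. ennreal (LINT x|M. D j x))"
    using int nonneg by (simp add: nn_integral_eq_integral)
  also have "\<dots> = ennreal (\<Sum>j. LINT x|M. D j x)"
    using sm nonneg by (intro suminf_ennreal2) (auto simp: integral_nonneg)
  finally have fin: "(\<integral>\<^sup>+x. (\<Sum>j. ennreal (D j x)) \<partial>M) < \<infinity>"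
    by simp
  then have "AE x in M. (\<Sum>j. ennreal (D j x)) \<noteq> \<infinity>"
    by (intro nn_integral_PInf_AE) auto
  then have sum: "AE x in M. summable (\<lambda>j. D j x)"
    by eventually_elim (use nonneg in \<open>auto intro: summable_suminf_not_top\<close>)
  define S where "S x = enn2real (\<Sum>j. ennreal (D j x))" for x
  show thesis
  proof
    show "S x \<ge> 0" for x by (simp add: S_def)
    show "integrable M S"
    proof (rule integrableI_bounded)
      show "S \<in> borel_measurable M" unfolding S_def by measurable
      have "(\<integral>\<^sup>+x. ennreal (norm (S x)) \<partial>M) \<le> (\<integral>\<^sup>+x. (\<Sum>j. ennreal (D j x)) \<partial>M)"
        by (intro nn_integral_mono) (simp add: S_def ennreal_enn2real_if)
      then show "(\<integral>\<^sup>+x. ennreal (norm (S x)) \<partial>M) < \<infinity>"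
        using fin by simp
    qed
    show "AE x in M. (\<lambda>j. D j x) \<longlonglongrightarrow> 0 \<and> (\<forall>j. D j x \<le> S x)"
      using sum
    proof eventually_elim
      case (elim x)
      have "S x = (\<Sum>j. D j x)"
        using elim nonneg by (simp add: S_def suminf_ennreal2 suminf_nonneg)
      then show ?case
        using summable_LIMSEQ_zero[OF elim] elim nonneg
          sum_le_suminf[OF elim, of "{j}" for j] by auto
    qed
  qed
qed

subsection \<open>Continuous functions with integrable weak derivative\<close>

text \<open>\<open>flat 2\<close> is the derivative of \<open>flat 0\<close>, which rises from 0 to
  1 on the half line.\<close>

lemma flat_2_integral:
  shows "integrable lborel (flat 2)" and "(LINT y|lborel. flat 2 y) = 1"
proof -
  have [measurable]: "flat 2 \<in> borel_measurable borel"
    by (rule borel_measurable_continuous_onI[OF Ck_continuous[OF Ck_flat]])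
  have lim: "(flat 0 \<longlongrightarrow> 1) at_top"
  proof -
    have "((\<lambda>k. flat 0 (k * 1)) \<longlongrightarrow> indicat_real {0<..} (1::real)) at_top"
      by (rule flat_0_tendsto[of "\<lambda>k. k"]) (rule filterlim_ident)
    then show ?thesis by simp
  qed
  have "(\<integral>\<^sup>+y. ennreal (flat 2 y) * indicator {0..} y \<partial>lborel) = ennreal (1 - flat 0 0)"
  proof (rule nn_integral_FTC_atLeast[OF _ _ _ lim])
    show "(flat 0 has_field_derivative flat 2 y) (at y)" for y
      using flat_has_field_derivative[of 0 y] by (simp add: numeral_2_eq_2)
  qed (auto simp: flat_nonneg)
  moreover have "(\<lambda>y. ennreal (flat 2 y) * indicator {0..} y) = (\<lambda>y. ennreal (flat 2 y))"
    by (auto simp: fun_eq_iff flat_def split: split_indicator)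
  ultimately have "(\<integral>\<^sup>+y. ennreal (flat 2 y) \<partial>lborel) = ennreal 1"
    by (simp add: flat_def)
  then have "has_bochner_integral lborel (flat 2) 1"
    by (intro has_bochner_integral_nn_integral) (auto simp: flat_nonneg)
  then show "integrable lborel (flat 2)" "(LINT y|lborel. flat 2 y) = 1"
    by (auto simp: has_bochner_integral_iff)
qed

lemma flat_0_diff_tendsto:
  assumes "d > 0"
  shows "(\<lambda>k. flat 0 (real k * d - y)) \<longlonglongrightarrow> 1"
proof -
  have "filterlim (\<lambda>k. real k * d - y) at_top sequentially"
    using filterlim_tendsto_add_at_top[OF tendsto_const[of "- y"]
       filterlim_at_top_mult_tendsto_pos[OF tendsto_const assms filterlim_real_sequentially]]
    by (simp add: algebra_simps)
  from flat_0_tendsto[OF this, of 1] show ?thesis by simp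
qed

text \<open>
  The derivative of the left flank of a bump rescales to the probability density \<open>flat 2\<close>, so it
  acts like a point mass in the limit. Taking \<open>\<sigma> = -1\<close> yields the right flank.
\<close>

lemma bump_flank_tendsto:
  fixes a :: "real \<Rightarrow> real"
  assumes \<sigma>: "\<sigma> = 1 \<or> \<sigma> = -1" and d: "d > 0"
    and a: "continuous_on {s. 0 \<le> \<sigma> * (s - t) \<and> \<sigma> * (s - t) \<le> d} a"
  shows "(\<lambda>k. LINT s|lborel. real k * flat 2 (real k * (\<sigma> * (s - t))) * flat 0 (real k * (d - \<sigma> * (s - t))) * a s)
    \<longlonglongrightarrow> a t"
proof -
  let ?J = "{s. 0 \<le> \<sigma> * (s - t) \<and> \<sigma> * (s - t) \<le> d}"
  have J: "?J = (if \<sigma> = 1 then {t..t + d} else {t - d..t})" using \<sigma> by auto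
  have cJ: "compact ?J" unfolding J by auto
  \<comment> \<open>The function a is only controlled on the interval, so it is cut off there to
    become bounded and Borel on the line. The two \<open>flat\<close> factors vanish off the
    interior of the interval, so the integrand does not change.\<close>
  define \<alpha> where "\<alpha> s = indicator ?J s *\<^sub>R a s" for s
  have [measurable]: "\<alpha> \<in> borel_measurable borel"
    unfolding \<alpha>_def by (rule borel_measurable_continuous_on_indicator[OF _ a]) (simp add: J)
  have "compact (a ` ?J)"
    using a cJ by (rule compact_continuous_image)
  then obtain M where M: "M > 0" "\<And>s. s \<in> ?J \<Longrightarrow> \<bar>a s\<bar> \<le> M"
    using bounded_pos[of "a ` ?J"] compact_imp_bounded by auto
  have \<alpha>M: "\<bar>\<alpha> s\<bar> \<le> M" for s
    using M by (auto simp: \<alpha>_def split: split_indicator)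
  have [measurable]: "flat n \<in> borel_measurable borel" for n
    by (rule borel_measurable_continuous_onI[OF Ck_continuous[OF Ck_flat]])
  let ?f = "\<lambda>k y. flat 2 y * flat 0 (real k * d - y) * \<alpha> (t + \<sigma> / real k * y)"
  have eq: "(LINT s|lborel. real k * flat 2 (real k * (\<sigma> * (s - t))) * flat 0 (real k * (d - \<sigma> * (s - t))) * a s)
      = (LINT y|lborel. ?f k y)" if k: "k > 0" for k
  proof -
    have \<sigma>2: "\<sigma> * \<sigma> = 1" "\<bar>\<sigma>\<bar> = 1" "\<sigma> \<noteq> 0" using \<sigma> by auto
    have "real k * flat 2 (real k * (\<sigma> * (s - t))) * flat 0 (real k * (d - \<sigma> * (s - t))) * a s
      = real k * flat 2 (real k * (\<sigma> * (s - t))) * flat 0 (real k * (d - \<sigma> * (s - t))) * \<alpha> s" for s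
    proof -
      have pos: "0 < real k * x \<longleftrightarrow> 0 < x" for x
        using k by (simp add: zero_less_mult_iff)
      show ?thesis
        by (cases "0 < \<sigma> * (s - t) \<and> \<sigma> * (s - t) < d") (simp_all add: \<alpha>_def flat_def pos)
    qed
    then have "(LINT s|lborel. real k * flat 2 (real k * (\<sigma> * (s - t))) * flat 0 (real k * (d - \<sigma> * (s - t))) * a s)
      = (LINT s|lborel. real k * flat 2 (real k * (\<sigma> * (s - t))) * flat 0 (real k * (d - \<sigma> * (s - t))) * \<alpha> s)"
      by (intro Bochner_Integration.integral_cong refl)
    \<comment> \<open>Substitution s = t + (\<sigma> / k) y, which absorbs the prefactor k and
      leaves the fixed density \<open>flat 2 y\<close>.\<close>
    also have "\<dots> = \<bar>\<sigma> / real k\<bar> *\<^sub>R (LINT y|lborel. real k * flat 2 (real k * (\<sigma> * (t + \<sigma> / real k * y - t)))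
         * flat 0 (real k * (d - \<sigma> * (t + \<sigma> / real k * y - t))) * \<alpha> (t + \<sigma> / real k * y))"
      using k \<sigma>2 by (intro lborel_integral_real_affine) simp
    also have "(\<lambda>y. real k * flat 2 (real k * (\<sigma> * (t + \<sigma> / real k * y - t)))
         * flat 0 (real k * (d - \<sigma> * (t + \<sigma> / real k * y - t))) * \<alpha> (t + \<sigma> / real k * y)) = (\<lambda>y. real k * ?f k y)"
    proof
      fix y
      have *: "\<sigma> * (t + \<sigma> / real k * y - t) = y / real k"
        using \<sigma>2 k by (simp add: field_simps)
      show "real k * flat 2 (real k * (\<sigma> * (t + \<sigma> / real k * y - t)))
         * flat 0 (real k * (d - \<sigma> * (t + \<sigma> / real k * y - t))) * \<alpha> (t + \<sigma> / real k * y) = real k * ?f k y"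
        unfolding * using k by (simp add: right_diff_distrib)
    qed
    also have "\<bar>\<sigma> / real k\<bar> *\<^sub>R (LINT y|lborel. real k * ?f k y) = (LINT y|lborel. ?f k y)"
      using k \<sigma>2 by simp
    finally show ?thesis .
  qed
  have "(\<lambda>k. LINT y|lborel. ?f k y) \<longlonglongrightarrow> (LINT y|lborel. flat 2 y * 1 * a t)"
  proof (rule integral_dominated_convergence[where w = "\<lambda>y. flat 2 y * M"])
    show "integrable lborel (\<lambda>y. flat 2 y * M)"
      using flat_2_integral by simp
    show "AE y in lborel. norm (?f k y) \<le> flat 2 y * M" for k
    proof (rule AE_I2)
      fix y
      have "\<bar>?f k y\<bar> = flat 2 y * (flat 0 (real k * d - y) * \<bar>\<alpha> (t + \<sigma> / real k * y)\<bar>)"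
        by (simp add: abs_mult flat_nonneg)
      also have "\<dots> \<le> flat 2 y * (1 * M)"
        by (intro mult_left_mono mult_mono flat_0_le_1 \<alpha>M flat_nonneg) auto
      finally show "norm (?f k y) \<le> flat 2 y * M" by simp
    qed
    show "AE y in lborel. (\<lambda>k. ?f k y) \<longlonglongrightarrow> flat 2 y * 1 * a t"
    proof (rule AE_I2)
      fix y
      show "(\<lambda>k. ?f k y) \<longlonglongrightarrow> flat 2 y * 1 * a t"
      proof (cases "y > 0")
        case True
        have "(\<lambda>k. t + \<sigma> * y * (1 / real k)) \<longlonglongrightarrow> t + \<sigma> * y * 0"
          by (intro tendsto_intros lim_1_over_n)
        then have lim: "(\<lambda>k. t + \<sigma> / real k * y) \<longlonglongrightarrow> t"
          by (simp add: mult.commute)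
        have "\<forall>\<^sub>F k in sequentially. y / d \<le> real k"
          using filterlim_real_sequentially by (simp add: filterlim_at_top)
        with eventually_gt_at_top[of 0]
        have ev: "\<forall>\<^sub>F k in sequentially. t + \<sigma> / real k * y \<in> ?J"
        proof eventually_elim
          case (elim k)
          have *: "\<sigma> * (t + \<sigma> / real k * y - t) = y / real k" using \<sigma> by auto
          have "y / real k \<le> d" using elim d by (simp add: field_simps)
          then show ?case unfolding mem_Collect_eq * using True by simp
        qed
        have "(\<lambda>k. a (t + \<sigma> / real k * y)) \<longlonglongrightarrow> a t"
          by (rule continuous_on_tendsto_compose[OF a lim]) (use d ev in auto)
        moreover have "\<forall>\<^sub>F k in sequentially. a (t + \<sigma> / real k * y) = \<alpha> (t + \<sigma> / real k * y)"
          using ev by eventually_elim (simp add: \<alpha>_def)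
        ultimately have "(\<lambda>k. \<alpha> (t + \<sigma> / real k * y)) \<longlonglongrightarrow> a t"
          by (rule Lim_transform_eventually)
        then show ?thesis
          using d by (intro tendsto_intros flat_0_diff_tendsto)
      qed (simp add: flat_def)
    qed
  qed measurable
  also have "(LINT y|lborel. flat 2 y * 1 * a t) = a t"
    using flat_2_integral by simp
  finally show ?thesis
    by (rule Lim_transform_eventually)
      (rule eventually_mono[OF eventually_gt_at_top[of 0]], rule eq[symmetric])
qed

lemma weak_derivative_imp_increment_interior:
  fixes a b :: "real \<Rightarrow> real"
  assumes a: "continuous_on {t\<^sub>1..t\<^sub>2} a" and b: "integrable lborel b"
    and weak: "\<And>\<eta>. \<eta> \<in> test_functions {0<..<T} \<Longrightarrow> (LINT t|lborel. deriv \<eta> t * a t) = (LINT t|lborel. \<eta> t * b t)"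
    and t: "0 < t\<^sub>1" "t\<^sub>1 < t\<^sub>2" "t\<^sub>2 < T"
  shows "a t\<^sub>2 - a t\<^sub>1 = - (LINT t|lborel. indicator {t\<^sub>1<..<t\<^sub>2} t * b t)"
proof -
  let ?\<eta> = "\<lambda>k. bump (real k) t\<^sub>1 t\<^sub>2"
  let ?f1 = "\<lambda>k t. real k * flat 2 (real k * (1 * (t - t\<^sub>1))) * flat 0 (real k * ((t\<^sub>2 - t\<^sub>1) - 1 * (t - t\<^sub>1)))"
  let ?f2 = "\<lambda>k t. real k * flat 2 (real k * (- 1 * (t - t\<^sub>2))) * flat 0 (real k * ((t\<^sub>2 - t\<^sub>1) - - 1 * (t - t\<^sub>2)))"
  have bump_eq: "?\<eta> k t = flat 0 (real k * (t - t\<^sub>1)) * flat 0 (real k * (t\<^sub>2 - t))" for k t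
    by (simp add: bump_def)
  have D: "deriv (?\<eta> k) t = ?f1 k t - ?f2 k t" for k t
  proof (rule DERIV_imp_deriv)
    have "((\<lambda>t. flat 0 (real k * (t - t\<^sub>1)) * flat 0 (real k * (t\<^sub>2 - t))) has_field_derivative ?f1 k t - ?f2 k t) (at t)"
      by (rule derivative_eq_intros DERIV_chain2[OF flat_has_field_derivative] refl)+
         (simp add: algebra_simps numeral_2_eq_2)
    then show "(?\<eta> k has_field_derivative ?f1 k t - ?f2 k t) (at t)"
      using bump_eq by presburger
  qed
  have J: "{s. 0 \<le> 1 * (s - t\<^sub>1) \<and> 1 * (s - t\<^sub>1) \<le> t\<^sub>2 - t\<^sub>1} = {t\<^sub>1..t\<^sub>2}"
     "{s. 0 \<le> - 1 * (s - t\<^sub>2) \<and> - 1 * (s - t\<^sub>2) \<le> t\<^sub>2 - t\<^sub>1} = {t\<^sub>1..t\<^sub>2}"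
    by auto
  have lim1: "(\<lambda>k. LINT t|lborel. ?f1 k t * a t) \<longlonglongrightarrow> a t\<^sub>1"
    using bump_flank_tendsto[of 1 "t\<^sub>2 - t\<^sub>1" t\<^sub>1 a, unfolded J] t a by simp
  have lim2: "(\<lambda>k. LINT t|lborel. ?f2 k t * a t) \<longlonglongrightarrow> a t\<^sub>2"
    using bump_flank_tendsto[of "- 1" "t\<^sub>2 - t\<^sub>1" t\<^sub>2 a, unfolded J] t a by simp
  have [measurable]: "flat n \<in> borel_measurable borel" for n
    by (rule borel_measurable_continuous_onI[OF Ck_continuous[OF Ck_flat]])
  have int: "integrable lborel (\<lambda>t. ?f1 k t * a t)" "integrable lborel (\<lambda>t. ?f2 k t * a t)" for k
  proof -
    have cont: "continuous_on {t\<^sub>1..t\<^sub>2} (\<lambda>t. flat n (g t))" if "continuous_on {t\<^sub>1..t\<^sub>2} g" for n g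
      by (rule continuous_on_compose2[OF Ck_continuous[OF Ck_flat] that]) simp
    have "integrable lborel (\<lambda>t. indicator {t\<^sub>1..t\<^sub>2} t *\<^sub>R (?f1 k t * a t))"
      "integrable lborel (\<lambda>t. indicator {t\<^sub>1..t\<^sub>2} t *\<^sub>R (?f2 k t * a t))"
      by (intro borel_integrable_compact continuous_intros cont a; simp)+
    moreover have "indicator {t\<^sub>1..t\<^sub>2} t *\<^sub>R (?f1 k t * a t) = ?f1 k t * a t"
      "indicator {t\<^sub>1..t\<^sub>2} t *\<^sub>R (?f2 k t * a t) = ?f2 k t * a t" for t
      by (auto simp: flat_def zero_less_mult_iff split: split_indicator)
    ultimately show "integrable lborel (\<lambda>t. ?f1 k t * a t)" "integrable lborel (\<lambda>t. ?f2 k t * a t)"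
      by (simp_all only:)
  qed
  have eq: "(LINT t|lborel. ?f1 k t * a t) - (LINT t|lborel. ?f2 k t * a t) = (LINT t|lborel. ?\<eta> k t * b t)" if "k > 0" for k
  proof -
    have "?\<eta> k \<in> test_functions {0<..<T}"
      using that t by (intro bump_test_function) auto
    from weak[OF this] have "(LINT t|lborel. (?f1 k t - ?f2 k t) * a t) = (LINT t|lborel. ?\<eta> k t * b t)"
      by (simp only: D)
    then show ?thesis
      using Bochner_Integration.integral_diff[OF int] by (simp add: left_diff_distrib)
  qed
  have "(\<lambda>k. (LINT t|lborel. ?f1 k t * a t) - (LINT t|lborel. ?f2 k t * a t)) \<longlonglongrightarrow> a t\<^sub>1 - a t\<^sub>2"
    by (intro tendsto_diff lim1 lim2)
  moreover have "\<forall>\<^sub>F k in sequentially. (LINT t|lborel. ?f1 k t * a t) - (LINT t|lborel. ?f2 k t * a t) = (LINT t|lborel. ?\<eta> k t * b t)"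
    using eventually_gt_at_top[of 0] by eventually_elim (rule eq)
  ultimately have "(\<lambda>k. LINT t|lborel. ?\<eta> k t * b t) \<longlonglongrightarrow> a t\<^sub>1 - a t\<^sub>2"
    by (rule Lim_transform_eventually)
  moreover have "(\<lambda>k. LINT t|lborel. ?\<eta> k t * b t) \<longlonglongrightarrow> (LINT t|lborel. indicator (box t\<^sub>1 t\<^sub>2) t * b t)"
  proof (rule integral_dominated_convergence[where w = "\<lambda>t. \<bar>b t\<bar>"])
    have [measurable]: "?\<eta> k \<in> borel_measurable borel" for k
      by (rule borel_measurable_continuous_onI[OF Ck_continuous[OF Ck_bump]])
    have [measurable]: "b \<in> borel_measurable borel" using b by auto
    show "(\<lambda>t. indicator (box t\<^sub>1 t\<^sub>2) t * b t) \<in> borel_measurable lborel"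
      "(\<lambda>t. ?\<eta> k t * b t) \<in> borel_measurable lborel" for k by measurable
    show "AE t in lborel. (\<lambda>k. ?\<eta> k t * b t) \<longlonglongrightarrow> indicator (box t\<^sub>1 t\<^sub>2) t * b t"
      by (intro AE_I2 tendsto_mult bump_tendsto tendsto_const)
    show "AE t in lborel. norm (?\<eta> k t * b t) \<le> \<bar>b t\<bar>" for k
      by (intro AE_I2) (simp add: abs_mult abs_of_nonneg[OF bump_nonneg] mult_left_le_one_le bump_le_1 bump_nonneg)
  qed (use b in auto)
  ultimately have "a t\<^sub>1 - a t\<^sub>2 = (LINT t|lborel. indicator (box t\<^sub>1 t\<^sub>2) t * b t)"
    using LIMSEQ_unique by blast
  then show ?thesis by (simp add: box_real)
qed

lemma weak_derivative_imp_increment: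
  fixes a b :: "real \<Rightarrow> real"
  assumes a: "continuous_on {0..T} a" and b: "integrable lborel b"
    and weak: "\<And>\<eta>. \<eta> \<in> test_functions {0<..<T} \<Longrightarrow> (LINT t|lborel. deriv \<eta> t * a t) = (LINT t|lborel. \<eta> t * b t)"
    and t: "0 \<le> t\<^sub>1" "t\<^sub>1 < t\<^sub>2" "t\<^sub>2 < T"
  shows "a t\<^sub>2 - a t\<^sub>1 = - (LINT t|lborel. indicator {t\<^sub>1<..<t\<^sub>2} t * b t)"
proof -
  define \<tau> where "\<tau> k = t\<^sub>1 + (t\<^sub>2 - t\<^sub>1) * (1 / (real k + 2))" for k
  have \<tau>: "t\<^sub>1 < \<tau> k" "\<tau> k < t\<^sub>2" for k
  proof -
    have "(t\<^sub>2 - t\<^sub>1) * (1 / (real k + 2)) < (t\<^sub>2 - t\<^sub>1) * 1"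
      using t by (intro mult_strict_left_mono) auto
    moreover have "0 < (t\<^sub>2 - t\<^sub>1) * (1 / (real k + 2))"
      using t by (intro mult_pos_pos) auto
    ultimately show "t\<^sub>1 < \<tau> k" "\<tau> k < t\<^sub>2" by (auto simp: \<tau>_def)
  qed
  have \<tau>lim: "\<tau> \<longlonglongrightarrow> t\<^sub>1"
  proof -
    have "(\<lambda>k. 1 / (real k + 2)) \<longlonglongrightarrow> 0"
      using LIMSEQ_ignore_initial_segment[OF lim_1_over_n[where 'a = real], of 2] by (simp add: add.commute)
    then have "\<tau> \<longlonglongrightarrow> t\<^sub>1 + (t\<^sub>2 - t\<^sub>1) * 0"
      unfolding \<tau>_def by (intro tendsto_intros)
    then show ?thesis by simp
  qed
  have "\<tau> k \<in> {0..T}" for k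
    using \<tau>[of k] t by auto
  then have "(\<lambda>k. a t\<^sub>2 - a (\<tau> k)) \<longlonglongrightarrow> a t\<^sub>2 - a t\<^sub>1"
    using t by (intro tendsto_intros continuous_on_tendsto_compose[OF a \<tau>lim] always_eventually allI) auto
  moreover have "a t\<^sub>2 - a (\<tau> k) = - (LINT t|lborel. indicator {\<tau> k<..<t\<^sub>2} t * b t)" for k
  proof (rule weak_derivative_imp_increment_interior[OF _ b weak])
    show "continuous_on {\<tau> k..t\<^sub>2} a"
      using \<tau>[of k] t by (intro continuous_on_subset[OF a]) auto
  qed (use \<tau>[of k] t in auto)
  moreover have "(\<lambda>k. - (LINT t|lborel. indicator {\<tau> k<..<t\<^sub>2} t * b t)) \<longlonglongrightarrow> - (LINT t|lborel. indicator {t\<^sub>1<..<t\<^sub>2} t * b t)"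
  proof (intro tendsto_minus integral_dominated_convergence[where w = "\<lambda>t. \<bar>b t\<bar>"])
    have [measurable]: "b \<in> borel_measurable borel" using b by auto
    show "(\<lambda>t. indicator {t\<^sub>1<..<t\<^sub>2} t * b t) \<in> borel_measurable lborel"
      "(\<lambda>t. indicator {\<tau> k<..<t\<^sub>2} t * b t) \<in> borel_measurable lborel" for k by measurable
    show "AE t in lborel. norm (indicator {\<tau> k<..<t\<^sub>2} t * b t) \<le> \<bar>b t\<bar>" for k
      by (auto split: split_indicator)
    have "(\<lambda>k. indicator {\<tau> k<..<t\<^sub>2} s * b s) \<longlonglongrightarrow> indicator {t\<^sub>1<..<t\<^sub>2} s * b s" for s
    proof (rule tendsto_eventually)
      show "\<forall>\<^sub>F k in sequentially. indicator {\<tau> k<..<t\<^sub>2} s * b s = indicator {t\<^sub>1<..<t\<^sub>2} s * b s"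
      proof (cases "t\<^sub>1 < s")
        case True
        have "\<forall>\<^sub>F k in sequentially. \<tau> k < s"
          by (rule order_tendstoD(2)[OF \<tau>lim True])
        then show ?thesis by eventually_elim (use True in \<open>auto split: split_indicator\<close>)
      next
        case False
        then have "s \<notin> {\<tau> k<..<t\<^sub>2}" for k using \<tau>(1)[of k] by auto
        then show ?thesis using False by simp
      qed
    qed
    then show "AE t in lborel. (\<lambda>k. indicator {\<tau> k<..<t\<^sub>2} t * b t) \<longlonglongrightarrow> indicator {t\<^sub>1<..<t\<^sub>2} t * b t"
      by simp
  qed (use b in auto)
  ultimately show ?thesis
    using LIMSEQ_unique by fastforce
qed

subsection \<open>Testing with Sobolev functions of zero trace\<close>

text \<open>
  Test functions approximate a Sobolev function in \<open>W\<^sup>1\<^sup>,\<^sup>p\<close>, which need not embed into \<open>L\<^sup>2\<close>. The truncated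
  test functions are again test functions and are bounded, so that both sides of a weak identity
  pass to the limit by dominated convergence.
\<close>

definition trunc :: "real \<Rightarrow> 'b::real_inner \<Rightarrow> 'b"
  where "trunc k y = exp (- (1 / k) * (y \<bullet> y)) *\<^sub>R y"

text \<open>The chain rule for \<open>trunc k\<close>, with y and \<Gamma> in the roles of the value
  and the Jacobian. The subtracted matrix is the rank-one product of y with the row vector obtained
  by multiplying \<Gamma> from the left by y.\<close>

definition trunc_jacobian :: "real \<Rightarrow> real^'m \<Rightarrow> real^'n^'m \<Rightarrow> real^'n^'m"
  where "trunc_jacobian k y \<Gamma> =
    exp (- (1 / k) * (y \<bullet> y)) *\<^sub>R (\<Gamma> - (2 / k) *\<^sub>R (\<chi> j. y $ j *\<^sub>R (\<Sum>l\<in>UNIV. y $ l *\<^sub>R \<Gamma> $ l)))"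

lemma trunc_test_function:
  fixes \<phi> :: "real^'n \<Rightarrow> real^'m"
  assumes \<phi>: "\<phi> \<in> test_functions U"
  shows "(\<lambda>x. trunc k (\<phi> x)) \<in> test_functions U"
    and "jacobian (\<lambda>x. trunc k (\<phi> x)) (at x) = trunc_jacobian k (\<phi> x) (jacobian \<phi> (at x))"
proof -
  note C = test_functions_Ck[OF \<phi>]
  have Ctr: "Ck j (\<lambda>x. trunc k (\<phi> x))" for j
    unfolding trunc_def
    by (rule Ck_scaleR[OF Ck_compose[OF Ck_exp Ck_mult[OF Ck_const Ck_inner[OF C C]]] C])
  show test: "(\<lambda>x. trunc k (\<phi> x)) \<in> test_functions U"
    by (rule test_functions_vanish[OF \<phi> Ctr]) (simp add: trunc_def)
  let ?D = "frechet_derivative \<phi> (at x)"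
  have "((\<lambda>x. trunc k (\<phi> x)) has_derivative
     (\<lambda>h. exp (- (1 / k) * (\<phi> x \<bullet> \<phi> x)) *\<^sub>R ?D h +
        (exp (- (1 / k) * (\<phi> x \<bullet> \<phi> x)) * (- (1 / k) * (\<phi> x \<bullet> ?D h + ?D h \<bullet> \<phi> x))) *\<^sub>R \<phi> x)) (at x)"
    unfolding trunc_def
    by (rule derivative_eq_intros test_functions_has_derivative[OF \<phi>] refl)+ (simp add: mult.commute)
  from fun_cong[OF frechet_derivative_at[OF this], symmetric]
  have D: "frechet_derivative (\<lambda>x. trunc k (\<phi> x)) (at x) h =
     exp (- (1 / k) * (\<phi> x \<bullet> \<phi> x)) *\<^sub>R ?D h +
        (exp (- (1 / k) * (\<phi> x \<bullet> \<phi> x)) * (- (1 / k) * (\<phi> x \<bullet> ?D h + ?D h \<bullet> \<phi> x))) *\<^sub>R \<phi> x" for h .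
  have inner: "\<phi> x \<bullet> ?D (axis i 1) = (\<Sum>l\<in>UNIV. \<phi> x $ l * jacobian \<phi> (at x) $ l $ i)" for i
    by (simp add: inner_vec_def jacobian_test_function(3)[OF \<phi>])
  show "jacobian (\<lambda>x. trunc k (\<phi> x)) (at x) = trunc_jacobian k (\<phi> x) (jacobian \<phi> (at x))"
    by (simp add: vec_eq_iff jacobian_test_function(3)[OF test] D inner_commute[of "?D _"] inner trunc_jacobian_def
      jacobian_test_function(3)[OF \<phi>, symmetric] sum_component algebra_simps)
qed

lemma mult_exp_minus_le_1:
  fixes s :: real
  assumes "s \<ge> 0"
  shows "s * exp (- s) \<le> 1"
proof -
  have "s \<le> exp s" using exp_ge_add_one_self[of s] by linarith
  then show ?thesis by (simp add: exp_minus field_simps)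
qed

text \<open>The second bound combines |y| \<le> 1 + |y|^2 with s exp (- s) \<le> 1 for s = |y|^2 /
  k.\<close>

lemma norm_trunc_le:
  assumes "k > 0"
  shows "norm (trunc k y) \<le> norm y" and "norm (trunc k y) \<le> 1 + k"
proof -
  let ?e = "exp (- (1 / k) * (y \<bullet> y))"
  have e: "?e \<le> 1" "?e \<ge> 0" using assms by auto
  show "norm (trunc k y) \<le> norm y"
    using e mult_right_mono[OF e(1), of "norm y"] by (simp add: trunc_def)
  have "norm y \<le> 1 + (norm y)\<^sup>2"
    using sum_power2_ge_zero[of "norm y - 1" 0] by (simp add: power2_eq_square algebra_simps) (smt (verit) norm_ge_zero)
  then have "?e * norm y \<le> ?e * (1 + (norm y)\<^sup>2)"
    using e by (intro mult_left_mono) auto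
  also have "\<dots> = ?e + k * ((1 / k) * (y \<bullet> y) * exp (- ((1 / k) * (y \<bullet> y))))"
    using assms by (simp add: algebra_simps power2_norm_eq_inner)
  also have "\<dots> \<le> 1 + k * 1"
    using e assms by (intro add_mono mult_left_mono mult_exp_minus_le_1) auto
  finally show "norm (trunc k y) \<le> 1 + k"
    by (simp add: trunc_def)
qed

text \<open>The rank-one part has norm at most |y|^2 |\<Gamma>|, and its prefactor (2/k) exp (-
  |y|^2 / k) turns this into at most 2 |\<Gamma>|. The constant 3 = 1 + 2 is independent of k, so
  one majorant serves both limits that follow.\<close>

lemma norm_trunc_jacobian_le:
  fixes \<Gamma> :: "real^'n^'m"
  assumes "k > 0"
  shows "norm (trunc_jacobian k y \<Gamma>) \<le> 3 * norm \<Gamma>"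
proof -
  let ?e = "exp (- (1 / k) * (y \<bullet> y))"
  let ?v = "\<Sum>l\<in>UNIV. y $ l *\<^sub>R \<Gamma> $ l"
  have e: "?e \<le> 1" "?e \<ge> 0" using assms by auto
  have "norm ?v \<le> (\<Sum>l\<in>UNIV. \<bar>norm (y $ l)\<bar> * \<bar>norm (\<Gamma> $ l)\<bar>)"
    by (rule order_trans[OF norm_sum]) simp
  also have "\<dots> \<le> norm y * norm \<Gamma>"
    unfolding norm_vec_def[of y] norm_vec_def[of \<Gamma>] by (rule L2_set_mult_ineq)
  finally have v: "norm ?v \<le> norm y * norm \<Gamma>" .
  have "norm (\<chi> j. y $ j *\<^sub>R ?v) = norm y * norm ?v"
    unfolding norm_vec_def[of "\<chi> j. y $ j *\<^sub>R ?v"] norm_vec_def[of y]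
    by (simp add: L2_set_left_distrib)
  also have "\<dots> \<le> norm y * (norm y * norm \<Gamma>)"
    using v by (intro mult_left_mono) auto
  also have "\<dots> = (y \<bullet> y) * norm \<Gamma>"
    by (simp add: dot_square_norm power2_eq_square)
  finally have outer: "norm (\<chi> j. y $ j *\<^sub>R ?v) \<le> (y \<bullet> y) * norm \<Gamma>" .
  have "norm (trunc_jacobian k y \<Gamma>) = ?e * norm (\<Gamma> - (2 / k) *\<^sub>R (\<chi> j. y $ j *\<^sub>R ?v))"
    by (simp add: trunc_jacobian_def)
  also have "\<dots> \<le> ?e * (norm \<Gamma> + (2 / k) * ((y \<bullet> y) * norm \<Gamma>))"
    using outer assms
    by (intro mult_left_mono order_trans[OF norm_triangle_ineq4] add_left_mono)
       (auto simp: divide_right_mono)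
  also have "\<dots> = (?e + 2 * ((1 / k) * (y \<bullet> y) * exp (- ((1 / k) * (y \<bullet> y))))) * norm \<Gamma>"
    using assms by (simp add: algebra_simps)
  also have "\<dots> \<le> (1 + 2 * 1) * norm \<Gamma>"
    using e assms by (intro mult_right_mono add_mono mult_left_mono mult_exp_minus_le_1) auto
  finally show ?thesis by simp
qed

lemma tendsto_trunc:
  assumes "(f \<longlongrightarrow> y) F"
  shows "((\<lambda>j. trunc k (f j)) \<longlongrightarrow> trunc k y) F"
  unfolding trunc_def by (intro tendsto_intros assms)

lemma tendsto_trunc_jacobian:
  assumes "(f \<longlongrightarrow> y) F" "(g \<longlongrightarrow> \<Gamma>) F"
  shows "((\<lambda>j. trunc_jacobian k (f j) (g j)) \<longlongrightarrow> trunc_jacobian k y \<Gamma>) F"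
  unfolding trunc_jacobian_def by (intro tendsto_intros assms)

lemma tendsto_trunc_limit: "(\<lambda>k. trunc (real (Suc k)) y) \<longlonglongrightarrow> y"
proof -
  have inv: "(\<lambda>k. 1 / real (Suc k)) \<longlonglongrightarrow> 0"
    using LIMSEQ_inverse_real_of_nat by (simp add: inverse_eq_divide)
  have "(\<lambda>k. exp (- (1 / real (Suc k)) * (y \<bullet> y)) *\<^sub>R y) \<longlonglongrightarrow> exp (- 0 * (y \<bullet> y)) *\<^sub>R y"
    by (intro tendsto_intros inv)
  then show ?thesis by (simp add: trunc_def)
qed

lemma tendsto_trunc_jacobian_limit:
  fixes \<Gamma> :: "real^'n^'m"
  shows "(\<lambda>k. trunc_jacobian (real (Suc k)) y \<Gamma>) \<longlonglongrightarrow> \<Gamma>"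
proof -
  have inv: "(\<lambda>k. 1 / real (Suc k)) \<longlonglongrightarrow> 0"
    using LIMSEQ_inverse_real_of_nat by (simp add: inverse_eq_divide)
  have "(\<lambda>k. exp (- (1 / real (Suc k)) * (y \<bullet> y)) *\<^sub>R (\<Gamma> - (2 * (1 / real (Suc k))) *\<^sub>R (\<chi> j. y $ j *\<^sub>R (\<Sum>l\<in>UNIV. y $ l *\<^sub>R \<Gamma> $ l))))
    \<longlonglongrightarrow> exp (- 0 * (y \<bullet> y)) *\<^sub>R (\<Gamma> - (2 * 0) *\<^sub>R (\<chi> j. y $ j *\<^sub>R (\<Sum>l\<in>UNIV. y $ l *\<^sub>R \<Gamma> $ l)))"
    by (intro tendsto_intros inv)
  then show ?thesis by (simp add: trunc_jacobian_def)
qed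

lemma borel_measurable_trunc [measurable]:
  fixes f :: "'a \<Rightarrow> 'b::euclidean_space"
  assumes [measurable]: "f \<in> borel_measurable M"
  shows "(\<lambda>x. trunc k (f x)) \<in> borel_measurable M"
  unfolding trunc_def by measurable

lemma borel_measurable_trunc_jacobian [measurable]:
  fixes g :: "'a \<Rightarrow> real^'n^'m"
  assumes "f \<in> borel_measurable M" "g \<in> borel_measurable M"
  shows "(\<lambda>x. trunc_jacobian k (f x) (g x)) \<in> borel_measurable M"
  using assms unfolding trunc_jacobian_def
  by (rule borel_measurable_continuous_Pair) (intro continuous_intros)

text \<open>Two successive limits. At a fixed truncation level K the bound 1 + K lets j
  \<rightarrow> \<infinity> although E is merely integrable; then K \<rightarrow> \<infinity> with
  majorant |E| |\<omega>|. The gradient side is dominated by 3 |\<beta>| H in both limits. The map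
  \<pi> allows the gradient side to be an integral over space-time of a spatial test function. There
  \<theta> is a measurable stand-in for \<omega> composed with \<pi>, and convergence is required
  only where \<beta> does not vanish.\<close>

lemma extend_weak_identity:
  fixes E \<omega> :: "real^'n \<Rightarrow> real^'m" and \<beta> \<Gamma> :: "'a \<Rightarrow> real^'n^'m" and \<pi> :: "'a \<Rightarrow> real^'n"
  assumes identity: "\<And>\<phi>. \<phi> \<in> test_functions \<Omega> \<Longrightarrow>
       (LINT x|lebesgue_on \<Omega>. E x \<bullet> \<phi> x) = - (LINT z|M. \<beta> z \<bullet> jacobian \<phi> (at (\<pi> z)))"
    and \<phi>: "\<And>j. \<phi> j \<in> test_functions \<Omega>"
    and E: "integrable (lebesgue_on \<Omega>) E" and E\<omega>: "integrable (lebesgue_on \<Omega>) (\<lambda>x. norm (E x) * norm (\<omega> x))"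
    and \<omega> [measurable]: "\<omega> \<in> borel_measurable (lebesgue_on \<Omega>)"
    and [measurable]: "\<pi> \<in> measurable M borel" "\<beta> \<in> borel_measurable M" "\<Gamma> \<in> borel_measurable M" "\<theta> \<in> borel_measurable M"
    and conv\<omega>: "AE x in lebesgue_on \<Omega>. (\<lambda>j. \<phi> j x) \<longlonglongrightarrow> \<omega> x"
    and conv\<Gamma>: "AE z in M. \<beta> z = 0 \<or> (\<lambda>j. \<phi> j (\<pi> z)) \<longlonglongrightarrow> \<theta> z \<and> (\<lambda>j. jacobian (\<phi> j) (at (\<pi> z))) \<longlonglongrightarrow> \<Gamma> z \<and>
       (\<forall>j. norm (jacobian (\<phi> j) (at (\<pi> z))) \<le> H z)"
    and \<beta>H: "integrable M (\<lambda>z. norm (\<beta> z) * H z)"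
  shows "(LINT x|lebesgue_on \<Omega>. E x \<bullet> \<omega> x) = - (LINT z|M. \<beta> z \<bullet> \<Gamma> z)"
proof -
  have [measurable]: "E \<in> borel_measurable (lebesgue_on \<Omega>)" using E by auto
  have \<phi>m: "\<psi> \<in> borel_measurable (lebesgue_on \<Omega>)" if "\<psi> \<in> test_functions \<Omega>" for \<psi> :: "real^'n \<Rightarrow> real^'m"
    by (rule measurable_restrict_space1[OF borel_measurable_lebesgueI[OF test_functions_borel_measurable[OF that]]])
  have \<phi>\<pi>m: "(\<lambda>z. jacobian \<psi> (at (\<pi> z))) \<in> borel_measurable M" if "\<psi> \<in> test_functions \<Omega>" for \<psi> :: "real^'n \<Rightarrow> real^'m"
    by (rule measurable_compose[OF _ jacobian_test_function(1)[OF that]]) measurable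
  have H: "AE z in M. \<beta> z = 0 \<or> norm (\<Gamma> z) \<le> H z"
    using conv\<Gamma>
  proof eventually_elim
    case (elim z)
    then show ?case by (auto intro: LIMSEQ_le_const2[OF tendsto_norm])
  qed
  have trunc_identity: "(LINT x|lebesgue_on \<Omega>. E x \<bullet> trunc K (\<omega> x)) = - (LINT z|M. \<beta> z \<bullet> trunc_jacobian K (\<theta> z) (\<Gamma> z))"
    if K: "K > 0" for K
  proof -
    have "(\<lambda>j. LINT x|lebesgue_on \<Omega>. E x \<bullet> trunc K (\<phi> j x)) \<longlonglongrightarrow> (LINT x|lebesgue_on \<Omega>. E x \<bullet> trunc K (\<omega> x))"
    proof (rule integral_dominated_convergence[where w = "\<lambda>x. norm (E x) * (1 + K)"])
      show "(\<lambda>x. E x \<bullet> trunc K (\<phi> j x)) \<in> borel_measurable (lebesgue_on \<Omega>)" for j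
        using \<phi>m[OF \<phi>[of j]] by measurable
      show "AE x in lebesgue_on \<Omega>. (\<lambda>j. E x \<bullet> trunc K (\<phi> j x)) \<longlonglongrightarrow> E x \<bullet> trunc K (\<omega> x)"
        using conv\<omega> by eventually_elim (intro tendsto_intros tendsto_trunc)
      show "AE x in lebesgue_on \<Omega>. norm (E x \<bullet> trunc K (\<phi> j x)) \<le> norm (E x) * (1 + K)" for j
        using norm_trunc_le(2)[OF K]
        by (intro AE_I2) (auto intro!: order_trans[OF Cauchy_Schwarz_ineq2] mult_left_mono)
      show "integrable (lebesgue_on \<Omega>) (\<lambda>x. norm (E x) * (1 + K))"
        using E by simp
    qed measurable
    moreover have "(\<lambda>j. LINT z|M. \<beta> z \<bullet> jacobian (\<lambda>x. trunc K (\<phi> j x)) (at (\<pi> z))) \<longlonglongrightarrow> (LINT z|M. \<beta> z \<bullet> trunc_jacobian K (\<theta> z) (\<Gamma> z))"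
    proof (rule integral_dominated_convergence[where w = "\<lambda>z. 3 * (norm (\<beta> z) * H z)"])
      show "(\<lambda>z. \<beta> z \<bullet> jacobian (\<lambda>x. trunc K (\<phi> j x)) (at (\<pi> z))) \<in> borel_measurable M" for j
        using \<phi>\<pi>m[OF trunc_test_function(1)[OF \<phi>]] by measurable
      show "AE z in M. (\<lambda>j. \<beta> z \<bullet> jacobian (\<lambda>x. trunc K (\<phi> j x)) (at (\<pi> z))) \<longlonglongrightarrow> \<beta> z \<bullet> trunc_jacobian K (\<theta> z) (\<Gamma> z)"
        using conv\<Gamma>
      proof eventually_elim
        case (elim z)
        then show ?case
          by (cases "\<beta> z = 0") (auto simp: trunc_test_function(2)[OF \<phi>] intro!: tendsto_intros tendsto_trunc_jacobian)
      qed
      show "AE z in M. norm (\<beta> z \<bullet> jacobian (\<lambda>x. trunc K (\<phi> j x)) (at (\<pi> z))) \<le> 3 * (norm (\<beta> z) * H z)" for j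
        using conv\<Gamma>
      proof eventually_elim
        case (elim z)
        show ?case
        proof (cases "\<beta> z = 0")
          case False
          then have "norm (jacobian (\<phi> j) (at (\<pi> z))) \<le> H z" using elim by blast
          then have "norm (trunc_jacobian K (\<phi> j (\<pi> z)) (jacobian (\<phi> j) (at (\<pi> z)))) \<le> 3 * H z"
            using norm_trunc_jacobian_le[OF K, of "\<phi> j (\<pi> z)" "jacobian (\<phi> j) (at (\<pi> z))"] by linarith
          then have "norm (\<beta> z) * norm (trunc_jacobian K (\<phi> j (\<pi> z)) (jacobian (\<phi> j) (at (\<pi> z)))) \<le> norm (\<beta> z) * (3 * H z)"
            by (intro mult_left_mono) auto
          then show ?thesis
            using Cauchy_Schwarz_ineq2[of "\<beta> z" "trunc_jacobian K (\<phi> j (\<pi> z)) (jacobian (\<phi> j) (at (\<pi> z)))"]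
            by (simp add: trunc_test_function(2)[OF \<phi>])
        qed simp
      qed
      show "integrable M (\<lambda>z. 3 * (norm (\<beta> z) * H z))"
        using \<beta>H by (rule integrable_mult_right)
    qed measurable
    moreover
    have "(LINT x|lebesgue_on \<Omega>. E x \<bullet> trunc K (\<phi> j x)) = - (LINT z|M. \<beta> z \<bullet> jacobian (\<lambda>x. trunc K (\<phi> j x)) (at (\<pi> z)))" for j
      by (rule identity[OF trunc_test_function(1)[OF \<phi>]])
    ultimately show ?thesis
      using LIMSEQ_unique[OF _ tendsto_minus] by (simp only:)
  qed
  have "(\<lambda>k. LINT x|lebesgue_on \<Omega>. E x \<bullet> trunc (real (Suc k)) (\<omega> x)) \<longlonglongrightarrow> (LINT x|lebesgue_on \<Omega>. E x \<bullet> \<omega> x)"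
  proof (rule integral_dominated_convergence[OF _ _ E\<omega>])
    show "AE x in lebesgue_on \<Omega>. (\<lambda>k. E x \<bullet> trunc (real (Suc k)) (\<omega> x)) \<longlonglongrightarrow> E x \<bullet> \<omega> x"
      by (intro AE_I2 tendsto_inner tendsto_const tendsto_trunc_limit)
    show "AE x in lebesgue_on \<Omega>. norm (E x \<bullet> trunc (real (Suc k)) (\<omega> x)) \<le> norm (E x) * norm (\<omega> x)" for k
      using norm_trunc_le(1)[of "real (Suc k)"]
      by (intro AE_I2) (auto intro!: order_trans[OF Cauchy_Schwarz_ineq2] mult_left_mono)
  qed measurable
  moreover
  have "(\<lambda>k. LINT z|M. \<beta> z \<bullet> trunc_jacobian (real (Suc k)) (\<theta> z) (\<Gamma> z)) \<longlonglongrightarrow> (LINT z|M. \<beta> z \<bullet> \<Gamma> z)"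
  proof (rule integral_dominated_convergence[where w = "\<lambda>z. 3 * (norm (\<beta> z) * H z)"])
    show "AE z in M. (\<lambda>k. \<beta> z \<bullet> trunc_jacobian (real (Suc k)) (\<theta> z) (\<Gamma> z)) \<longlonglongrightarrow> \<beta> z \<bullet> \<Gamma> z"
      by (intro AE_I2 tendsto_inner tendsto_const tendsto_trunc_jacobian_limit)
    show "AE z in M. norm (\<beta> z \<bullet> trunc_jacobian (real (Suc k)) (\<theta> z) (\<Gamma> z)) \<le> 3 * (norm (\<beta> z) * H z)" for k
      using H
    proof eventually_elim
      case (elim z)
      show ?case
      proof (cases "\<beta> z = 0")
        case False
        then have "norm (trunc_jacobian (real (Suc k)) (\<theta> z) (\<Gamma> z)) \<le> 3 * H z"
          using elim norm_trunc_jacobian_le[of "real (Suc k)" "\<theta> z" "\<Gamma> z"] by force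
        then have "norm (\<beta> z) * norm (trunc_jacobian (real (Suc k)) (\<theta> z) (\<Gamma> z)) \<le> norm (\<beta> z) * (3 * H z)"
          by (intro mult_left_mono) auto
        then show ?thesis
          using Cauchy_Schwarz_ineq2[of "\<beta> z" "trunc_jacobian (real (Suc k)) (\<theta> z) (\<Gamma> z)"] by simp
      qed simp
    qed
    show "integrable M (\<lambda>z. 3 * (norm (\<beta> z) * H z))"
      using \<beta>H by (rule integrable_mult_right)
  qed measurable
  from tendsto_minus[OF this]
  have "(\<lambda>k. LINT x|lebesgue_on \<Omega>. E x \<bullet> trunc (real (Suc k)) (\<omega> x)) \<longlonglongrightarrow> - (LINT z|M. \<beta> z \<bullet> \<Gamma> z)"
    by (subst trunc_identity) simp_all
  ultimately show ?thesis
    by (rule LIMSEQ_unique)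
qed

subsection \<open>The energy argument\<close>

lemma AE_lborel_fst:
  fixes P :: "'a::euclidean_space \<Rightarrow> bool"
  assumes "AE x in lborel. P x"
  shows "AE z in (lborel :: ('a \<times> 'b::euclidean_space) measure). P (fst z)"
proof -
  obtain N where N: "N \<in> null_sets lborel" "{x. \<not> P x} \<subseteq> N"
    using assms by (auto elim!: AE_E3 simp: eventually_ae_filter)
  have "N \<times> (UNIV :: 'b set) \<in> null_sets (lborel \<Otimes>\<^sub>M lborel)"
    by (rule lborel.times_in_null_sets1[OF N(1)]) simp
  then have "N \<times> (UNIV :: 'b set) \<in> null_sets lborel"
    unfolding lborel_prod .
  then show ?thesis
    by (rule AE_I') (use N(2) in auto)
qed

text \<open>The weight d is fixed before the limit is taken, so C d may blow up as d \<rightarrow>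
  0. This replaces Cauchy-Schwarz by its additive form with weights and avoids square roots of
  integrals.\<close>

lemma tendsto_if_weighted_bound:
  fixes x :: "'a \<Rightarrow> real"
  assumes I: "(I \<longlongrightarrow> 0) F" and K: "K \<ge> 0"
    and le: "\<And>d. d > 0 \<Longrightarrow> \<forall>\<^sub>F s in F. \<bar>x s - y\<bar> \<le> C d * I s + d * K"
  shows "(x \<longlongrightarrow> y) F"
proof (rule tendstoI)
  fix e :: real assume e: "e > 0"
  define d where "d = e / (2 * (K + 1))"
  have d: "d > 0" "d * K < e / 2" using e K by (auto simp: d_def field_simps)
  have "((\<lambda>s. C d * I s) \<longlongrightarrow> C d * 0) F"
    by (intro tendsto_intros I)
  then have "\<forall>\<^sub>F s in F. C d * I s < e / 2"
    by (rule order_tendstoD(2)) (use e in simp)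
  with le[OF d(1)] show "\<forall>\<^sub>F s in F. dist (x s) y < e"
    by eventually_elim (use d(2) in \<open>simp add: dist_real_def\<close>)
qed

lemma norm_powr_two: "norm x powr 2 = (norm x)\<^sup>2"
  by (cases "x = 0") (auto simp: powr_numeral)

lemma Lp_space_two:
  "v \<in> Lp_space 2 U \<longleftrightarrow> v \<in> borel_measurable (lebesgue_on U) \<and> integrable (lebesgue_on U) (\<lambda>x. (norm (v x))\<^sup>2)"
  by (simp add: Lp_space_def norm_powr_two)

text \<open>Expansion of (|a| - d |b|)^2 \<ge> 0, giving away a factor 2.\<close>

lemma mult_le_weighted_squares:
  fixes a b :: real
  assumes "d > 0"
  shows "\<bar>a * b\<bar> \<le> (1 / d) * a\<^sup>2 + d * b\<^sup>2"
proof -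
  have "0 \<le> (\<bar>a\<bar> - d * \<bar>b\<bar>)\<^sup>2" by simp
  also have "(\<bar>a\<bar> - d * \<bar>b\<bar>)\<^sup>2 = a\<^sup>2 + d\<^sup>2 * b\<^sup>2 - 2 * (d * \<bar>a * b\<bar>)"
    by (simp add: power2_diff power_mult_distrib abs_mult algebra_simps)
  finally have "d * \<bar>a * b\<bar> \<le> a\<^sup>2 + d\<^sup>2 * b\<^sup>2"
    using assms by (simp add: mult_nonneg_nonneg) (smt (verit) abs_ge_zero assms mult_nonneg_nonneg)
  then have "\<bar>a * b\<bar> \<le> (a\<^sup>2 + d\<^sup>2 * b\<^sup>2) / d"
    using assms by (simp add: pos_le_divide_eq mult.commute)
  then show ?thesis
    using assms by (simp add: field_simps power2_eq_square)
qed

lemma Lp_space_two_products: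
  fixes v w :: "'a::euclidean_space \<Rightarrow> 'b::euclidean_space"
  assumes "v \<in> Lp_space 2 U" "w \<in> Lp_space 2 U"
  shows "integrable (lebesgue_on U) (\<lambda>x. norm (v x) * norm (w x))"
    and "integrable (lebesgue_on U) (\<lambda>x. v x \<bullet> w x)"
    and "(\<lambda>x. v x - w x) \<in> Lp_space 2 U"
    and "d > 0 \<Longrightarrow> \<bar>LINT x|lebesgue_on U. v x \<bullet> w x\<bar> \<le>
      (1 / d) * (LINT x|lebesgue_on U. (norm (v x))\<^sup>2) + d * (LINT x|lebesgue_on U. (norm (w x))\<^sup>2)"
proof -
  let ?M = "lebesgue_on U"
  have [measurable]: "v \<in> borel_measurable ?M" "w \<in> borel_measurable ?M"
    and int: "integrable ?M (\<lambda>x. (norm (v x))\<^sup>2)" "integrable ?M (\<lambda>x. (norm (w x))\<^sup>2)"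
    using assms by (auto simp: Lp_space_two)
  show p: "integrable ?M (\<lambda>x. norm (v x) * norm (w x))"
  proof (rule Bochner_Integration.integrable_bound)
    show "integrable ?M (\<lambda>x. (norm (v x))\<^sup>2 + (norm (w x))\<^sup>2)" using int by simp
    show "AE x in ?M. norm (norm (v x) * norm (w x)) \<le> norm ((norm (v x))\<^sup>2 + (norm (w x))\<^sup>2)"
      using mult_le_weighted_squares[of 1 "norm (v x)" "norm (w x)" for x]
      by (intro AE_I2) (simp add: abs_mult)
  qed measurable
  show i: "integrable ?M (\<lambda>x. v x \<bullet> w x)"
    by (rule Bochner_Integration.integrable_bound[OF p]) (auto simp: Cauchy_Schwarz_ineq2)
  have "integrable ?M (\<lambda>x. (norm (v x))\<^sup>2 + (norm (w x))\<^sup>2 - 2 * (v x \<bullet> w x))"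
    using int i by simp
  then show "(\<lambda>x. v x - w x) \<in> Lp_space 2 U"
    by (simp add: Lp_space_two power2_norm_eq_inner inner_diff_left inner_diff_right inner_commute algebra_simps)
  show "\<bar>LINT x|?M. v x \<bullet> w x\<bar> \<le> (1 / d) * (LINT x|?M. (norm (v x))\<^sup>2) + d * (LINT x|?M. (norm (w x))\<^sup>2)"
    if d: "d > 0"
  proof -
    have "\<bar>LINT x|?M. v x \<bullet> w x\<bar> \<le> (LINT x|?M. \<bar>v x \<bullet> w x\<bar>)"
      by (rule integral_abs_bound)
    also have "\<dots> \<le> (LINT x|?M. (1 / d) * (norm (v x))\<^sup>2 + d * (norm (w x))\<^sup>2)"
    proof (rule integral_mono)
      show "\<bar>v x \<bullet> w x\<bar> \<le> (1 / d) * (norm (v x))\<^sup>2 + d * (norm (w x))\<^sup>2" for x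
        using mult_le_weighted_squares[OF d, of "norm (v x)" "norm (w x)"] Cauchy_Schwarz_ineq2[of "v x" "w x"]
        by (simp add: abs_mult)
    qed (use i int in auto)
    also have "\<dots> = (1 / d) * (LINT x|?M. (norm (v x))\<^sup>2) + d * (LINT x|?M. (norm (w x))\<^sup>2)"
      using int by simp
    finally show ?thesis .
  qed
qed

section \<open>Continuity in time of square integrals and pairings\<close>

lemma C0_L2_tendsto:
  assumes "U \<in> C0_L2 T \<Omega>" "t \<in> {0..T}"
  shows "((\<lambda>s. LINT x|lebesgue_on \<Omega>. (norm (U s x - U t x))\<^sup>2) \<longlongrightarrow> 0) (at t within {0..T})"
proof -
  have "((\<lambda>s. Lp_norm 2 \<Omega> (\<lambda>x. U s x - U t x)) \<longlongrightarrow> 0) (at t within {0..T})"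
    using assms by (simp add: C0_L2_def)
  then have "((\<lambda>s. (Lp_norm 2 \<Omega> (\<lambda>x. U s x - U t x))\<^sup>2) \<longlongrightarrow> 0\<^sup>2) (at t within {0..T})"
    by (rule tendsto_power)
  moreover have "(Lp_norm 2 \<Omega> v)\<^sup>2 = (LINT x|lebesgue_on \<Omega>. (norm (v x))\<^sup>2)" for v :: "'a \<Rightarrow> 'b"
    by (simp add: Lp_norm_def norm_powr_two powr_half_sqrt)
  ultimately show ?thesis by simp
qed

lemma C0_L2_continuous_inner:
  fixes U :: "real \<Rightarrow> 'a::euclidean_space \<Rightarrow> 'b::euclidean_space"
  assumes U: "U \<in> C0_L2 T \<Omega>" and \<phi>: "\<phi> \<in> Lp_space 2 \<Omega>"
  shows "continuous_on {0..T} (\<lambda>t. LINT x|lebesgue_on \<Omega>. U t x \<bullet> \<phi> x)"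
  unfolding continuous_on_def
proof
  fix t assume t: "t \<in> {0..T}"
  have UL: "U s \<in> Lp_space 2 \<Omega>" if "s \<in> {0..T}" for s
    using U that by (simp add: C0_L2_def)
  show "((\<lambda>t. LINT x|lebesgue_on \<Omega>. U t x \<bullet> \<phi> x) \<longlongrightarrow> (LINT x|lebesgue_on \<Omega>. U t x \<bullet> \<phi> x)) (at t within {0..T})"
  proof (rule tendsto_if_weighted_bound[OF C0_L2_tendsto[OF U t], where C = "\<lambda>d. 1 / d"])
    fix d :: real assume d: "d > 0"
    have "\<forall>\<^sub>F s in at t within {0..T}. s \<in> {0..T}"
      by (simp add: eventually_at_filter)
    then show "\<forall>\<^sub>F s in at t within {0..T}. \<bar>(LINT x|lebesgue_on \<Omega>. U s x \<bullet> \<phi> x) - (LINT x|lebesgue_on \<Omega>. U t x \<bullet> \<phi> x)\<bar>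
      \<le> 1 / d * (LINT x|lebesgue_on \<Omega>. (norm (U s x - U t x))\<^sup>2) + d * (LINT x|lebesgue_on \<Omega>. (norm (\<phi> x))\<^sup>2)"
    proof eventually_elim
      case (elim s)
      note p = Lp_space_two_products
      have "(LINT x|lebesgue_on \<Omega>. U s x \<bullet> \<phi> x) - (LINT x|lebesgue_on \<Omega>. U t x \<bullet> \<phi> x)
         = (LINT x|lebesgue_on \<Omega>. (U s x - U t x) \<bullet> \<phi> x)"
        using p(2)[OF UL[OF elim] \<phi>] p(2)[OF UL[OF t] \<phi>]
        by (simp add: inner_diff_left)
      then show ?case
        using p(4)[OF p(3)[OF UL[OF elim] UL[OF t]] \<phi> d] by simp
    qed
  qed simp
qed

text \<open>From |a|^2 - |b|^2 = |a - b|^2 + 2 (a - b) \<bullet> b the difference is I + 2 J with I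
  \<rightarrow> 0 and |J| \<le> I / d + d K, whence the constants 1 + 2 / d and 2 K.\<close>

lemma C0_L2_continuous_norm:
  fixes U :: "real \<Rightarrow> 'a::euclidean_space \<Rightarrow> 'b::euclidean_space"
  assumes U: "U \<in> C0_L2 T \<Omega>"
  shows "continuous_on {0..T} (\<lambda>t. LINT x|lebesgue_on \<Omega>. (norm (U t x))\<^sup>2)"
  unfolding continuous_on_def
proof
  fix t assume t: "t \<in> {0..T}"
  have UL: "U s \<in> Lp_space 2 \<Omega>" if "s \<in> {0..T}" for s
    using U that by (simp add: C0_L2_def)
  show "((\<lambda>t. LINT x|lebesgue_on \<Omega>. (norm (U t x))\<^sup>2) \<longlongrightarrow> (LINT x|lebesgue_on \<Omega>. (norm (U t x))\<^sup>2)) (at t within {0..T})"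
  proof (rule tendsto_if_weighted_bound[OF C0_L2_tendsto[OF U t], where C = "\<lambda>d. 1 + 2 / d"])
    fix d :: real assume d: "d > 0"
    have "\<forall>\<^sub>F s in at t within {0..T}. s \<in> {0..T}"
      by (simp add: eventually_at_filter)
    then show "\<forall>\<^sub>F s in at t within {0..T}. \<bar>(LINT x|lebesgue_on \<Omega>. (norm (U s x))\<^sup>2) - (LINT x|lebesgue_on \<Omega>. (norm (U t x))\<^sup>2)\<bar>
      \<le> (1 + 2 / d) * (LINT x|lebesgue_on \<Omega>. (norm (U s x - U t x))\<^sup>2) + d * (2 * (LINT x|lebesgue_on \<Omega>. (norm (U t x))\<^sup>2))"
    proof eventually_elim
      case (elim s)
      note p = Lp_space_two_products
      note D = p(3)[OF UL[OF elim] UL[OF t]]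
      have i: "integrable (lebesgue_on \<Omega>) (\<lambda>x. (norm (U s x - U t x))\<^sup>2)"
         "integrable (lebesgue_on \<Omega>) (\<lambda>x. (norm (U t x))\<^sup>2)"
         "integrable (lebesgue_on \<Omega>) (\<lambda>x. (norm (U s x))\<^sup>2)"
        using D UL[OF t] UL[OF elim] by (simp_all add: Lp_space_two)
      have "(LINT x|lebesgue_on \<Omega>. (norm (U s x))\<^sup>2) - (LINT x|lebesgue_on \<Omega>. (norm (U t x))\<^sup>2)
         = (LINT x|lebesgue_on \<Omega>. (norm (U s x))\<^sup>2 - (norm (U t x))\<^sup>2)"
        using i by simp
      also have "\<dots> = (LINT x|lebesgue_on \<Omega>. (norm (U s x - U t x))\<^sup>2 + 2 * ((U s x - U t x) \<bullet> U t x))"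
        by (intro Bochner_Integration.integral_cong refl)
          (simp add: power2_norm_eq_inner inner_diff_left inner_diff_right inner_commute)
      also have "\<dots> = (LINT x|lebesgue_on \<Omega>. (norm (U s x - U t x))\<^sup>2) + 2 * (LINT x|lebesgue_on \<Omega>. (U s x - U t x) \<bullet> U t x)"
        using i p(2)[OF D UL[OF t]] by simp
      finally have eq: "(LINT x|lebesgue_on \<Omega>. (norm (U s x))\<^sup>2) - (LINT x|lebesgue_on \<Omega>. (norm (U t x))\<^sup>2)
         = (LINT x|lebesgue_on \<Omega>. (norm (U s x - U t x))\<^sup>2) + 2 * (LINT x|lebesgue_on \<Omega>. (U s x - U t x) \<bullet> U t x)" .
      have "(LINT x|lebesgue_on \<Omega>. (norm (U s x - U t x))\<^sup>2) \<ge> 0" by simp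
      moreover have "\<bar>I + 2 * J\<bar> \<le> (1 + 2 / d) * I + d * (2 * K)"
        if "I \<ge> 0" "\<bar>J\<bar> \<le> (1 / d) * I + d * K" for I J K
      proof -
        have "(1 + 2 / d) * I + d * (2 * K) = I + 2 * ((1 / d) * I + d * K)"
          by (simp add: algebra_simps)
        then show ?thesis using that by (smt (verit))
      qed
      ultimately show ?case
        using p(4)[OF D UL[OF t] d] unfolding eq by blast
    qed
  qed simp
qed

lemma bounded_open_finite_measure:
  fixes U :: "'a::euclidean_space set"
  assumes "open U" "bounded U"
  shows "finite_measure (lebesgue_on U)"
  by (rule finite_measure_lebesgue_on) (use assms in \<open>simp add: lmeasurable_open\<close>)

lemma Lp_space_two_integrable:
  fixes v :: "'a::euclidean_space \<Rightarrow> 'b::euclidean_space"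
  assumes "open U" "bounded U" "v \<in> Lp_space 2 U"
  shows "integrable (lebesgue_on U) v"
proof -
  interpret finite_measure "lebesgue_on U" by (rule bounded_open_finite_measure[OF assms(1,2)])
  have "integrable (lebesgue_on U) (\<lambda>x. 1 + (norm (v x))\<^sup>2)"
    using assms(3) by (simp add: Lp_space_two)
  then show ?thesis
  proof (rule Bochner_Integration.integrable_bound)
    show "v \<in> borel_measurable (lebesgue_on U)" using assms(3) by (simp add: Lp_space_two)
    have "norm y \<le> 1 + (norm y)\<^sup>2" for y :: 'b
      using mult_le_weighted_squares[of 1 1 "norm y"] by simp
    then show "AE x in lebesgue_on U. norm (v x) \<le> norm (1 + (norm (v x))\<^sup>2)"
      by (auto simp: abs_of_nonneg)
  qed
qed

text \<open>Meant for majorants that depend on x only, such as data frozen at one time: the cut-off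
  in time makes them integrable over space-time.\<close>

lemma integrable_lborel_product_indicator:
  fixes h :: "'a::euclidean_space \<Rightarrow> real" and T :: real
  assumes "integrable lborel h"
  shows "integrable lborel (\<lambda>z. indicator {0<..<T} (snd z) * h (fst z))"
proof -
  have [measurable]: "h \<in> borel_measurable borel" using assms by auto
  have "integrable (lborel \<Otimes>\<^sub>M lborel) (\<lambda>z. indicator {0<..<T} (snd z) * h (fst z))"
  proof (rule lborel_pair.Fubini_integrable)
    show "(\<lambda>z. indicator {0<..<T} (snd z) * h (fst z)) \<in> borel_measurable (lborel \<Otimes>\<^sub>M lborel)"
      by measurable
    have "integrable lborel (\<lambda>x. (LINT y|lborel. indicator {0<..<T} y) * norm (h x))"
      using assms by (intro integrable_mult_right integrable_norm)
    then show "integrable lborel (\<lambda>x. LINT y|lborel. norm (indicator {0<..<T} (snd (x, y)) * h (fst (x, y))))"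
      by (simp add: abs_mult)
    show "AE x in lborel. integrable lborel (\<lambda>y. indicator {0<..<T} (snd (x, y)) * h (fst (x, y)))"
      by (intro AE_I2 integrable_mult_left integrable_real_indicator; cases "0 \<le> T") auto
  qed
  then show ?thesis unfolding lborel_prod .
qed

text \<open>Lets the measurability prover identify the Borel sets of a product with the product
  sigma-algebra.\<close>

lemma measurable_ident_borel_prod [measurable]:
  "(\<lambda>x. x) \<in> (borel :: ('a::second_countable_topology \<times> 'b::second_countable_topology) measure) \<rightarrow>\<^sub>M borel \<Otimes>\<^sub>M borel"
  by (simp add: borel_prod)

text \<open>
  Almost everywhere approximation of a function and its gradient with a gradient bound in \<open>L\<^sup>p\<close>;
  this form of \<open>W\<^sub>0\<^sup>1\<^sup>,\<^sup>p\<close>-convergence is tailored to dominated convergence.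
\<close>

definition test_approximable ::
    "(real^'n) set \<Rightarrow> real \<Rightarrow> (real^'n \<Rightarrow> real^'m) \<Rightarrow> (real^'n \<Rightarrow> real^'n^'m) \<Rightarrow> bool"
  where "test_approximable \<Omega> p \<omega> \<Gamma> \<longleftrightarrow> (\<exists>\<phi> H. (\<forall>j::nat. \<phi> j \<in> test_functions \<Omega>) \<and>
    H \<in> borel_measurable borel \<and> integrable lborel (\<lambda>x. H x powr p) \<and> (\<forall>x. H x \<ge> 0) \<and>
    (AE x in lborel. x \<in> \<Omega> \<longrightarrow> (\<lambda>j. \<phi> j x) \<longlonglongrightarrow> \<omega> x \<and> (\<lambda>j. jacobian (\<phi> j) (at x)) \<longlonglongrightarrow> \<Gamma> x \<and>
      (\<forall>j. norm (jacobian (\<phi> j) (at x)) \<le> H x)))"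

text \<open>
  The difference \<open>w\<close> of two solutions, with the difference \<open>B\<close> of the fluxes and the difference
  \<open>G\<close> of the gradients.
\<close>

locale energy =
  fixes \<Omega> :: "(real^'n) set" and T p q :: real
    and w :: "real \<Rightarrow> real^'n \<Rightarrow> real^'m" and B G :: "(real^'n) \<times> real \<Rightarrow> real^'n^'m"
  assumes \<Omega>: "open \<Omega>" "bounded \<Omega>" and T: "T > 0"
    and pq: "p > 1" "q > 1" "1 / p + 1 / q = 1"
    and Bm [measurable]: "B \<in> borel_measurable borel" and Gm [measurable]: "G \<in> borel_measurable borel"
    and B: "integrable lborel (\<lambda>z. norm (B z) powr q)" and G: "integrable lborel (\<lambda>z. norm (G z) powr p)"
    and B0: "\<And>z. z \<notin> cylinder \<Omega> T \<Longrightarrow> B z = 0"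
    and mono: "AE z in lborel. B z \<bullet> G z \<ge> 0"
    and w: "w \<in> C0_L2 T \<Omega>" and w0: "AE x in lebesgue_on \<Omega>. w 0 x = 0"
    and increment: "\<And>\<phi> t\<^sub>1 t\<^sub>2. \<phi> \<in> test_functions \<Omega> \<Longrightarrow> 0 \<le> t\<^sub>1 \<Longrightarrow> t\<^sub>1 < t\<^sub>2 \<Longrightarrow> t\<^sub>2 < T \<Longrightarrow>
       (LINT x|lebesgue_on \<Omega>. (w t\<^sub>2 x - w t\<^sub>1 x) \<bullet> \<phi> x) =
       - (LINT z|lborel. (indicator {t\<^sub>1<..<t\<^sub>2} (snd z) *\<^sub>R B z) \<bullet> jacobian \<phi> (at (fst z)))"
    and approximation: "AE t in lborel. t \<in> {0<..<T} \<longrightarrow> test_approximable \<Omega> p (w t) (\<lambda>x. G (x, t))"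
begin

lemma wL: "t \<in> {0..T} \<Longrightarrow> w t \<in> Lp_space 2 \<Omega>"
  using w by (simp add: C0_L2_def)

definition sq_norm where "sq_norm t = (LINT x|lebesgue_on \<Omega>. (norm (w t x))\<^sup>2)"

lemma sq_norm_continuous: "continuous_on {0..T} sq_norm"
  unfolding sq_norm_def by (rule C0_L2_continuous_norm[OF w])

lemma sq_norm_nonneg: "sq_norm t \<ge> 0"
  by (simp add: sq_norm_def)

lemma sq_norm_0: "sq_norm 0 = 0"
proof -
  have "sq_norm 0 = (LINT x|lebesgue_on \<Omega>. 0)"
    unfolding sq_norm_def
    by (rule integral_cong_AE) (use wL[of 0] T w0 in \<open>auto simp: Lp_space_two elim: eventually_mono\<close>)
  then show ?thesis by simp
qed

text \<open>For a.e. fixed t the approximations of \<open>w t\<close> are inserted into the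
  increment identity. The exceptional set of times does not depend on s, which matters because s
  will later be chosen as a function of t.\<close>

lemma test_with_solution:
  "AE t in lborel. t \<in> {0<..<T} \<longrightarrow> (\<forall>s. 0 \<le> s \<and> s < t \<longrightarrow>
     (LINT x|lebesgue_on \<Omega>. (w t x - w s x) \<bullet> w t x) =
     - (LINT z|lborel. (indicator {s<..<t} (snd z) *\<^sub>R B z) \<bullet> G (fst z, t)))"
  using approximation
proof eventually_elim
  case (elim t)
  show ?case
  proof (intro impI allI)
    fix s assume t: "t \<in> {0<..<T}" and s: "0 \<le> s \<and> s < t"
    obtain \<phi> H where \<phi>: "\<And>j::nat. \<phi> j \<in> test_functions \<Omega>" and [measurable]: "H \<in> borel_measurable borel"
      and H: "integrable lborel (\<lambda>x. H x powr p)" "\<And>x. H x \<ge> 0"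
      and conv: "AE x in lborel. x \<in> \<Omega> \<longrightarrow> (\<lambda>j. \<phi> j x) \<longlonglongrightarrow> w t x \<and> (\<lambda>j. jacobian (\<phi> j) (at x)) \<longlonglongrightarrow> G (x, t) \<and>
          (\<forall>j. norm (jacobian (\<phi> j) (at x)) \<le> H x)"
      using elim t unfolding test_approximable_def by blast
    have L: "w t \<in> Lp_space 2 \<Omega>" "w s \<in> Lp_space 2 \<Omega>"
      using wL t s by auto
    note E = Lp_space_two_products(3)[OF L]
    have "(\<lambda>x. indicator \<Omega> x *\<^sub>R w t x) \<in> borel_measurable lebesgue"
      using L(1) \<Omega> by (subst borel_measurable_restrict_space_iff[symmetric]) (auto simp: Lp_space_two)
    \<comment> \<open>\<open>w t\<close> is only Lebesgue measurable on the domain; its composition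
      with \<open>fst\<close> on space-time is formed with a Borel representative instead.\<close>
    then obtain W where [measurable]: "W \<in> borel_measurable lborel" and W: "AE x in lborel. indicator \<Omega> x *\<^sub>R w t x = W x"
      by (rule completion_ex_borel_measurable_euclidean)
    have convz: "AE z in (lborel :: ((real^'n) \<times> real) measure). fst z \<in> \<Omega> \<longrightarrow> (\<lambda>j. \<phi> j (fst z)) \<longlonglongrightarrow> W (fst z) \<and>
         (\<lambda>j. jacobian (\<phi> j) (at (fst z))) \<longlonglongrightarrow> G (fst z, t) \<and> (\<forall>j. norm (jacobian (\<phi> j) (at (fst z))) \<le> H (fst z))"
      using AE_lborel_fst[OF conv, where 'b = real] AE_lborel_fst[OF W, where 'b = real]
      by eventually_elim auto
    \<comment> \<open>The gradient bound H is constant in time, so it enters with the indicator of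
      (0, T). This costs nothing, as the flux vanishes off the cylinder.\<close>
    show "(LINT x|lebesgue_on \<Omega>. (w t x - w s x) \<bullet> w t x) =
     - (LINT z|lborel. (indicator {s<..<t} (snd z) *\<^sub>R B z) \<bullet> G (fst z, t))"
    proof (rule extend_weak_identity[where \<theta> = "\<lambda>z. W (fst z)" and H = "\<lambda>z. indicator {0<..<T} (snd z) * H (fst z)" and \<pi> = fst])
      show "(LINT x|lebesgue_on \<Omega>. (w t x - w s x) \<bullet> \<psi> x) =
          - (LINT z|lborel. (indicator {s<..<t} (snd z) *\<^sub>R B z) \<bullet> jacobian \<psi> (at (fst z)))"
        if "\<psi> \<in> test_functions \<Omega>" for \<psi>
        by (rule increment[OF that]) (use s t in auto)
      show "\<phi> j \<in> test_functions \<Omega>" for j by (rule \<phi>)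
      show "integrable (lebesgue_on \<Omega>) (\<lambda>x. w t x - w s x)"
        by (rule Lp_space_two_integrable[OF \<Omega> E])
      show "integrable (lebesgue_on \<Omega>) (\<lambda>x. norm (w t x - w s x) * norm (w t x))"
        by (rule Lp_space_two_products(1)[OF E L(1)])
      show "w t \<in> borel_measurable (lebesgue_on \<Omega>)"
        using L(1) by (simp add: Lp_space_two)
      show "AE x in lebesgue_on \<Omega>. (\<lambda>j. \<phi> j x) \<longlonglongrightarrow> w t x"
        using conv \<Omega> by (auto simp: AE_lebesgue_on_iff elim: eventually_mono)
      show "AE z in lborel. indicator {s<..<t} (snd z) *\<^sub>R B z = 0 \<or> (\<lambda>j. \<phi> j (fst z)) \<longlonglongrightarrow> W (fst z) \<and>
         (\<lambda>j. jacobian (\<phi> j) (at (fst z))) \<longlonglongrightarrow> G (fst z, t) \<and>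
         (\<forall>j. norm (jacobian (\<phi> j) (at (fst z))) \<le> indicator {0<..<T} (snd z) * H (fst z))"
        using convz
      proof eventually_elim
        case (elim z)
        then show ?case
          using B0[of z] by (cases "z \<in> cylinder \<Omega> T") (auto simp: cylinder_def)
      qed
      show "integrable lborel (\<lambda>z. norm (indicator {s<..<t} (snd z) *\<^sub>R B z) * (indicator {0<..<T} (snd z) * H (fst z)))"
      proof (rule Bochner_Integration.integrable_bound)
        show "integrable lborel (\<lambda>z. norm (B z) powr q + indicator {0<..<T} (snd z) * H (fst z) powr p)"
          using B integrable_lborel_product_indicator[OF H(1)] by simp
        show "AE z in lborel. norm (norm (indicator {s<..<t} (snd z) *\<^sub>R B z) * (indicator {0<..<T} (snd z) * H (fst z)))
           \<le> norm (norm (B z) powr q + indicator {0<..<T} (snd z) * H (fst z) powr p)"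
          using Youngs_inequality_scaled[OF pq, of "norm (B z)" "H (fst z)" 1 for z] H(2)
          by (intro AE_I2) (auto split: split_indicator simp: abs_of_nonneg)
      qed measurable
    qed measurable
  qed
qed

section \<open>Averaging the identity over time\<close>

definition G_upto :: "real \<Rightarrow> (real^'n) \<times> real \<Rightarrow> real^'n^'m"
  where "G_upto \<tau> z = indicator {0<..<\<tau>} (snd z) *\<^sub>R G z"

lemma G_upto_measurable [measurable]: "G_upto \<tau> \<in> borel_measurable borel"
  unfolding G_upto_def by measurable

lemma G_upto_integrable: "integrable lborel (\<lambda>z. norm (G_upto \<tau> z) powr p)"
proof (rule Bochner_Integration.integrable_bound[OF G])
  show "(\<lambda>z. norm (G_upto \<tau> z) powr p) \<in> borel_measurable lborel" by measurable
qed (auto simp: G_upto_def split: split_indicator)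

definition shifted_pairing :: "real \<Rightarrow> real \<Rightarrow> real"
  where "shifted_pairing \<tau> r = (LINT z|lborel. B (z - (0, r)) \<bullet> G_upto \<tau> z)"

lemma shifted_pairing_tendsto:
  "(shifted_pairing \<tau> \<longlongrightarrow> (LINT z|lborel. B z \<bullet> G_upto \<tau> z)) (at_right 0)"
  unfolding tendsto_at_iff_sequentially
proof (intro allI impI)
  fix X :: "nat \<Rightarrow> real" assume "X \<longlonglongrightarrow> 0"
  then have "(\<lambda>k. (0 :: real^'n, X k)) \<longlonglongrightarrow> (0, 0)"
    by (intro tendsto_intros)
  then have Y: "(\<lambda>k. (0 :: real^'n, X k)) \<longlonglongrightarrow> 0"
    by (simp add: zero_prod_def)
  show "(shifted_pairing \<tau> \<circ> X) \<longlonglongrightarrow> (LINT z|lborel. B z \<bullet> G_upto \<tau> z)"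
    unfolding shifted_pairing_def comp_def
    by (rule tendsto_integral_inner_translation[OF pq Bm G_upto_measurable B G_upto_integrable Y])
qed

lemma pairing_nonneg: "(LINT z|lborel. B z \<bullet> G_upto \<tau> z) \<ge> 0"
  by (rule integral_nonneg_AE) (use mono in \<open>auto simp: G_upto_def split: split_indicator elim!: eventually_mono\<close>)

text \<open>Young's inequality with weight 1 bounds the integral over z, for each shift r, by the
  two full integrals; by translation invariance this bound does not depend on r, and r ranges over a
  bounded interval. The result justifies the exchanges of integrals below.\<close>

lemma shifted_integrable:
  "integrable (lborel \<Otimes>\<^sub>M lborel) (\<lambda>y. indicator {0<..<h} (snd y) * (B (fst y - (0, snd y)) \<bullet> G_upto \<tau> (fst y)))"
  (is "integrable ?M ?f")
proof (rule integrableI_bounded)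
  have sh [measurable]: "(\<lambda>y :: ((real^'n) \<times> real) \<times> real. fst y - (0, snd y)) \<in> ?M \<rightarrow>\<^sub>M borel"
  proof -
    have "(\<lambda>y :: ((real^'n) \<times> real) \<times> real. fst y - (0, snd y)) \<in> borel_measurable borel"
      by (intro borel_measurable_continuous_onI continuous_intros)
    then show ?thesis unfolding lborel_prod by simp
  qed
  show fm: "?f \<in> borel_measurable ?M"
  proof (intro borel_measurable_times borel_measurable_inner)
    show "(\<lambda>y. indicat_real {0<..<h} (snd y)) \<in> borel_measurable ?M"
      by (rule measurable_compose[OF measurable_snd]) simp
    show "(\<lambda>y. B (fst y - (0, snd y))) \<in> borel_measurable ?M"
      by (rule measurable_compose[OF sh Bm])
    show "(\<lambda>y. G_upto \<tau> (fst y)) \<in> borel_measurable ?M"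
      by (rule measurable_compose[OF measurable_fst]) simp
  qed
  let ?K = "(LINT z|lborel. norm (B z) powr q) + (LINT z|lborel. norm (G z) powr p)"
  have "(\<integral>\<^sup>+y. ennreal (norm (?f y)) \<partial>?M) = (\<integral>\<^sup>+r. (\<integral>\<^sup>+z. ennreal (norm (?f (z, r))) \<partial>lborel) \<partial>lborel)"
    using fm by (intro lborel_pair.nn_integral_snd[symmetric]) simp
  also have "\<dots> \<le> (\<integral>\<^sup>+r. ennreal ?K * indicator {0<..<h} r \<partial>lborel)"
  proof (rule nn_integral_mono)
    fix r :: real
    have Bs: "integrable lborel (\<lambda>z. norm (B (z - (0, r))) powr q)"
      "(LINT z|lborel. norm (B (z - (0, r))) powr q) = (LINT z|lborel. norm (B z) powr q)"
      using integral_lborel_shift[OF B, of "(0, r)"] by auto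
    have "(\<integral>\<^sup>+z. ennreal (norm (?f (z, r))) \<partial>lborel) \<le>
       (\<integral>\<^sup>+z. ennreal (norm (B (z - (0, r))) powr q + norm (G z) powr p) * indicator {0<..<h} r \<partial>lborel)"
    proof (rule nn_integral_mono)
      fix z
      have "\<bar>B (z - (0, r)) \<bullet> G_upto \<tau> z\<bar> \<le> norm (B (z - (0, r))) * norm (G z)"
        by (rule order_trans[OF Cauchy_Schwarz_ineq2 mult_left_mono]) (auto simp: G_upto_def split: split_indicator)
      also have "\<dots> \<le> norm (B (z - (0, r))) powr q + norm (G z) powr p"
        using Youngs_inequality_scaled[OF pq, of "norm (B (z - (0, r)))" "norm (G z)" 1] by simp
      finally show "ennreal (norm (?f (z, r))) \<le> ennreal (norm (B (z - (0, r))) powr q + norm (G z) powr p) * indicator {0<..<h} r"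
        by (cases "r \<in> {0<..<h}") (simp_all add: ennreal_leI del: ennreal_plus)
    qed
    also have "\<dots> = (\<integral>\<^sup>+z. ennreal (norm (B (z - (0, r))) powr q + norm (G z) powr p) \<partial>lborel) * indicator {0<..<h} r"
      using Bs(1) G by (intro nn_integral_multc) (auto dest!: borel_measurable_integrable)
    also have "(\<integral>\<^sup>+z. ennreal (norm (B (z - (0, r))) powr q + norm (G z) powr p) \<partial>lborel) = ennreal ?K"
      using Bs G by (subst nn_integral_eq_integral) auto
    finally show "(\<integral>\<^sup>+z. ennreal (norm (?f (z, r))) \<partial>lborel) \<le> ennreal ?K * indicator {0<..<h} r" .
  qed
  also have "\<dots> = ennreal ?K * emeasure lborel {0<..<h}"
    by (rule nn_integral_cmult_indicator) simp
  also have "\<dots> < \<infinity>"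
    by (cases "0 \<le> h") (auto simp: ennreal_mult_less_top)
  finally show "(\<integral>\<^sup>+y. ennreal (norm (?f y)) \<partial>?M) < \<infinity>" .
qed

text \<open>For fixed t the flux is integrated over the time window (t - h, t). Writing the flux
  time as t - r turns the window into 0 < r < h, and Fubini moves the integration over r to the
  outside.\<close>

lemma averaged_pairing:
  obtains k where "integrable lborel k"
    and "AE t in lborel. k t = (LINT z|lborel. (indicator {t - h<..<t} (snd z) *\<^sub>R B z) \<bullet> G_upto \<tau> (fst z, t))"
    and "(LINT t|lborel. k t) = (LINT r|lborel. indicator {0<..<h} r * shifted_pairing \<tau> r)"
    and "integrable lborel (\<lambda>r. indicator {0<..<h} r * shifted_pairing \<tau> r)"
proof -
  let ?f = "\<lambda>y. indicator {0<..<h} (snd y) * (B (fst y - (0, snd y)) \<bullet> G_upto \<tau> (fst y))"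
  note int = shifted_integrable[of h \<tau>]
  have int': "integrable (lborel \<Otimes>\<^sub>M lborel) (case_prod (\<lambda>z r. ?f (z, r)))"
    using int by (simp add: split_beta')
  define g where "g z = (LINT r|lborel. ?f (z, r))" for z
  have g_int: "integrable lborel g"
    unfolding g_def by (rule lborel_pair.integrable_fst'[OF int])
  have "(LINT z|lborel. g z) = (LINT r|lborel. LINT z|lborel. ?f (z, r))"
    unfolding g_def using lborel_pair.integral_fst'[OF int] lborel_pair.integral_snd[OF int']
    by (simp add: split_beta')
  also have "(\<lambda>r. LINT z|lborel. ?f (z, r)) = (\<lambda>r. indicator {0<..<h} r * shifted_pairing \<tau> r)"
    by (simp add: shifted_pairing_def fun_eq_iff)
  finally have g_eq: "(LINT z|lborel. g z) = (LINT r|lborel. indicator {0<..<h} r * shifted_pairing \<tau> r)" .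
  have g_int2: "integrable (lborel \<Otimes>\<^sub>M lborel) (case_prod (\<lambda>x t. g (x, t)))"
    using g_int by (simp add: lborel_prod)
  define k where "k t = (LINT x|lborel. g (x, t))" for t
  \<comment> \<open>The reflection s = t - r, whose Jacobian factor has absolute value 1.\<close>
  have g_alt: "g (x, t) = (LINT s|lborel. (indicator {t - h<..<t} s *\<^sub>R B (x, s)) \<bullet> G_upto \<tau> (x, t))" for x t
  proof -
    have "(LINT s|lborel. (indicator {t - h<..<t} s *\<^sub>R B (x, s)) \<bullet> G_upto \<tau> (x, t)) =
      \<bar>- 1\<bar> *\<^sub>R (LINT r|lborel. (indicator {t - h<..<t} (t + - 1 * r) *\<^sub>R B (x, t + - 1 * r)) \<bullet> G_upto \<tau> (x, t))"
      by (rule lborel_integral_real_affine) simp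
    also have "\<dots> = g (x, t)"
      unfolding g_def by (auto intro!: Bochner_Integration.integral_cong split: split_indicator)
    finally show ?thesis by simp
  qed
  have Gp: "integrable (lborel \<Otimes>\<^sub>M lborel) (case_prod (\<lambda>x t. norm (G_upto \<tau> (x, t)) powr p))"
    using G_upto_integrable[of \<tau>] by (simp add: lborel_prod split_beta')
  show thesis
  proof
    show "integrable lborel k"
      unfolding k_def by (rule lborel_pair.integrable_snd[OF g_int2])
    show "(LINT t|lborel. k t) = (LINT r|lborel. indicator {0<..<h} r * shifted_pairing \<tau> r)"
      unfolding k_def using lborel_pair.integral_snd[OF g_int2] g_eq by (simp add: lborel_prod)
    show "integrable lborel (\<lambda>r. indicator {0<..<h} r * shifted_pairing \<tau> r)"
      using lborel_pair.integrable_snd[OF int'] by (simp add: shifted_pairing_def)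
    show "AE t in lborel. k t = (LINT z|lborel. (indicator {t - h<..<t} (snd z) *\<^sub>R B z) \<bullet> G_upto \<tau> (fst z, t))"
      using lborel_pair.AE_integrable_snd[OF Gp]
    proof eventually_elim
      case (elim t)
      let ?\<beta> = "\<lambda>z. (indicator {t - h<..<t} (snd z) *\<^sub>R B z) \<bullet> G_upto \<tau> (fst z, t)"
      have [measurable]: "(\<lambda>z :: (real^'n) \<times> real. G_upto \<tau> (fst z, t)) \<in> borel_measurable borel"
        by measurable
      \<comment> \<open>Here the gradient is frozen at time t while the flux time runs, so
        integrability needs the slice of \<open>G_upto \<tau>\<close> at t to be in L^p; this holds
        for a.e. t only.\<close>
      have "integrable lborel ?\<beta>"
      proof (rule Bochner_Integration.integrable_bound)
        show "integrable lborel (\<lambda>z. norm (B z) powr q + indicator {0<..<T} (snd z) * norm (G_upto \<tau> (fst z, t)) powr p)"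
          using B integrable_lborel_product_indicator[OF elim] by simp
        show "AE z in lborel. norm (?\<beta> z) \<le> norm (norm (B z) powr q + indicator {0<..<T} (snd z) * norm (G_upto \<tau> (fst z, t)) powr p)"
        proof (rule AE_I2)
          fix z
          show "norm (?\<beta> z) \<le> norm (norm (B z) powr q + indicator {0<..<T} (snd z) * norm (G_upto \<tau> (fst z, t)) powr p)"
          proof (cases "z \<in> cylinder \<Omega> T")
            case True
            have "norm (?\<beta> z) \<le> norm (B z) * norm (G_upto \<tau> (fst z, t))"
              by (rule order_trans[OF _ Cauchy_Schwarz_ineq2]) (auto split: split_indicator)
            also have "\<dots> \<le> norm (B z) powr q + norm (G_upto \<tau> (fst z, t)) powr p"
              using Youngs_inequality_scaled[OF pq, of "norm (B z)" "norm (G_upto \<tau> (fst z, t))" 1] by simp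
            finally show ?thesis using True by (auto simp: cylinder_def)
          qed (simp add: B0)
        qed
      qed measurable
      then have int\<beta>: "integrable (lborel \<Otimes>\<^sub>M lborel) ?\<beta>"
        by (simp add: lborel_prod)
      have "(LINT z|lborel. ?\<beta> z) = (LINT x|lborel. LINT s|lborel. ?\<beta> (x, s))"
        using lborel_pair.integral_fst'[OF int\<beta>] by (simp add: lborel_prod)
      then show ?case
        by (simp add: k_def g_alt)
    qed
  qed
qed

lemma energy_increment:
  assumes h: "0 < h" "h \<le> \<tau>" and \<tau>: "\<tau> \<le> T"
  shows "(LINT s|lborel. indicator {\<tau> - h..<\<tau>} s * sq_norm s) \<le>
    - 2 * (LINT r|lborel. indicator {0<..<h} r * shifted_pairing \<tau> r)"
proof -
  obtain k where k: "integrable lborel k"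
    "AE t in lborel. k t = (LINT z|lborel. (indicator {t - h<..<t} (snd z) *\<^sub>R B z) \<bullet> G_upto \<tau> (fst z, t))"
    "(LINT t|lborel. k t) = (LINT r|lborel. indicator {0<..<h} r * shifted_pairing \<tau> r)"
    by (rule averaged_pairing)
  define E where "E t = indicator {0<..<\<tau>} t * sq_norm t" for t
  have Eint: "integrable lborel (\<lambda>t. indicator S t * E t)" if "S \<in> sets borel" for S
  proof -
    have "integrable lborel (\<lambda>t. indicator {0..T} t *\<^sub>R sq_norm t)"
      by (rule borel_integrable_compact[OF compact_Icc sq_norm_continuous])
    from integrable_mult_indicator[OF _ this, of "S \<inter> {0<..<\<tau>}"]
    have "integrable lborel (\<lambda>t. indicator (S \<inter> {0<..<\<tau>}) t *\<^sub>R (indicator {0..T} t *\<^sub>R sq_norm t))"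
      using that by simp
    also have "(\<lambda>t. indicator (S \<inter> {0<..<\<tau>}) t *\<^sub>R (indicator {0..T} t *\<^sub>R sq_norm t)) = (\<lambda>t. indicator S t * E t)"
      using \<tau> by (auto simp: E_def fun_eq_iff split: split_indicator)
    finally show ?thesis .
  qed
  \<comment> \<open>Shifting by h moves the interval (- h, \<tau> - h) onto (0, \<tau>), so
    \<open>f (t - h)\<close> is the energy at the earlier time for exactly those t over which the
    average runs. Between - h and 0 it equals 0, in agreement with the initial value.\<close>
  define f where "f s = indicator {- h<..<\<tau> - h} s * E s" for s
  have fint: "integrable lborel f" unfolding f_def by (rule Eint) simp
  have Eint': "integrable lborel E" using Eint[of UNIV] by simp
  have ineq: "AE t in lborel. (1 / 2) * (E t - f (t - h)) \<le> - k t"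
    using test_with_solution k(2)
  proof eventually_elim
    case (elim t)
    show ?case
    proof (cases "t \<in> {0<..<\<tau>}")
      case False
      then have "k t = 0" "E t = 0" "f (t - h) = 0"
        using elim(2) by (auto simp: G_upto_def E_def f_def split: split_indicator)
      then show ?thesis by simp
    next
      case True
      \<comment> \<open>Negative times may be cut off because \<open>B\<close> and \<open>w 0\<close> vanish there.\<close>
      define s where "s = max 0 (t - h)"
      have s: "0 \<le> s" "s < t" using True h by (auto simp: s_def)
      have tT: "t \<in> {0<..<T}" using True \<tau> by auto
      have L: "w t \<in> Lp_space 2 \<Omega>" "w s \<in> Lp_space 2 \<Omega>" using wL s tT by auto
      have ind: "(indicator {t - h<..<t} (snd z) *\<^sub>R B z) = (indicator {s<..<t} (snd z) *\<^sub>R B z)" for z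
        using B0[of z] by (cases "z \<in> cylinder \<Omega> T") (auto simp: s_def cylinder_def split: split_indicator)
      have "G_upto \<tau> (x, t) = G (x, t)" for x
        using True by (simp add: G_upto_def)
      with ind have kt: "k t = (LINT z|lborel. (indicator {s<..<t} (snd z) *\<^sub>R B z) \<bullet> G (fst z, t))"
        using elim(2) by (simp only:)
      have "(LINT x|lebesgue_on \<Omega>. (w t x - w s x) \<bullet> w t x) = - k t"
        unfolding kt by (rule elim(1)[rule_format, OF tT conjI[OF s]])
      moreover have "(1 / 2) * (sq_norm t - sq_norm s) \<le> (LINT x|lebesgue_on \<Omega>. (w t x - w s x) \<bullet> w t x)"
      proof -
        have i: "integrable (lebesgue_on \<Omega>) (\<lambda>x. (norm (w t x))\<^sup>2)" "integrable (lebesgue_on \<Omega>) (\<lambda>x. (norm (w s x))\<^sup>2)"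
          using L by (auto simp: Lp_space_two)
        have "(1 / 2) * (sq_norm t - sq_norm s) = (LINT x|lebesgue_on \<Omega>. (1 / 2) * ((norm (w t x))\<^sup>2 - (norm (w s x))\<^sup>2))"
          using i by (simp add: sq_norm_def)
        also have "\<dots> \<le> (LINT x|lebesgue_on \<Omega>. (w t x - w s x) \<bullet> w t x)"
        proof (rule integral_mono)
          show "(1 / 2) * ((norm (w t x))\<^sup>2 - (norm (w s x))\<^sup>2) \<le> (w t x - w s x) \<bullet> w t x" for x
          proof -
            have "0 \<le> (w t x - w s x) \<bullet> (w t x - w s x)" by simp
            then show ?thesis
              by (simp add: power2_norm_eq_inner inner_diff_left inner_diff_right inner_commute)
          qed
          show "integrable (lebesgue_on \<Omega>) (\<lambda>x. (w t x - w s x) \<bullet> w t x)"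
            by (rule Lp_space_two_products(2)[OF Lp_space_two_products(3)[OF L] L(1)])
        qed (use i in simp)
        finally show ?thesis .
      qed
      moreover have "E t = sq_norm t" using True by (simp add: E_def)
      moreover have "f (t - h) = sq_norm s"
        using True sq_norm_0 h by (auto simp: f_def E_def s_def max_def split: split_indicator)
      ultimately show ?thesis by simp
    qed
  qed
  note shift = integral_lborel_shift[OF fint, of h]
  have "(1 / 2) * ((LINT t|lborel. E t) - (LINT s|lborel. f s)) = (LINT t|lborel. (1 / 2) * (E t - f (t - h)))"
    using shift Eint' by simp
  also have "\<dots> \<le> (LINT t|lborel. - k t)"
    by (rule integral_mono_AE) (use ineq Eint' shift k(1) in auto)
  finally have "(LINT t|lborel. E t) - (LINT s|lborel. f s) \<le> - 2 * (LINT t|lborel. k t)"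
    by simp
  moreover have "(LINT t|lborel. E t) - (LINT s|lborel. f s) = (LINT s|lborel. indicator {\<tau> - h..<\<tau>} s * E s)"
  proof -
    have "(LINT t|lborel. E t) - (LINT s|lborel. f s) = (LINT s|lborel. E s - f s)"
      using Eint' fint by simp
    also have "(\<lambda>s. E s - f s) = (\<lambda>s. indicator {\<tau> - h..<\<tau>} s * E s)"
      using h by (auto simp: fun_eq_iff f_def E_def split: split_indicator)
    finally show ?thesis .
  qed
  \<comment> \<open>Inside the window the two sides can differ only at s = 0, which belongs to it
    when h = \<tau>; there \<open>sq_norm\<close> vanishes.\<close>
  moreover have "(\<lambda>s. indicator {\<tau> - h..<\<tau>} s * E s) = (\<lambda>s. indicator {\<tau> - h..<\<tau>} s * sq_norm s)"
  proof
    fix s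
    show "indicator {\<tau> - h..<\<tau>} s * E s = indicator {\<tau> - h..<\<tau>} s * sq_norm s"
      using h sq_norm_0 by (cases "s = 0") (auto simp: E_def split: split_indicator)
  qed
  ultimately show ?thesis using k(3) by simp
qed

text \<open>Suppose the energy at \<tau> is S > 0. By continuity it exceeds S/2 shortly before
  \<tau>, while the shifted pairing exceeds - S/8 for small shifts. The averaged inequality then
  reads h S/2 \<le> 2 h S/8, a contradiction. Only times up to \<tau> enter, so \<tau> = T is
  covered.\<close>

lemma energy_zero:
  assumes "\<tau> \<in> {0..T}"
  shows "sq_norm \<tau> = 0"
proof (rule ccontr)
  assume ne: "sq_norm \<tau> \<noteq> 0"
  then have \<tau>: "0 < \<tau>" "\<tau> \<le> T" and pos: "sq_norm \<tau> > 0"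
    using assms sq_norm_0 sq_norm_nonneg[of \<tau>] by (auto simp: less_le)
  have "(sq_norm \<longlongrightarrow> sq_norm \<tau>) (at \<tau> within {0..T})"
    using sq_norm_continuous assms by (simp add: continuous_on_def)
  then have "\<forall>\<^sub>F s in at \<tau> within {0..T}. sq_norm s > sq_norm \<tau> / 2"
    by (rule order_tendstoD(1)) (use pos in simp)
  then obtain d where d: "d > 0" "\<And>s. s \<in> {0..T} \<Longrightarrow> s \<noteq> \<tau> \<Longrightarrow> dist s \<tau> < d \<Longrightarrow> sq_norm s > sq_norm \<tau> / 2"
    unfolding eventually_at by blast
  have "\<forall>\<^sub>F r in at_right 0. shifted_pairing \<tau> r > - (sq_norm \<tau> / 8)"
    by (rule order_tendstoD(1)[OF shifted_pairing_tendsto]) (use pairing_nonneg[of \<tau>] pos in linarith)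
  then obtain c where c: "c > 0" "\<And>r. 0 < r \<Longrightarrow> r < c \<Longrightarrow> shifted_pairing \<tau> r > - (sq_norm \<tau> / 8)"
    unfolding eventually_at_right_field by auto
  \<comment> \<open>Halving the minimum makes h strictly smaller than c and d and keeps the window
    inside [0, \<tau>).\<close>
  define h where "h = min (min c \<tau>) d / 2"
  have h: "0 < h" "h \<le> \<tau>" "h < c" "h < d" using c(1) d(1) \<tau> by (auto simp: h_def)
  have "h * (sq_norm \<tau> / 2) = (LINT s|lborel. indicator {\<tau> - h..<\<tau>} s * (sq_norm \<tau> / 2))"
    using h by simp
  also have "\<dots> \<le> (LINT s|lborel. indicator {\<tau> - h..<\<tau>} s * sq_norm s)"
  proof (rule integral_mono)
    have "integrable lborel (\<lambda>t. indicator {0..T} t *\<^sub>R sq_norm t)"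
      by (rule borel_integrable_compact[OF compact_Icc sq_norm_continuous])
    from integrable_mult_indicator[OF _ this, of "{\<tau> - h..<\<tau>}"]
    have "integrable lborel (\<lambda>t. indicator {\<tau> - h..<\<tau>} t *\<^sub>R (indicator {0..T} t *\<^sub>R sq_norm t))"
      by simp
    also have "(\<lambda>t. indicator {\<tau> - h..<\<tau>} t *\<^sub>R (indicator {0..T} t *\<^sub>R sq_norm t)) = (\<lambda>t. indicator {\<tau> - h..<\<tau>} t * sq_norm t)"
      using \<tau> h by (auto simp: fun_eq_iff split: split_indicator)
    finally show "integrable lborel (\<lambda>s. indicator {\<tau> - h..<\<tau>} s * sq_norm s)" .
    show "indicator {\<tau> - h..<\<tau>} s * (sq_norm \<tau> / 2) \<le> indicator {\<tau> - h..<\<tau>} s * sq_norm s" for s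
      using d(2)[of s] h \<tau> by (auto simp: dist_real_def split: split_indicator intro: less_imp_le)
    show "integrable lborel (\<lambda>s. indicator {\<tau> - h..<\<tau>} s * (sq_norm \<tau> / 2))"
      using h by (intro integrable_mult_left integrable_real_indicator) auto
  qed
  also have "\<dots> \<le> - 2 * (LINT r|lborel. indicator {0<..<h} r * shifted_pairing \<tau> r)"
    by (rule energy_increment) (use h \<tau> in auto)
  also have "(LINT r|lborel. indicator {0<..<h} r * shifted_pairing \<tau> r) \<ge> (LINT r|lborel. indicator {0<..<h} r * (- (sq_norm \<tau> / 8)))"
  proof (rule integral_mono)
    show "integrable lborel (\<lambda>r. indicator {0<..<h} r * shifted_pairing \<tau> r)"
      by (rule averaged_pairing)
    show "indicator {0<..<h} r * (- (sq_norm \<tau> / 8)) \<le> indicator {0<..<h} r * shifted_pairing \<tau> r" for r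
      using c(2)[of r] h by (auto split: split_indicator)
  qed (use h in simp)
  then have "- 2 * (LINT r|lborel. indicator {0<..<h} r * shifted_pairing \<tau> r) \<le> h * (sq_norm \<tau> / 4)"
    using h by simp
  finally show False
    using h pos by simp
qed

lemma vanishes:
  assumes "t \<in> {0..T}"
  shows "AE x in lebesgue_on \<Omega>. w t x = 0"
proof -
  have "AE x in lebesgue_on \<Omega>. (norm (w t x))\<^sup>2 = 0"
    using energy_zero[OF assms] wL[OF assms] unfolding sq_norm_def
    by (subst integral_nonneg_eq_0_iff_AE[symmetric]) (auto simp: Lp_space_two)
  then show ?thesis by eventually_elim simp
qed

end

subsection \<open>The vector field\<close>

text \<open>Adding the tangent inequalities at s and t gives monotonicity of the derivative. It is
  zero on (0, 1), where \<phi> is locally constant, so monotonicity makes it nonnegative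
  everywhere.\<close>

lemma convex_vanishing_derivative:
  fixes \<phi> D :: "real \<Rightarrow> real"
  assumes conv: "convex_on {0..} \<phi>" and zero: "\<And>s. s \<in> {0..1} \<Longrightarrow> \<phi> s = 0"
    and D: "\<And>s. s > 0 \<Longrightarrow> (\<phi> has_field_derivative D s) (at s)"
  shows "0 < s \<Longrightarrow> s \<le> t \<Longrightarrow> D s \<le> D t"
    and "0 < s \<Longrightarrow> s < 1 \<Longrightarrow> D s = 0"
    and "0 < s \<Longrightarrow> 0 \<le> D s"
proof -
  show mono: "D s \<le> D t" if "0 < s" "s \<le> t" for s t
  proof (cases "s = t")
    case False
    have "\<phi> y - \<phi> x \<ge> D x * (y - x)" if "x > 0" "y > 0" for x y
      using that
      by (intro convex_on_imp_above_tangent[OF conv])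
         (auto intro: has_field_derivative_at_within[OF D])
    from this[of s t] this[of t s] have "(D s - D t) * (t - s) \<le> 0"
      using that by (simp add: algebra_simps)
    then show ?thesis
      using that False by (simp add: mult_le_0_iff)
  qed simp
  show zero': "D s = 0" if "0 < s" "s < 1" for s
  proof -
    have "\<forall>\<^sub>F x in nhds s. \<phi> x = 0"
      using eventually_nhds_in_open[of "{0<..<1}" s] that by (auto elim: eventually_mono simp: zero)
    then have "(\<phi> has_field_derivative 0) (at s)"
      using DERIV_cong_ev[OF refl _ refl, of \<phi> "\<lambda>_. 0" s 0] by simp
    then show ?thesis
      using D[OF \<open>0 < s\<close>] DERIV_unique by blast
  qed
  show "0 \<le> D s" if "0 < s"
    using zero'[of "min s (1/2)"] mono[of "min s (1/2)" s] that by (auto simp: min_def split: if_splits)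
qed

text \<open>With a and b the two norms, the Cauchy-Schwarz inequality and nonnegativity of D reduce
  the claim to the scalar inequality (D a - D b) (a - b) \<ge> 0.\<close>

lemma radial_field_monotone:
  fixes \<xi> \<zeta> :: "'a::real_inner"
  assumes nonneg: "\<And>s. 0 < s \<Longrightarrow> 0 \<le> D s" and mono: "\<And>s t. 0 < s \<Longrightarrow> s \<le> t \<Longrightarrow> D s \<le> D t"
  defines "A \<equiv> (\<lambda>\<xi>::'a. if \<xi> = 0 then 0 else (D (norm \<xi>) / norm \<xi>) *\<^sub>R \<xi>)"
  shows "(A \<xi> - A \<zeta>) \<bullet> (\<xi> - \<zeta>) \<ge> 0"
proof -
  have A0: "A \<xi> \<bullet> \<xi> \<ge> 0" for \<xi>
    using nonneg[of "norm \<xi>"] by (simp add: A_def)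
  consider "\<xi> = 0" | "\<zeta> = 0" | "\<xi> \<noteq> 0" "\<zeta> \<noteq> 0" by blast
  then show ?thesis
  proof cases
    case 3
    define a b where "a = norm \<xi>" and "b = norm \<zeta>"
    have ab: "a > 0" "b > 0" using 3 by (auto simp: a_def b_def)
    have sq: "\<xi> \<bullet> \<xi> = a * a" "\<zeta> \<bullet> \<zeta> = b * b"
      by (simp_all add: a_def b_def dot_square_norm power2_eq_square)
    have cs: "\<xi> \<bullet> \<zeta> \<le> a * b"
      unfolding a_def b_def by (rule norm_cauchy_schwarz)
    define \<alpha> \<beta> where "\<alpha> = D a / a" and "\<beta> = D b / b"
    have \<alpha>\<beta>: "\<alpha> \<ge> 0" "\<beta> \<ge> 0" using nonneg ab by (auto simp: \<alpha>_def \<beta>_def)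
    have "(A \<xi> - A \<zeta>) \<bullet> (\<xi> - \<zeta>) = \<alpha> * (a * a) + \<beta> * (b * b) - (\<alpha> + \<beta>) * (\<xi> \<bullet> \<zeta>)"
      using 3 by (simp add: A_def \<alpha>_def \<beta>_def a_def[symmetric] b_def[symmetric] inner_diff_left
        inner_diff_right sq inner_commute[of \<zeta> \<xi>] algebra_simps)
    also have "\<dots> \<ge> \<alpha> * (a * a) + \<beta> * (b * b) - (\<alpha> + \<beta>) * (a * b)"
      using cs \<alpha>\<beta> by (simp add: mult_left_mono)
    moreover have "\<alpha> * (a * a) + \<beta> * (b * b) - (\<alpha> + \<beta>) * (a * b) = (D a - D b) * (a - b)"
      using ab by (simp add: \<alpha>_def \<beta>_def field_simps)
    moreover have "(D a - D b) * (a - b) \<ge> 0"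
      using mono[of a b] mono[of b a] ab by (cases a b rule: linorder_cases) (auto intro: mult_nonneg_nonneg mult_nonpos_nonpos)
    ultimately show ?thesis by linarith
  qed (use A0[of \<xi>] A0[of \<zeta>] in \<open>auto simp: A_def\<close>)
qed

text \<open>The growth bound is assumed for each s separately, with an exceptional null set
  depending on s. Restricting to rational s leaves a single null set, and monotonicity of the
  derivative recovers all real s outside it.\<close>

lemma structural_vector_field:
  fixes F :: "real^'n \<Rightarrow> real \<Rightarrow> real \<Rightarrow> real"
  assumes "structural_assumptions \<Omega> T p L C K F"
  shows "AE z in lebesgue_on (cylinder \<Omega> T). \<forall>\<xi> \<zeta> :: real^'n^'m.
     norm (vector_field F (fst z) (snd z) \<xi>) \<le> C * norm \<xi> powr (p - 1) \<and>
     (vector_field F (fst z) (snd z) \<xi> - vector_field F (fst z) (snd z) \<zeta>) \<bullet> (\<xi> - \<zeta>) \<ge> 0"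
proof -
  let ?M = "lebesgue_on (cylinder \<Omega> T)"
  have p: "p > 1" and C: "C > 1"
    and conv: "\<And>x t. (x, t) \<in> cylinder \<Omega> T \<Longrightarrow> convex_on {0..} (F x t) \<and> (\<forall>s\<in>{0..1}. F x t s = 0)"
    and C1: "AE (x, t) in ?M. F x t C1_differentiable_on {0<..} \<and> Fs F x t C1_differentiable_on ({0<..} - {1})"
    and bound: "\<And>s. s > 1 \<Longrightarrow> AE (x, t) in ?M.
          1 / C * (s - 1) powr (p - 1) \<le> Fs F x t s \<and> Fs F x t s \<le> C * (s - 1) powr (p - 1)"
    using assms by (auto simp: structural_assumptions_def)
  have "AE z in ?M. \<forall>q::rat. of_rat q > (1::real) \<longrightarrow>
      Fs F (fst z) (snd z) (of_rat q) \<le> C * (of_rat q - 1) powr (p - 1)"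
    unfolding AE_all_countable
  proof
    fix q :: rat
    show "AE z in ?M. of_rat q > (1::real) \<longrightarrow> Fs F (fst z) (snd z) (of_rat q) \<le> C * (of_rat q - 1) powr (p - 1)"
      using bound[of "of_rat q"] by (cases "of_rat q > (1::real)") (auto simp: case_prod_beta elim: eventually_mono)
  qed
  moreover have "AE z in ?M. z \<in> cylinder \<Omega> T"
    using AE_space[of ?M] by simp
  ultimately show ?thesis
    using C1
  proof eventually_elim
    case (elim z)
    obtain x t where z: "z = (x, t)" by (cases z)
    obtain D where D: "\<And>s. s > 0 \<Longrightarrow> (F x t has_field_derivative D s) (at s)"
      using elim(3) unfolding z C1_differentiable_on_def
      by (auto simp: has_real_derivative_iff_has_vector_derivative)
    have FsD: "Fs F x t s = D s" if "s > 0" for s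
      unfolding Fs_def by (rule DERIV_imp_deriv[OF D[OF that]])
    have "convex_on {0..} (F x t)" and F0: "\<And>s. s \<in> {0..1} \<Longrightarrow> F x t s = 0"
      using conv elim(2) z by auto
    note props = convex_vanishing_derivative[OF this D]
    have growth: "D s \<le> C * s powr (p - 1)" if "s > 0" for s
    proof (cases "s < 1")
      case True
      then show ?thesis using props(2)[of s] that C by simp
    next
      case False
      \<comment> \<open>As q > s \<ge> 1 the assumed bound applies at q, and q - 1 < s keeps the
        final bound in terms of s with the same constant.\<close>
      obtain q where q: "s < of_rat q" "of_rat q < s + 1"
        using of_rat_dense[of s "s + 1"] by auto
      have "D s \<le> D (of_rat q)"
        using props(1) that q by simp
      also have "\<dots> \<le> C * (of_rat q - 1) powr (p - 1)"
      proof -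
        have "(1::real) < of_rat q" using q False by linarith
        then show ?thesis
          using elim(1)[rule_format, of q] FsD[of "of_rat q"] z by simp
      qed
      also have "\<dots> \<le> C * s powr (p - 1)"
        using q False C p by (intro mult_left_mono powr_mono2) linarith+
      finally show ?thesis .
    qed
    have A: "vector_field F x t = (\<lambda>\<xi>::real^'n^'m. if \<xi> = 0 then 0 else (D (norm \<xi>) / norm \<xi>) *\<^sub>R \<xi>)"
      by (auto simp: fun_eq_iff vector_field_def FsD)
    have "norm (vector_field F x t \<xi>) \<le> C * norm \<xi> powr (p - 1)" for \<xi> :: "real^'n^'m"
      using growth[of "norm \<xi>"] props(3)[of "norm \<xi>"] by (auto simp: A)
    moreover have "(vector_field F x t \<xi> - vector_field F x t \<zeta>) \<bullet> (\<xi> - \<zeta>) \<ge> 0" for \<xi> \<zeta> :: "real^'n^'m"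
      unfolding A by (rule radial_field_monotone) (use props in auto)
    ultimately show ?case by (simp add: z)
  qed
qed

subsection \<open>Sobolev functions of zero trace\<close>

lemma powr_add_le:
  fixes x y p :: real
  assumes "x \<ge> 0" "y \<ge> 0" "p > 0"
  shows "(x + y) powr p \<le> 2 powr p * (x powr p + y powr p)"
proof -
  have "(x + y) powr p \<le> (2 * max x y) powr p"
    using assms by (intro powr_mono2) auto
  also have "\<dots> = 2 powr p * max x y powr p"
    using assms by (simp add: powr_mult)
  also have "\<dots> \<le> 2 powr p * (x powr p + y powr p)"
    by (intro mult_left_mono) (auto simp: max_def)
  finally show ?thesis .
qed

lemma norm_diff_powr_le:
  assumes "p > 0"
  shows "norm (a - b) powr p \<le> 2 powr p * (norm a powr p + norm b powr p)"
  by (rule order_trans[OF powr_mono2 powr_add_le]) (use assms norm_triangle_ineq4 in auto)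

lemma W1p_norm_powr:
  assumes "p > 0"
  shows "W1p_norm p \<Omega> v powr p =
    (LINT x|lebesgue_on \<Omega>. norm (v x) powr p) + (LINT x|lebesgue_on \<Omega>. norm (weak_gradient \<Omega> v x) powr p)"
  using assms by (simp add: W1p_norm_def Lp_norm_def powr_powr)

lemma has_weak_gradient_weak_gradient:
  "has_weak_gradient \<Omega> v G \<Longrightarrow> has_weak_gradient \<Omega> v (weak_gradient \<Omega> v)"
  unfolding weak_gradient_def by (rule someI[of "has_weak_gradient \<Omega> v" G])

text \<open>Local integrability gives measurability on each compact subset; countably many closed
  boxes that exhaust U glue these together.\<close>

lemma has_weak_gradient_measurable:
  assumes U: "open U" and G: "has_weak_gradient U v G"
  shows "G \<in> borel_measurable (lebesgue_on U)"
proof -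
  obtain D where D: "countable D" "D \<subseteq> Pow U" "\<And>X. X \<in> D \<Longrightarrow> \<exists>a b. X = cbox a b" "\<Union>D = U"
    using open_countable_Union_open_cbox[OF U] by metis
  have "G \<in> borel_measurable (lebesgue_on X)" if "X \<in> D" for X
  proof -
    have "compact X" "X \<subseteq> U" using D(2) D(3)[OF that] that by auto
    then have "integrable (lebesgue_on X) G"
      using G by (simp add: has_weak_gradient_def L1_loc_def)
    then show ?thesis by simp
  qed
  then show ?thesis
  proof (intro measurable_piecewise_restrict[OF D(1), where M = "lebesgue_on U"])
    fix X assume X: "X \<in> D"
    show "X \<inter> space (lebesgue_on U) \<in> sets (lebesgue_on U)"
    proof -
      have "X \<in> sets lebesgue" "X \<subseteq> U" using D(2) D(3)[OF X] X by auto
      then show ?thesis using U by (simp add: sets_restrict_space_iff Int_absorb2)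
    qed
    have "restrict_space (lebesgue_on U) X = lebesgue_on X"
      using D(2) X D(3)[OF X] U by (subst restrict_restrict_space) (auto simp: Int_absorb1)
    then show "G \<in> borel_measurable (restrict_space (lebesgue_on U) X)"
      using \<open>\<And>X. X \<in> D \<Longrightarrow> G \<in> borel_measurable (lebesgue_on X)\<close> X by simp
  qed (use D in auto)
qed

lemma Lp_space_diff:
  fixes v w :: "'a::euclidean_space \<Rightarrow> 'b::euclidean_space"
  assumes "p > 0" "v \<in> Lp_space p U" "w \<in> Lp_space p U"
  shows "(\<lambda>x. v x - w x) \<in> Lp_space p U"
proof -
  have [measurable]: "v \<in> borel_measurable (lebesgue_on U)" "w \<in> borel_measurable (lebesgue_on U)"
    using assms by (auto simp: Lp_space_def)
  have "integrable (lebesgue_on U) (\<lambda>x. norm (v x - w x) powr p)"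
  proof (rule Bochner_Integration.integrable_bound)
    show "integrable (lebesgue_on U) (\<lambda>x. 2 powr p * (norm (v x) powr p + norm (w x) powr p))"
      using assms by (auto simp: Lp_space_def)
  qed (use norm_diff_powr_le[OF assms(1)] in auto)
  then show ?thesis by (simp add: Lp_space_def)
qed

text \<open>Interpolation between L^1 and the supremum bound: |f|^p \<le> C^(p - 1) |f|.\<close>

lemma bounded_compact_support_Lp:
  fixes f :: "'a::euclidean_space \<Rightarrow> 'b::euclidean_space"
  assumes "f \<in> borel_measurable borel" "integrable lborel f" "\<And>x. norm (f x) \<le> C" "p > 1" "U \<in> sets lebesgue"
    "\<And>x. x \<notin> U \<Longrightarrow> f x = 0"
  shows "f \<in> Lp_space p U"
proof -
  have [measurable]: "f \<in> borel_measurable borel" by fact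
  have int: "integrable lborel (\<lambda>x. norm (f x) powr p)"
  proof (rule Bochner_Integration.integrable_bound)
    show "integrable lborel (\<lambda>x. C powr (p - 1) * norm (f x))" using assms by simp
    have "norm (f x) powr p \<le> C powr (p - 1) * norm (f x)" for x
    proof -
      have "norm (f x) powr p = norm (f x) powr (p - 1) * norm (f x)"
        using powr_add[of "norm (f x)" "p - 1" 1] by simp
      also have "\<dots> \<le> C powr (p - 1) * norm (f x)"
        using assms by (intro mult_right_mono powr_mono2) auto
      finally show ?thesis .
    qed
    then show "AE x in lborel. norm (norm (f x) powr p) \<le> norm (C powr (p - 1) * norm (f x))"
      by (intro AE_I2) (simp add: abs_mult)
  qed measurable
  have "integrable (lebesgue_on U) (\<lambda>x. norm (f x) powr p)"
    using int assms(4-6) by (subst integral_lebesgue_on_eq_lborel(2)) auto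
  moreover have "f \<in> borel_measurable (lebesgue_on U)"
    by (rule measurable_restrict_space1[OF borel_measurable_lebesgueI[OF assms(1)]])
  ultimately show ?thesis by (simp add: Lp_space_def)
qed

lemma test_function_Lp:
  fixes \<phi> :: "real^'n \<Rightarrow> real^'m"
  assumes "open U" "\<phi> \<in> test_functions U" "p > 1"
  shows "\<phi> \<in> Lp_space p U" and "(\<lambda>x. jacobian \<phi> (at x)) \<in> Lp_space p U"
proof -
  obtain C where "\<And>x. norm (\<phi> x) \<le> C"
    using test_functions_bounded[OF assms(2)] by auto
  then show "\<phi> \<in> Lp_space p U"
    using assms test_functions_borel_measurable[OF assms(2)] test_functions_integrable[OF assms(2)]
      test_functions_zero_outside[OF assms(2)]
    by (intro bounded_compact_support_Lp[where C = C]) auto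
  obtain C where "\<And>x. norm (jacobian \<phi> (at x)) \<le> C"
    using jacobian_test_function(4)[OF assms(2)] by auto
  then show "(\<lambda>x. jacobian \<phi> (at x)) \<in> Lp_space p U"
    using assms jacobian_test_function[OF assms(2)]
    by (intro bounded_compact_support_Lp[where C = C]) auto
qed

lemma jacobian_diff_test:
  fixes \<phi> \<psi> :: "real^'n \<Rightarrow> real^'m"
  assumes "\<phi> \<in> test_functions U" "\<psi> \<in> test_functions U"
  shows "jacobian (\<lambda>x. \<phi> x - \<psi> x) (at x) = jacobian \<phi> (at x) - jacobian \<psi> (at x)"
proof -
  have "((\<lambda>x. \<phi> x - \<psi> x) has_derivative (\<lambda>h. frechet_derivative \<phi> (at x) h - frechet_derivative \<psi> (at x) h)) (at x)"
    by (intro derivative_intros test_functions_has_derivative[OF assms(1)] test_functions_has_derivative[OF assms(2)])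
  from fun_cong[OF frechet_derivative_at[OF this], symmetric]
  show ?thesis
    by (simp add: vec_eq_iff jacobian_test_function(3)[OF test_functions_diff[OF assms]]
      jacobian_test_function(3)[OF assms(1)] jacobian_test_function(3)[OF assms(2)])
qed

text \<open>The Sobolev norm of the difference is written with the chosen
  \<open>weak_gradient\<close>, which by uniqueness may be replaced by \<Gamma> minus the Jacobian.
  Demanding a norm below the p-th root of \<epsilon> bounds both p-th power integrals by
  \<epsilon>.\<close>

lemma W1p0_approximation:
  fixes a :: "real^'n \<Rightarrow> real^'m"
  assumes \<Omega>: "open \<Omega>" and p: "p > 1" and a: "a \<in> W1p0 p \<Omega>"
  obtains \<Gamma> where "has_weak_gradient \<Omega> a \<Gamma>" "a \<in> Lp_space p \<Omega>" "\<Gamma> \<in> Lp_space p \<Omega>"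
    "\<forall>\<epsilon>>0. \<exists>\<phi>\<in>test_functions \<Omega>. (LINT x|lebesgue_on \<Omega>. norm (a x - \<phi> x) powr p) < \<epsilon> \<and>
       (LINT x|lebesgue_on \<Omega>. norm (\<Gamma> x - jacobian \<phi> (at x)) powr p) < \<epsilon>"
proof -
  obtain \<Gamma> where \<Gamma>: "has_weak_gradient \<Omega> a \<Gamma>" "\<Gamma> \<in> Lp_space p \<Omega>" and aL: "a \<in> Lp_space p \<Omega>"
    using a by (auto simp: W1p0_def W1p_def)
  have "\<exists>\<phi>\<in>test_functions \<Omega>. (LINT x|lebesgue_on \<Omega>. norm (a x - \<phi> x) powr p) < \<epsilon> \<and>
       (LINT x|lebesgue_on \<Omega>. norm (\<Gamma> x - jacobian \<phi> (at x)) powr p) < \<epsilon>" if \<epsilon>: "\<epsilon> > 0" for \<epsilon>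
  proof -
    obtain \<phi> where \<phi>: "\<phi> \<in> test_functions \<Omega>" and less: "W1p_norm p \<Omega> (\<lambda>x. a x - \<phi> x) < \<epsilon> powr (1 / p)"
    proof -
      have "\<forall>\<epsilon>>0. \<exists>\<phi>\<in>test_functions \<Omega>. W1p_norm p \<Omega> (\<lambda>x. a x - \<phi> x) < \<epsilon>"
        using a by (simp add: W1p0_def)
      from this[rule_format, of "\<epsilon> powr (1 / p)"] show ?thesis
        using \<epsilon> that by auto
    qed
    note D = has_weak_gradient_diff[OF \<Omega> \<Gamma>(1) has_weak_gradient_test_function[OF \<Omega> \<phi>]]
    let ?W = "weak_gradient \<Omega> (\<lambda>x. a x - \<phi> x)"
    note W = has_weak_gradient_weak_gradient[OF D]
    have [measurable]: "?W \<in> borel_measurable (lebesgue_on \<Omega>)"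
      by (rule has_weak_gradient_measurable[OF \<Omega> W])
    have [measurable]: "(\<lambda>x. \<Gamma> x - jacobian \<phi> (at x)) \<in> borel_measurable (lebesgue_on \<Omega>)"
      by (rule has_weak_gradient_measurable[OF \<Omega> D])
    have eq: "(LINT x|lebesgue_on \<Omega>. norm (?W x) powr p) = (LINT x|lebesgue_on \<Omega>. norm (\<Gamma> x - jacobian \<phi> (at x)) powr p)"
    proof (rule integral_cong_AE)
      show "AE x in lebesgue_on \<Omega>. norm (?W x) powr p = norm (\<Gamma> x - jacobian \<phi> (at x)) powr p"
        using has_weak_gradient_unique[OF \<Omega> W D] by eventually_elim simp
    qed measurable
    have "W1p_norm p \<Omega> (\<lambda>x. a x - \<phi> x) powr p < (\<epsilon> powr (1 / p)) powr p"
      using less p by (intro powr_less_mono2) (auto simp: W1p_norm_def)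
    then have "(LINT x|lebesgue_on \<Omega>. norm (a x - \<phi> x) powr p) + (LINT x|lebesgue_on \<Omega>. norm (\<Gamma> x - jacobian \<phi> (at x)) powr p) < \<epsilon>"
      using p \<epsilon> by (simp add: W1p_norm_powr eq powr_powr)
    moreover have "(LINT x|lebesgue_on \<Omega>. norm (a x - \<phi> x) powr p) \<ge> 0"
       "(LINT x|lebesgue_on \<Omega>. norm (\<Gamma> x - jacobian \<phi> (at x)) powr p) \<ge> 0"
      by simp_all
    ultimately show ?thesis using \<phi> by (intro bexI[of _ \<phi>]) linarith+
  qed
  then show thesis using that \<Gamma> aL by blast
qed

text \<open>The two functions are approximated separately at a geometric rate and the approximations
  subtracted. Summability of the errors upgrades norm convergence to convergence almost everywhere
  with an integrable majorant S.\<close>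

lemma W1p0_diff_approximation:
  fixes a b :: "real^'n \<Rightarrow> real^'m"
  assumes \<Omega>: "open \<Omega>" and p: "p > 1" and a: "a \<in> W1p0 p \<Omega>" and b: "b \<in> W1p0 p \<Omega>"
    and G: "has_weak_gradient \<Omega> (\<lambda>x. a x - b x) G"
  shows "test_approximable \<Omega> p (\<lambda>x. a x - b x) G"
proof -
  let ?M = "lebesgue_on \<Omega>"
  obtain \<Gamma>a where \<Gamma>a: "has_weak_gradient \<Omega> a \<Gamma>a" "a \<in> Lp_space p \<Omega>" "\<Gamma>a \<in> Lp_space p \<Omega>"
    "\<forall>\<epsilon>>0. \<exists>\<phi>\<in>test_functions \<Omega>. (LINT x|?M. norm (a x - \<phi> x) powr p) < \<epsilon> \<and>
       (LINT x|?M. norm (\<Gamma>a x - jacobian \<phi> (at x)) powr p) < \<epsilon>"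
    by (rule W1p0_approximation[OF \<Omega> p a])
  obtain \<Gamma>b where \<Gamma>b: "has_weak_gradient \<Omega> b \<Gamma>b" "b \<in> Lp_space p \<Omega>" "\<Gamma>b \<in> Lp_space p \<Omega>"
    "\<forall>\<epsilon>>0. \<exists>\<phi>\<in>test_functions \<Omega>. (LINT x|?M. norm (b x - \<phi> x) powr p) < \<epsilon> \<and>
       (LINT x|?M. norm (\<Gamma>b x - jacobian \<phi> (at x)) powr p) < \<epsilon>"
    by (rule W1p0_approximation[OF \<Omega> p b])
  \<comment> \<open>The denominator compensates for the four error integrals and for the factor 2^p
    in the p-th power of a difference.\<close>
  define \<epsilon> where "\<epsilon> j = (1 / 2) ^ j / (4 * 2 powr p)" for j :: nat
  have \<epsilon>: "\<epsilon> j > 0" for j by (simp add: \<epsilon>_def)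
  obtain \<phi>a where \<phi>a: "\<And>j. \<phi>a j \<in> test_functions \<Omega>" "\<And>j. (LINT x|?M. norm (a x - \<phi>a j x) powr p) < \<epsilon> j"
      "\<And>j. (LINT x|?M. norm (\<Gamma>a x - jacobian (\<phi>a j) (at x)) powr p) < \<epsilon> j"
  proof -
    have "\<forall>j. \<exists>\<phi>. \<phi> \<in> test_functions \<Omega> \<and> (LINT x|?M. norm (a x - \<phi> x) powr p) < \<epsilon> j \<and>
       (LINT x|?M. norm (\<Gamma>a x - jacobian \<phi> (at x)) powr p) < \<epsilon> j"
      using \<Gamma>a(4) \<epsilon> by blast
    from choice[OF this] show ?thesis using that by blast
  qed
  obtain \<phi>b where \<phi>b: "\<And>j. \<phi>b j \<in> test_functions \<Omega>" "\<And>j. (LINT x|?M. norm (b x - \<phi>b j x) powr p) < \<epsilon> j"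
      "\<And>j. (LINT x|?M. norm (\<Gamma>b x - jacobian (\<phi>b j) (at x)) powr p) < \<epsilon> j"
  proof -
    have "\<forall>j. \<exists>\<phi>. \<phi> \<in> test_functions \<Omega> \<and> (LINT x|?M. norm (b x - \<phi> x) powr p) < \<epsilon> j \<and>
       (LINT x|?M. norm (\<Gamma>b x - jacobian \<phi> (at x)) powr p) < \<epsilon> j"
      using \<Gamma>b(4) \<epsilon> by blast
    from choice[OF this] show ?thesis using that by blast
  qed
  define \<phi> where "\<phi> j x = \<phi>a j x - \<phi>b j x" for j x
  have \<phi>: "\<phi> j \<in> test_functions \<Omega>" for j
    unfolding \<phi>_def by (rule test_functions_diff[OF \<phi>a(1) \<phi>b(1)])
  have j\<phi>: "jacobian (\<phi> j) (at x) = jacobian (\<phi>a j) (at x) - jacobian (\<phi>b j) (at x)" for j x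
    unfolding \<phi>_def by (rule jacobian_diff_test[OF \<phi>a(1) \<phi>b(1)])
  have p0: "p > 0" using p by simp
  note L = Lp_space_diff[OF p0]
  have L1: "(\<lambda>x. a x - \<phi>a j x) \<in> Lp_space p \<Omega>" "(\<lambda>x. b x - \<phi>b j x) \<in> Lp_space p \<Omega>"
     "(\<lambda>x. \<Gamma>a x - jacobian (\<phi>a j) (at x)) \<in> Lp_space p \<Omega>" "(\<lambda>x. \<Gamma>b x - jacobian (\<phi>b j) (at x)) \<in> Lp_space p \<Omega>" for j
    using \<Gamma>a \<Gamma>b test_function_Lp[OF \<Omega> \<phi>a(1) p] test_function_Lp[OF \<Omega> \<phi>b(1) p] by (auto intro: L)
  define D where "D j x = norm ((a x - \<phi>a j x) - (b x - \<phi>b j x)) powr p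
     + norm ((\<Gamma>a x - jacobian (\<phi>a j) (at x)) - (\<Gamma>b x - jacobian (\<phi>b j) (at x))) powr p" for j x
  have Dint: "integrable ?M (D j)" for j
    unfolding D_def using L[OF L1(1,2)] L[OF L1(3,4)] by (auto simp: Lp_space_def)
  have Dle: "(LINT x|?M. D j x) \<le> (1 / 2) ^ j" for j
  proof -
    have i: "integrable ?M (\<lambda>x. norm (a x - \<phi>a j x) powr p)" "integrable ?M (\<lambda>x. norm (b x - \<phi>b j x) powr p)"
      "integrable ?M (\<lambda>x. norm (\<Gamma>a x - jacobian (\<phi>a j) (at x)) powr p)"
      "integrable ?M (\<lambda>x. norm (\<Gamma>b x - jacobian (\<phi>b j) (at x)) powr p)"
      using L1[of j] by (auto simp: Lp_space_def)
    have "(LINT x|?M. D j x) \<le> (LINT x|?M. 2 powr p * ((norm (a x - \<phi>a j x) powr p + norm (b x - \<phi>b j x) powr p)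
       + (norm (\<Gamma>a x - jacobian (\<phi>a j) (at x)) powr p + norm (\<Gamma>b x - jacobian (\<phi>b j) (at x)) powr p)))"
    proof (rule integral_mono[OF Dint])
      show "D j x \<le> 2 powr p * ((norm (a x - \<phi>a j x) powr p + norm (b x - \<phi>b j x) powr p)
       + (norm (\<Gamma>a x - jacobian (\<phi>a j) (at x)) powr p + norm (\<Gamma>b x - jacobian (\<phi>b j) (at x)) powr p))" for x
        unfolding D_def distrib_left[of "2 powr p" "_ + _" "_ + _"] by (intro add_mono norm_diff_powr_le p0)
    qed (use i in simp)
    also have "\<dots> = 2 powr p * (((LINT x|?M. norm (a x - \<phi>a j x) powr p) + (LINT x|?M. norm (b x - \<phi>b j x) powr p))
       + ((LINT x|?M. norm (\<Gamma>a x - jacobian (\<phi>a j) (at x)) powr p) + (LINT x|?M. norm (\<Gamma>b x - jacobian (\<phi>b j) (at x)) powr p)))"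
      using i by simp
    also have "\<dots> \<le> 2 powr p * (4 * \<epsilon> j)"
      using \<phi>a(2,3)[of j] \<phi>b(2,3)[of j] by (intro mult_left_mono) auto
    also have "\<dots> = (1 / 2) ^ j" by (simp add: \<epsilon>_def)
    finally show ?thesis .
  qed
  obtain S where S: "integrable ?M S" "\<And>x. S x \<ge> 0" "AE x in ?M. (\<lambda>j. D j x) \<longlonglongrightarrow> 0 \<and> (\<forall>j. D j x \<le> S x)"
    by (rule integrals_summable_imp_dominated[OF Dint _ Dle]) (auto simp: D_def)
  define \<Gamma> where "\<Gamma> x = \<Gamma>a x - \<Gamma>b x" for x
  have \<Gamma>L: "\<Gamma> \<in> Lp_space p \<Omega>" unfolding \<Gamma>_def by (rule L[OF \<Gamma>a(3) \<Gamma>b(3)])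
  have \<Gamma>G: "AE x in ?M. \<Gamma> x = G x"
    unfolding \<Gamma>_def by (rule has_weak_gradient_unique[OF \<Omega> has_weak_gradient_diff[OF \<Omega> \<Gamma>a(1) \<Gamma>b(1)] G])
  \<comment> \<open>The Jacobian of the approximation differs from \<Gamma> by a matrix whose norm
    to the power p is at most S.\<close>
  define H where "H x = norm (\<Gamma> x) + S x powr (1 / p)" for x
  have H0: "H x \<ge> 0" for x by (simp add: H_def)
  have [measurable]: "\<Gamma> \<in> borel_measurable ?M" "S \<in> borel_measurable ?M"
    using \<Gamma>L S(1) by (auto simp: Lp_space_def)
  have Hm [measurable]: "H \<in> borel_measurable ?M" unfolding H_def by measurable
  have Hint: "integrable ?M (\<lambda>x. H x powr p)"
  proof (rule Bochner_Integration.integrable_bound)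
    show "integrable ?M (\<lambda>x. 2 powr p * (norm (\<Gamma> x) powr p + S x))"
      using \<Gamma>L S(1) by (auto simp: Lp_space_def)
    have "H x powr p \<le> 2 powr p * (norm (\<Gamma> x) powr p + S x)" for x
      using powr_add_le[of "norm (\<Gamma> x)" "S x powr (1 / p)" p] p S(2)[of x] by (simp add: H_def powr_powr)
    then show "AE x in ?M. norm (H x powr p) \<le> norm (2 powr p * (norm (\<Gamma> x) powr p + S x))"
      using S(2) by (intro AE_I2) (simp add: abs_of_nonneg)
  qed measurable
  have conv: "AE x in ?M. (\<lambda>j. \<phi> j x) \<longlonglongrightarrow> a x - b x \<and> (\<lambda>j. jacobian (\<phi> j) (at x)) \<longlonglongrightarrow> G x \<and>
        (\<forall>j. norm (jacobian (\<phi> j) (at x)) \<le> H x)"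
    using S(3) \<Gamma>G
  proof eventually_elim
    case (elim x)
    have root: "(\<lambda>j. f j) \<longlonglongrightarrow> 0" if "\<And>j. norm (f j) powr p \<le> D j x" for f :: "nat \<Rightarrow> 'z::real_normed_vector"
    proof -
      have "(\<lambda>j. norm (f j) powr p) \<longlonglongrightarrow> 0"
        by (rule tendsto_sandwich[OF _ _ tendsto_const]) (use that elim in auto)
      then have "(\<lambda>j. (norm (f j) powr p) powr (1 / p)) \<longlonglongrightarrow> 0 powr (1 / p)"
        using p by (intro tendsto_powr') auto
      then show ?thesis using p by (simp add: powr_powr tendsto_norm_zero_iff)
    qed
    have "(\<lambda>j. (a x - \<phi>a j x) - (b x - \<phi>b j x)) \<longlonglongrightarrow> 0"
      by (rule root) (simp add: D_def)
    then have "(\<lambda>j. (a x - b x) - ((a x - \<phi>a j x) - (b x - \<phi>b j x))) \<longlonglongrightarrow> (a x - b x) - 0"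
      by (intro tendsto_intros)
    then have c1: "(\<lambda>j. \<phi> j x) \<longlonglongrightarrow> a x - b x"
      by (simp add: \<phi>_def algebra_simps)
    have "(\<lambda>j. (\<Gamma>a x - jacobian (\<phi>a j) (at x)) - (\<Gamma>b x - jacobian (\<phi>b j) (at x))) \<longlonglongrightarrow> 0"
      by (rule root) (simp add: D_def)
    then have "(\<lambda>j. \<Gamma> x - ((\<Gamma>a x - jacobian (\<phi>a j) (at x)) - (\<Gamma>b x - jacobian (\<phi>b j) (at x)))) \<longlonglongrightarrow> \<Gamma> x - 0"
      by (intro tendsto_intros)
    then have c2: "(\<lambda>j. jacobian (\<phi> j) (at x)) \<longlonglongrightarrow> G x"
      using elim by (simp add: j\<phi> \<Gamma>_def algebra_simps)
    have "norm (jacobian (\<phi> j) (at x)) \<le> H x" for j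
    proof -
      let ?d = "(\<Gamma>a x - jacobian (\<phi>a j) (at x)) - (\<Gamma>b x - jacobian (\<phi>b j) (at x))"
      have "norm ?d powr p \<le> D j x" by (simp add: D_def)
      also have "\<dots> \<le> S x" using elim by blast
      finally have "(norm ?d powr p) powr (1 / p) \<le> S x powr (1 / p)"
        using p by (intro powr_mono2) auto
      then have "norm ?d \<le> S x powr (1 / p)" using p by (simp add: powr_powr)
      moreover have "jacobian (\<phi> j) (at x) = \<Gamma> x - ?d"
        by (simp add: j\<phi> \<Gamma>_def)
      ultimately show ?thesis
        using norm_triangle_ineq4[of "\<Gamma> x" ?d] by (simp add: H_def)
    qed
    with c1 c2 show ?case by blast
  qed
  have S\<Omega>: "\<Omega> \<in> sets lebesgue" using \<Omega> by simp
  have "(\<lambda>x. indicator \<Omega> x *\<^sub>R H x) \<in> borel_measurable lebesgue"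
    using Hm S\<Omega> by (subst borel_measurable_restrict_space_iff[symmetric]) auto
  \<comment> \<open>H' agrees with H only almost everywhere, while nonnegativity is demanded at
    every point; therefore its absolute value becomes the bound.\<close>
  then obtain H' where H' [measurable]: "H' \<in> borel_measurable lborel" and HH': "AE x in lborel. indicator \<Omega> x *\<^sub>R H x = H' x"
    by (rule completion_ex_borel_measurable_euclidean)
  show ?thesis
    unfolding test_approximable_def
  proof (intro exI conjI allI)
    show "\<phi> j \<in> test_functions \<Omega>" for j by (rule \<phi>)
    show "(\<lambda>x. \<bar>H' x\<bar>) \<in> borel_measurable borel" using H' by simp
    show "\<bar>H' x\<bar> \<ge> 0" for x by simp
    have "integrable lebesgue (\<lambda>x. indicator \<Omega> x *\<^sub>R (H x powr p))"
      using Hint S\<Omega> by (subst (asm) integrable_restrict_space) auto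
    moreover have "AE x in lebesgue. indicator \<Omega> x *\<^sub>R (H x powr p) = \<bar>H' x\<bar> powr p"
      using AE_completion[OF HH']
    proof eventually_elim
      case (elim x)
      then show ?case using H0[of x] by (cases "x \<in> \<Omega>") (metis abs_of_nonneg indicator_simps scaleR_one scaleR_zero_left powr_0 abs_zero)+
    qed
    moreover have "(\<lambda>x. \<bar>H' x\<bar> powr p) \<in> borel_measurable lebesgue"
      by (rule borel_measurable_lebesgueI) (use H' in measurable)
    ultimately have "integrable lebesgue (\<lambda>x. \<bar>H' x\<bar> powr p)"
      using integrable_cong_AE_imp by blast
    then show "integrable lborel (\<lambda>x. \<bar>H' x\<bar> powr p)"
      by (subst (asm) integrable_completion) auto
    show "AE x in lborel. x \<in> \<Omega> \<longrightarrow> (\<lambda>j. \<phi> j x) \<longlonglongrightarrow> a x - b x \<and> (\<lambda>j. jacobian (\<phi> j) (at x)) \<longlonglongrightarrow> G x \<and>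
        (\<forall>j. norm (jacobian (\<phi> j) (at x)) \<le> \<bar>H' x\<bar>)"
      using conv[unfolded AE_lebesgue_on_iff[OF S\<Omega>]] HH'
    proof eventually_elim
      case (elim x)
      show ?case
      proof
        assume "x \<in> \<Omega>"
        then have "H x = \<bar>H' x\<bar>" using elim(2) H0[of x] by simp
        then show "(\<lambda>j. \<phi> j x) \<longlonglongrightarrow> a x - b x \<and> (\<lambda>j. jacobian (\<phi> j) (at x)) \<longlonglongrightarrow> G x \<and>
          (\<forall>j. norm (jacobian (\<phi> j) (at x)) \<le> \<bar>H' x\<bar>)" using elim(1) \<open>x \<in> \<Omega>\<close> by simp
      qed
    qed
  qed
qed

subsection \<open>Weak solutions\<close>

lemma borel_representative:
  fixes f :: "'a::euclidean_space \<Rightarrow> 'b::euclidean_space"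
  assumes "f \<in> borel_measurable (lebesgue_on S)" "S \<in> sets lebesgue"
  obtains g where "g \<in> borel_measurable borel" "AE x in lborel. indicator S x *\<^sub>R f x = g x"
proof -
  have "(\<lambda>x. indicator S x *\<^sub>R f x) \<in> borel_measurable lebesgue"
    using assms by (subst borel_measurable_restrict_space_iff[symmetric]) auto
  then obtain g where "g \<in> borel_measurable lborel" "AE x in lborel. indicator S x *\<^sub>R f x = g x"
    by (rule completion_ex_borel_measurable_euclidean)
  then show thesis using that by simp
qed

lemma open_cylinder: "open \<Omega> \<Longrightarrow> open (cylinder \<Omega> T)"
  by (simp add: cylinder_def open_Times)

lemma emeasure_cylinder_finite:
  assumes "bounded \<Omega>"
  shows "emeasure lborel (cylinder \<Omega> T) < \<infinity>"
  using assms by (intro emeasure_bounded_finite) (simp add: cylinder_def bounded_Times)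

text \<open>Tonelli for the Borel representative: the integral over space-time is at most the time
  integral of the slice bounds. It serves the gradient, with the Bochner norm as N, and the function
  itself, with a constant N.\<close>

lemma slices_integrable_imp_integrable:
  fixes u :: "(real^'n) \<times> real \<Rightarrow> 'b::euclidean_space"
  assumes \<Omega>: "open \<Omega>" and r: "r > 0"
    and W [measurable]: "W \<in> borel_measurable borel" and rep: "AE z in lborel. indicator (cylinder \<Omega> T) z *\<^sub>R u z = W z"
    and slices: "AE t in lborel. t \<in> {0<..<T} \<longrightarrow> integrable (lebesgue_on \<Omega>) (\<lambda>x. norm (u (x, t)) powr r) \<and>
       (LINT x|lebesgue_on \<Omega>. norm (u (x, t)) powr r) \<le> N t"
    and N: "(\<integral>\<^sup>+t. ennreal (N t) \<partial>lebesgue_on {0<..<T}) < \<infinity>"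
  shows "integrable lborel (\<lambda>z. norm (W z) powr r)"
proof (rule integrableI_bounded)
  show "(\<lambda>z. norm (W z) powr r) \<in> borel_measurable lborel" by measurable
  have S\<Omega>: "\<Omega> \<in> sets lebesgue" using \<Omega> by simp
  have meas: "(\<lambda>z. ennreal (norm (norm (W z) powr r))) \<in> borel_measurable (lborel \<Otimes>\<^sub>M lborel)"
    unfolding lborel_prod by measurable
  have "(\<integral>\<^sup>+z. ennreal (norm (norm (W z) powr r)) \<partial>lborel) =
      (\<integral>\<^sup>+t. (\<integral>\<^sup>+x. ennreal (norm (norm (W (x, t)) powr r)) \<partial>lborel) \<partial>lborel)"
    using lborel_pair.nn_integral_snd[OF meas] by (simp add: lborel_prod)
  also have "\<dots> \<le> (\<integral>\<^sup>+t. ennreal (N t) * indicator {0<..<T} t \<partial>lborel)"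
  proof (rule nn_integral_mono_AE)
    show "AE t in lborel. (\<integral>\<^sup>+x. ennreal (norm (norm (W (x, t)) powr r)) \<partial>lborel) \<le> ennreal (N t) * indicator {0<..<T} t"
      using slices AE_lborel_prod_slices[OF rep]
    proof eventually_elim
      case (elim t)
      have "(\<integral>\<^sup>+x. ennreal (norm (norm (W (x, t)) powr r)) \<partial>lborel) =
         (\<integral>\<^sup>+x. (ennreal (norm (u (x, t)) powr r) * indicator {0<..<T} t) * indicator \<Omega> x \<partial>lborel)"
      proof (rule nn_integral_cong_AE)
        show "AE x in lborel. ennreal (norm (norm (W (x, t)) powr r)) = ennreal (norm (u (x, t)) powr r) * indicator {0<..<T} t * indicator \<Omega> x"
          using elim(2)
        proof eventually_elim
          case (elim x)
          show ?case
            unfolding elim[symmetric] using r by (auto simp: cylinder_def split: split_indicator)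
        qed
      qed
      also have "\<dots> \<le> ennreal (N t) * indicator {0<..<T} t"
      proof (cases "t \<in> {0<..<T}")
        case True
        then have int: "integrable (lebesgue_on \<Omega>) (\<lambda>x. norm (u (x, t)) powr r)"
           and le: "(LINT x|lebesgue_on \<Omega>. norm (u (x, t)) powr r) \<le> N t"
          using elim(1) by auto
        have "(\<integral>\<^sup>+x. (ennreal (norm (u (x, t)) powr r) * indicator {0<..<T} t) * indicator \<Omega> x \<partial>lborel) =
           (\<integral>\<^sup>+x. ennreal (norm (u (x, t)) powr r) * indicator \<Omega> x \<partial>lebesgue)"
          using True by (simp add: nn_integral_completion)
        also have "\<dots> = (\<integral>\<^sup>+x. ennreal (norm (u (x, t)) powr r) \<partial>lebesgue_on \<Omega>)"
          using S\<Omega> by (simp add: nn_integral_restrict_space)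
        also have "\<dots> = ennreal (LINT x|lebesgue_on \<Omega>. norm (u (x, t)) powr r)"
          using int by (intro nn_integral_eq_integral) auto
        also have "\<dots> \<le> ennreal (N t)" using le by (rule ennreal_leI)
        finally show ?thesis using True by simp
      qed simp
      finally show ?case .
    qed
  qed
  also have "\<dots> = (\<integral>\<^sup>+t. ennreal (N t) * indicator {0<..<T} t \<partial>lebesgue)"
    by (simp add: nn_integral_completion)
  also have "\<dots> = (\<integral>\<^sup>+t. ennreal (N t) \<partial>lebesgue_on {0<..<T})"
    by (simp add: nn_integral_restrict_space)
  also have "\<dots> < \<infinity>" by (rule N)
  finally show "(\<integral>\<^sup>+z. ennreal (norm (norm (W z) powr r)) \<partial>lborel) < \<infinity>" .
qed

text \<open>\<open>Bochner_Lp\<close> controls the chosen weak gradient slice by slice; uniqueness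
  identifies it with \<open>Du\<close> on almost every slice.\<close>

lemma spatial_gradient_integrable:
  fixes u :: "(real^'n) \<times> real \<Rightarrow> real^'m"
  assumes \<Omega>: "open \<Omega>" and p: "p > 1"
    and u: "slice u \<in> Bochner_Lp p T (W1p p \<Omega>) (W1p_norm p \<Omega>)" and Du: "has_spatial_gradient \<Omega> T u Du"
    and D: "D \<in> borel_measurable borel" "AE z in lborel. indicator (cylinder \<Omega> T) z *\<^sub>R Du z = D z"
  shows "integrable lborel (\<lambda>z. norm (D z) powr p)"
proof (rule slices_integrable_imp_integrable[OF \<Omega> _ D])
  show "p > 0" using p by simp
  have uW: "AE t in lborel. t \<in> {0<..<T} \<longrightarrow> slice u t \<in> W1p p \<Omega>"
    using u by (simp add: Bochner_Lp_def AE_lebesgue_on_iff)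
  have wg: "AE t in lborel. t \<in> {0<..<T} \<longrightarrow> has_weak_gradient \<Omega> (slice u t) (slice Du t)"
    using Du by (simp add: has_spatial_gradient_def AE_lebesgue_on_iff)
  have N: "integrable (lebesgue_on {0<..<T}) (\<lambda>t. W1p_norm p \<Omega> (slice u t) powr p)"
    using u by (simp add: Bochner_Lp_def)
  then show "(\<integral>\<^sup>+t. ennreal (W1p_norm p \<Omega> (slice u t) powr p) \<partial>lebesgue_on {0<..<T}) < \<infinity>"
    by (subst nn_integral_eq_integral) auto
  show "AE t in lborel. t \<in> {0<..<T} \<longrightarrow> integrable (lebesgue_on \<Omega>) (\<lambda>x. norm (Du (x, t)) powr p) \<and>
       (LINT x|lebesgue_on \<Omega>. norm (Du (x, t)) powr p) \<le> W1p_norm p \<Omega> (slice u t) powr p"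
    using uW wg
  proof eventually_elim
    case (elim t)
    show ?case
    proof
      assume t: "t \<in> {0<..<T}"
      then have Dt: "has_weak_gradient \<Omega> (slice u t) (slice Du t)" and "slice u t \<in> W1p p \<Omega>"
        using elim by auto
      then obtain G where G: "has_weak_gradient \<Omega> (slice u t) G" "G \<in> Lp_space p \<Omega>"
        by (auto simp: W1p_def)
      let ?W = "weak_gradient \<Omega> (slice u t)"
      note W = has_weak_gradient_weak_gradient[OF Dt]
      have [measurable]: "slice Du t \<in> borel_measurable (lebesgue_on \<Omega>)" "?W \<in> borel_measurable (lebesgue_on \<Omega>)"
        by (rule has_weak_gradient_measurable[OF \<Omega> Dt], rule has_weak_gradient_measurable[OF \<Omega> W])
      have eqG: "AE x in lebesgue_on \<Omega>. norm (G x) powr p = norm (Du (x, t)) powr p"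
        using has_weak_gradient_unique[OF \<Omega> G(1) Dt] by eventually_elim simp
      have eqW: "AE x in lebesgue_on \<Omega>. norm (Du (x, t)) powr p = norm (?W x) powr p"
        using has_weak_gradient_unique[OF \<Omega> Dt W] by eventually_elim simp
      have "integrable (lebesgue_on \<Omega>) (\<lambda>x. norm (G x) powr p)"
        using G(2) by (simp add: Lp_space_def)
      then have int: "integrable (lebesgue_on \<Omega>) (\<lambda>x. norm (Du (x, t)) powr p)"
        by (rule integrable_cong_AE_imp) (use eqG in auto)
      have "(LINT x|lebesgue_on \<Omega>. norm (Du (x, t)) powr p) = (LINT x|lebesgue_on \<Omega>. norm (?W x) powr p)"
        by (rule integral_cong_AE) (use eqW in auto)
      also have "\<dots> \<le> W1p_norm p \<Omega> (slice u t) powr p"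
        using p by (simp add: W1p_norm_powr)
      finally show "integrable (lebesgue_on \<Omega>) (\<lambda>x. norm (Du (x, t)) powr p) \<and>
         (LINT x|lebesgue_on \<Omega>. norm (Du (x, t)) powr p) \<le> W1p_norm p \<Omega> (slice u t) powr p"
        using int by blast
    qed
  qed
qed

text \<open>The slice norms are continuous on the compact interval [0, T], hence bounded.\<close>

lemma C0_L2_integrable:
  fixes u :: "(real^'n) \<times> real \<Rightarrow> real^'m"
  assumes \<Omega>: "open \<Omega>" and u: "slice u \<in> C0_L2 T \<Omega>"
    and W: "W \<in> borel_measurable borel" "AE z in lborel. indicator (cylinder \<Omega> T) z *\<^sub>R u z = W z"
  shows "integrable lborel (\<lambda>z. norm (W z) powr 2)"
proof -
  have "compact ((\<lambda>t. LINT x|lebesgue_on \<Omega>. (norm (u (x, t)))\<^sup>2) ` {0..T})"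
    using C0_L2_continuous_norm[OF u] by (intro compact_continuous_image) auto
  then obtain M where "\<forall>y\<in>(\<lambda>t. LINT x|lebesgue_on \<Omega>. (norm (u (x, t)))\<^sup>2) ` {0..T}. \<bar>y\<bar> \<le> M"
    using compact_imp_bounded bounded_real by blast
  then have M: "(LINT x|lebesgue_on \<Omega>. (norm (u (x, t)))\<^sup>2) \<le> M" if "t \<in> {0..T}" for t
    using that by force
  show ?thesis
  proof (rule slices_integrable_imp_integrable[OF \<Omega> _ W, where N = "\<lambda>_. M"])
    show "AE t in lborel. t \<in> {0<..<T} \<longrightarrow> integrable (lebesgue_on \<Omega>) (\<lambda>x. norm (u (x, t)) powr 2) \<and>
       (LINT x|lebesgue_on \<Omega>. norm (u (x, t)) powr 2) \<le> M"
      using M u by (intro AE_I2) (auto simp: C0_L2_def Lp_space_def norm_powr_two)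
    have "emeasure (lebesgue_on {0<..<T}) {0<..<T} < \<infinity>"
      by (cases "0 \<le> T") (auto simp: emeasure_restrict_space)
    then show "(\<integral>\<^sup>+t. ennreal M \<partial>lebesgue_on {0<..<T}) < \<infinity>"
      by (simp add: ennreal_mult_less_top)
  qed simp
qed

lemma deriv_test_function:
  fixes \<eta> :: "real \<Rightarrow> real"
  assumes "\<eta> \<in> test_functions U"
  shows "(\<eta> has_field_derivative deriv \<eta> t) (at t)" and "deriv \<eta> \<in> test_functions U"
proof -
  have lin: "linear (frechet_derivative \<eta> (at t))" for t
    using test_functions_has_derivative[OF assms] by (rule has_derivative_linear)
  have D: "(\<eta> has_field_derivative frechet_derivative \<eta> (at t) 1) (at t)" for t
  proof -
    have "frechet_derivative \<eta> (at t) h = frechet_derivative \<eta> (at t) 1 * h" for h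
      using linear_scale[OF lin, of t h 1] by simp
    then have "frechet_derivative \<eta> (at t) = (\<lambda>h. frechet_derivative \<eta> (at t) 1 * h)"
      by (rule ext)
    then show ?thesis
      using test_functions_has_derivative[OF assms, of t] unfolding has_field_derivative_def by metis
  qed
  then have eq: "deriv \<eta> t = frechet_derivative \<eta> (at t) 1" for t
    by (rule DERIV_imp_deriv)
  then show "(\<eta> has_field_derivative deriv \<eta> t) (at t)" using D by simp
  have "deriv \<eta> = (\<lambda>t. frechet_derivative \<eta> (at t) 1)" using eq by blast
  then show "deriv \<eta> \<in> test_functions U" using test_functions_frechet_derivative[OF assms] by simp
qed

lemma partial_derivatives_test_function:
  fixes \<Phi> :: "(real^'n) \<times> real \<Rightarrow> real^'m"
  assumes "\<Phi> \<in> test_functions Q"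
  shows "vector_derivative (\<lambda>s. \<Phi> (x, s)) (at t) = frechet_derivative \<Phi> (at (x, t)) (0, 1)"
    and "jacobian (\<lambda>y. \<Phi> (y, t)) (at x) $ j $ i = frechet_derivative \<Phi> (at (x, t)) (axis i 1, 0) $ j"
proof -
  note D = test_functions_has_derivative[OF assms, of "(x, t)"]
  have lin: "linear (frechet_derivative \<Phi> (at (x, t)))"
    using D by (rule has_derivative_linear)
  have "((\<lambda>s. (x, s)) has_derivative (\<lambda>h. (0, h))) (at t)"
    by (auto intro!: derivative_eq_intros)
  from has_derivative_compose[OF this D]
  have "((\<lambda>s. \<Phi> (x, s)) has_vector_derivative frechet_derivative \<Phi> (at (x, t)) (0, 1)) (at t)"
    unfolding has_vector_derivative_def
  proof (rule has_derivative_eq_rhs)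
    show "(\<lambda>h. frechet_derivative \<Phi> (at (x, t)) (0, h)) = (\<lambda>h. h *\<^sub>R frechet_derivative \<Phi> (at (x, t)) (0, 1))"
    proof
      fix h :: real
      have "h *\<^sub>R (0 :: real^'n, 1 :: real) = (0, h)" by simp
      then show "frechet_derivative \<Phi> (at (x, t)) (0, h) = h *\<^sub>R frechet_derivative \<Phi> (at (x, t)) (0, 1)"
        using linear_scale[OF lin, of h "(0, 1)"] by metis
    qed
  qed
  then show "vector_derivative (\<lambda>s. \<Phi> (x, s)) (at t) = frechet_derivative \<Phi> (at (x, t)) (0, 1)"
    by (rule vector_derivative_at)
  have "((\<lambda>y. (y, t)) has_derivative (\<lambda>h. (h, 0))) (at x)"
    by (auto intro!: derivative_eq_intros)
  from fun_cong[OF frechet_derivative_at[OF has_derivative_compose[OF this D]], symmetric]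
  show "jacobian (\<lambda>y. \<Phi> (y, t)) (at x) $ j $ i = frechet_derivative \<Phi> (at (x, t)) (axis i 1, 0) $ j"
    by (simp add: jacobian_def matrix_def)
qed

text \<open>
  \<open>F\<close> is not assumed to be jointly measurable. Measurability of the flux comes out of the weak
  formulation: comparing the test functions \<open>\<psi> e\<^sub>j\<close> and \<open>x\<^sub>i \<psi> e\<^sub>j\<close> isolates \<open>\<psi> A\<^sub>j\<^sub>i\<close>.
\<close>

lemma flux_measurable:
  fixes u :: "(real^'n) \<times> real \<Rightarrow> real^'m" and A :: "(real^'n) \<times> real \<Rightarrow> real^'n^'m"
  assumes Q: "open Q" and u [measurable]: "u \<in> borel_measurable (lebesgue_on Q)"
    and int: "\<And>\<Phi>. \<Phi> \<in> test_functions Q \<Longrightarrow> integrable (lebesgue_on Q)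
       (\<lambda>(x, t). u (x, t) \<bullet> vector_derivative (\<lambda>s. \<Phi> (x, s)) (at t) - A (x, t) \<bullet> jacobian (\<lambda>y. \<Phi> (y, t)) (at x))"
  shows "A \<in> borel_measurable (lebesgue_on Q)"
proof -
  let ?M = "lebesgue_on Q"
  have borel: "f \<in> borel_measurable ?M" if "f \<in> borel_measurable borel" for f :: "(real^'n) \<times> real \<Rightarrow> 'z::euclidean_space"
    by (rule measurable_restrict_space1[OF borel_measurable_lebesgueI[OF that]])
  define J where "J \<Phi> z = jacobian (\<lambda>y. \<Phi> (y, snd z)) (at (fst z))" for \<Phi> :: "(real^'n) \<times> real \<Rightarrow> real^'m" and z
  have AJ: "(\<lambda>z. A z \<bullet> J \<Phi> z) \<in> borel_measurable ?M" if \<Phi>: "\<Phi> \<in> test_functions Q" for \<Phi>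
  proof -
    have [measurable]: "(\<lambda>z. frechet_derivative \<Phi> (at z) (0, 1)) \<in> borel_measurable ?M"
      by (rule borel[OF test_functions_borel_measurable[OF test_functions_frechet_derivative[OF \<Phi>]]])
    have "(\<lambda>z. u z \<bullet> frechet_derivative \<Phi> (at z) (0, 1) - A z \<bullet> J \<Phi> z) \<in> borel_measurable ?M"
      using borel_measurable_integrable[OF int[OF \<Phi>]]
      by (simp add: partial_derivatives_test_function(1)[OF \<Phi>] split_beta' J_def)
    then have "(\<lambda>z. u z \<bullet> frechet_derivative \<Phi> (at z) (0, 1) - (u z \<bullet> frechet_derivative \<Phi> (at z) (0, 1) - A z \<bullet> J \<Phi> z)) \<in> borel_measurable ?M"
      by measurable
    then show ?thesis by simp
  qed
  have chi: "(\<lambda>z. \<psi> z * A z $ j $ i) \<in> borel_measurable ?M"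
    if \<psi>: "\<psi> \<in> test_functions Q" for \<psi> :: "(real^'n) \<times> real \<Rightarrow> real" and i j
  proof -
    define \<Phi>1 where "\<Phi>1 z = \<psi> z *\<^sub>R axis j (1::real)" for z
    define \<Phi>2 where "\<Phi>2 z = (fst z $ i) *\<^sub>R \<Phi>1 z" for z
    have \<Phi>1: "\<Phi>1 \<in> test_functions Q"
      unfolding \<Phi>1_def by (rule test_functions_bounded_linear[OF \<psi> bounded_linear_scaleR_left])
    have lin: "bounded_linear (\<lambda>z::(real^'n) \<times> real. fst z $ i)"
      by (rule bounded_linear_compose[OF bounded_linear_vec_nth bounded_linear_fst])
    have \<Phi>2: "\<Phi>2 \<in> test_functions Q"
    proof (rule test_functions_vanish[OF \<Phi>1])
      show "Ck k \<Phi>2" for k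
        unfolding \<Phi>2_def by (rule Ck_scaleR[OF Ck_linear[OF lin] test_functions_Ck[OF \<Phi>1]])
    qed (simp add: \<Phi>2_def)
    have J2: "J \<Phi>2 z = (fst z $ i) *\<^sub>R J \<Phi>1 z + \<psi> z *\<^sub>R axis j (axis i 1)" for z
    proof -
      have "(\<Phi>2 has_derivative (\<lambda>h. (fst z $ i) *\<^sub>R frechet_derivative \<Phi>1 (at z) h + (fst h $ i) *\<^sub>R \<Phi>1 z)) (at z)"
        unfolding \<Phi>2_def
        by (rule has_derivative_scaleR[OF bounded_linear_imp_has_derivative[OF lin] test_functions_has_derivative[OF \<Phi>1]])
      from fun_cong[OF frechet_derivative_at[OF this], symmetric]
      have "frechet_derivative \<Phi>2 (at z) h = (fst z $ i) *\<^sub>R frechet_derivative \<Phi>1 (at z) h + (fst h $ i) *\<^sub>R \<Phi>1 z" for h .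
      moreover have "\<Phi>1 z $ j' = (if j' = j then \<psi> z else 0)" for j'
        by (simp add: \<Phi>1_def axis_def)
      ultimately have "J \<Phi>2 z $ j' $ i' = ((fst z $ i) *\<^sub>R J \<Phi>1 z + \<psi> z *\<^sub>R axis j (axis i 1)) $ j' $ i'" for j' i'
        unfolding J_def
        by (simp add: partial_derivatives_test_function(2)[OF \<Phi>2] partial_derivatives_test_function(2)[OF \<Phi>1] axis_def)
      then show ?thesis by (simp add: vec_eq_iff)
    qed
    have "A z \<bullet> axis j (axis i 1) = A z $ j $ i" for z
      by (simp add: inner_axis)
    then have eq: "\<psi> z * A z $ j $ i = A z \<bullet> J \<Phi>2 z - fst z $ i * (A z \<bullet> J \<Phi>1 z)" for z
      by (simp add: J2 inner_add_right)
    have "(\<lambda>z::(real^'n) \<times> real. fst z $ i) \<in> borel_measurable ?M"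
      by (rule borel) (intro borel_measurable_continuous_onI continuous_intros)
    then show ?thesis
      unfolding eq by (intro borel_measurable_diff borel_measurable_times AJ \<Phi>1 \<Phi>2)
  qed
  have comp: "(\<lambda>z. A z $ j $ i) \<in> borel_measurable ?M" for i j
  proof -
    \<comment> \<open>On an open box the bump is positive, so dividing the measurable product by it
      recovers the entry of A there; by the Lindeloef property countably many boxes suffice to cover
      Q.\<close>
    define \<F> where "\<F> = {box a b |a b. cbox a b \<subseteq> Q}"
    have op: "open S" if "S \<in> \<F>" for S using that by (auto simp: \<F>_def)
    have cover: "\<Union>\<F> = Q"
    proof
      show "\<Union>\<F> \<subseteq> Q" using box_subset_cbox by (fastforce simp: \<F>_def)
      show "Q \<subseteq> \<Union>\<F>"
      proof
        fix z assume "z \<in> Q"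
        then obtain a b where z: "z \<in> box a b" and ab: "cbox a b \<subseteq> Q"
          using Q open_contains_cbox by metis
        have "box a b \<in> \<F>" unfolding \<F>_def using ab by blast
        then show "z \<in> \<Union>\<F>" using z by (rule UnionI)
      qed
    qed
    obtain \<F>' where \<F>': "\<F>' \<subseteq> \<F>" "countable \<F>'" "\<Union>\<F>' = \<Union>\<F>"
      using Lindelof[OF op] by metis
    show ?thesis
    proof (rule measurable_piecewise_restrict[OF \<F>'(2)])
      fix S assume S: "S \<in> \<F>'"
      then obtain a b where ab: "S = box a b" "cbox a b \<subseteq> Q"
        using \<F>'(1) by (auto simp: \<F>_def)
      show S_sets: "S \<inter> space ?M \<in> sets ?M"
        using ab Q by (auto simp: sets_restrict_space_iff)
      have [measurable]: "bump 1 a b \<in> borel_measurable ?M"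
        by (intro borel borel_measurable_continuous_onI Ck_continuous[OF Ck_bump])
      have "(\<lambda>z. (bump 1 a b z * A z $ j $ i) / bump 1 a b z) \<in> borel_measurable ?M"
        using chi[OF bump_test_function[OF zero_less_one ab(2)]] by measurable
      then have "(\<lambda>z. (bump 1 a b z * A z $ j $ i) / bump 1 a b z) \<in> borel_measurable (restrict_space ?M S)"
        by (rule measurable_restrict_space1)
      moreover have "(bump 1 a b z * A z $ j $ i) / bump 1 a b z = A z $ j $ i" if "z \<in> space (restrict_space ?M S)" for z
        using that ab bump_eq_0_iff[of 1 a b z] by (simp add: space_restrict_space)
      ultimately show "(\<lambda>z. A z $ j $ i) \<in> borel_measurable (restrict_space ?M S)"
        using measurable_cong by (metis (no_types, lifting))
    qed (use \<F>' cover in auto)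
  qed
  have eq: "A = (\<lambda>z. \<Sum>i\<in>UNIV. \<Sum>j\<in>UNIV. A z $ j $ i *\<^sub>R axis j (axis i 1))"
    by (simp add: fun_eq_iff vec_eq_iff axis_def sum.delta if_distrib if_distribR cong: if_cong)
  show ?thesis
    by (subst eq) (use comp in measurable)
qed

text \<open>The initial condition prescribes a limit as t decreases to 0, whereas continuity in L2
  gives u t \<rightarrow> u 0. Comparing both through |a - b|^2 \<le> 2 |a|^2 + 2 |b|^2 identifies
  the value at time 0 itself.\<close>

lemma initial_value:
  fixes u :: "real \<Rightarrow> 'a::euclidean_space \<Rightarrow> 'b::euclidean_space"
  assumes T: "T > 0" and u: "u \<in> C0_L2 T \<Omega>" and g: "g \<in> Lp_space 2 \<Omega>"
    and lim: "((\<lambda>t. Lp_norm 2 \<Omega> (\<lambda>x. u t x - g x)) \<longlongrightarrow> 0) (at_right 0)"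
  shows "AE x in lebesgue_on \<Omega>. u 0 x = g x"
proof -
  let ?I = "\<lambda>v. LINT x|lebesgue_on \<Omega>. (norm (v x :: 'b))\<^sup>2"
  have uL: "u t \<in> Lp_space 2 \<Omega>" if "t \<in> {0..T}" for t
    using u that by (simp add: C0_L2_def)
  have "((\<lambda>t. (Lp_norm 2 \<Omega> (\<lambda>x. u t x - g x))\<^sup>2) \<longlongrightarrow> 0\<^sup>2) (at_right 0)"
    by (rule tendsto_power[OF lim])
  then have l1: "((\<lambda>t. ?I (\<lambda>x. u t x - g x)) \<longlongrightarrow> 0) (at_right 0)"
    by (simp add: Lp_norm_def norm_powr_two powr_half_sqrt)
  have l2: "((\<lambda>t. ?I (\<lambda>x. u t x - u 0 x)) \<longlongrightarrow> 0) (at_right 0)"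
    using C0_L2_tendsto[OF u, of 0] T by (simp add: at_within_Icc_at_right)
  have D: "(\<lambda>x. u 0 x - g x) \<in> Lp_space 2 \<Omega>"
    using T by (intro Lp_space_two_products(3) uL g) simp
  have "?I (\<lambda>x. u 0 x - g x) \<le> 0"
  proof (rule tendsto_le[OF _ _ tendsto_const])
    show "((\<lambda>t. 2 * ?I (\<lambda>x. u t x - g x) + 2 * ?I (\<lambda>x. u t x - u 0 x)) \<longlongrightarrow> 0) (at_right 0)"
      using tendsto_add[OF tendsto_mult_left[OF l1, of 2] tendsto_mult_left[OF l2, of 2]] by simp
    have "\<forall>\<^sub>F t in at_right 0. t \<in> {0<..<T}"
      using eventually_at_right_real[OF T] .
    then show "\<forall>\<^sub>F t in at_right 0. ?I (\<lambda>x. u 0 x - g x) \<le> 2 * ?I (\<lambda>x. u t x - g x) + 2 * ?I (\<lambda>x. u t x - u 0 x)"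
    proof eventually_elim
      case (elim t)
      have L: "(\<lambda>x. u t x - g x) \<in> Lp_space 2 \<Omega>" "(\<lambda>x. u t x - u 0 x) \<in> Lp_space 2 \<Omega>"
        using elim by (auto intro!: Lp_space_two_products(3) uL g)
      have "?I (\<lambda>x. u 0 x - g x) \<le> (LINT x|lebesgue_on \<Omega>. 2 * (norm (u t x - g x))\<^sup>2 + 2 * (norm (u t x - u 0 x))\<^sup>2)"
      proof (rule integral_mono)
        show "(norm (u 0 x - g x))\<^sup>2 \<le> 2 * (norm (u t x - g x))\<^sup>2 + 2 * (norm (u t x - u 0 x))\<^sup>2" for x
        proof -
          have "0 \<le> (norm ((u t x - g x) + (u t x - u 0 x)))\<^sup>2" by simp
          then show ?thesis
            by (simp add: power2_norm_eq_inner inner_diff_left inner_diff_right inner_add_left inner_add_right inner_commute)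
        qed
      qed (use D L in \<open>auto simp: Lp_space_two\<close>)
      also have "\<dots> = 2 * ?I (\<lambda>x. u t x - g x) + 2 * ?I (\<lambda>x. u t x - u 0 x)"
        using L by (simp add: Lp_space_two)
      finally show ?case .
    qed
  qed simp
  moreover have "?I (\<lambda>x. u 0 x - g x) \<ge> 0" by simp
  ultimately have "?I (\<lambda>x. u 0 x - g x) = 0" by linarith
  then have "AE x in lebesgue_on \<Omega>. (norm (u 0 x - g x))\<^sup>2 = 0"
    using D by (subst integral_nonneg_eq_0_iff_AE[symmetric]) (auto simp: Lp_space_two)
  then show ?thesis by eventually_elim simp
qed

lemma C0_L2_diff:
  fixes u v :: "real \<Rightarrow> 'a::euclidean_space \<Rightarrow> 'b::euclidean_space"
  assumes u: "u \<in> C0_L2 T \<Omega>" and v: "v \<in> C0_L2 T \<Omega>"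
  shows "(\<lambda>t x. u t x - v t x) \<in> C0_L2 T \<Omega>"
proof -
  let ?I = "\<lambda>v. LINT x|lebesgue_on \<Omega>. (norm (v x :: 'b))\<^sup>2"
  have uL: "u t \<in> Lp_space 2 \<Omega>" "v t \<in> Lp_space 2 \<Omega>" if "t \<in> {0..T}" for t
    using u v that by (auto simp: C0_L2_def)
  have "((\<lambda>s. Lp_norm 2 \<Omega> (\<lambda>x. (u s x - v s x) - (u t x - v t x))) \<longlongrightarrow> 0) (at t within {0..T})"
    if t: "t \<in> {0..T}" for t
  proof -
    have "((\<lambda>s. ?I (\<lambda>x. (u s x - v s x) - (u t x - v t x))) \<longlongrightarrow> 0) (at t within {0..T})"
    proof (rule tendsto_sandwich[OF _ _ tendsto_const])
      show "((\<lambda>s. 2 * ?I (\<lambda>x. u s x - u t x) + 2 * ?I (\<lambda>x. v s x - v t x)) \<longlongrightarrow> 0) (at t within {0..T})"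
        using tendsto_add[OF tendsto_mult_left[OF C0_L2_tendsto[OF u t], of 2] tendsto_mult_left[OF C0_L2_tendsto[OF v t], of 2]]
        by simp
      have "\<forall>\<^sub>F s in at t within {0..T}. s \<in> {0..T}"
        by (simp add: eventually_at_filter)
      then show "\<forall>\<^sub>F s in at t within {0..T}. ?I (\<lambda>x. (u s x - v s x) - (u t x - v t x)) \<le>
          2 * ?I (\<lambda>x. u s x - u t x) + 2 * ?I (\<lambda>x. v s x - v t x)"
      proof eventually_elim
        case (elim s)
        note L2 = Lp_space_two_products(3)
        have L: "(\<lambda>x. u s x - u t x) \<in> Lp_space 2 \<Omega>" "(\<lambda>x. v s x - v t x) \<in> Lp_space 2 \<Omega>"
          "(\<lambda>x. (u s x - v s x) - (u t x - v t x)) \<in> Lp_space 2 \<Omega>"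
          using L2[OF uL(1)[OF elim] uL(1)[OF t]] L2[OF uL(2)[OF elim] uL(2)[OF t]]
            L2[OF L2[OF uL[OF elim]] L2[OF uL[OF t]]] by auto
        have "?I (\<lambda>x. (u s x - v s x) - (u t x - v t x)) \<le>
          (LINT x|lebesgue_on \<Omega>. 2 * (norm (u s x - u t x))\<^sup>2 + 2 * (norm (v s x - v t x))\<^sup>2)"
        proof (rule integral_mono)
          show "(norm ((u s x - v s x) - (u t x - v t x)))\<^sup>2 \<le> 2 * (norm (u s x - u t x))\<^sup>2 + 2 * (norm (v s x - v t x))\<^sup>2" for x
          proof -
            have "0 \<le> (norm ((u s x - u t x) + (v s x - v t x)))\<^sup>2" by simp
            then show ?thesis
              by (simp add: power2_norm_eq_inner inner_diff_left inner_diff_right inner_add_left inner_add_right inner_commute)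
          qed
        qed (use L in \<open>auto simp: Lp_space_two\<close>)
        also have "\<dots> = 2 * ?I (\<lambda>x. u s x - u t x) + 2 * ?I (\<lambda>x. v s x - v t x)"
          using L by (simp add: Lp_space_two)
        finally show ?case .
      qed
    qed simp
    then have "((\<lambda>s. sqrt (?I (\<lambda>x. (u s x - v s x) - (u t x - v t x)))) \<longlongrightarrow> sqrt 0) (at t within {0..T})"
      by (rule tendsto_real_sqrt)
    then show ?thesis
      by (simp add: Lp_norm_def norm_powr_two powr_half_sqrt)
  qed
  then show ?thesis
    using Lp_space_two_products(3)[OF uL] by (simp add: C0_L2_def)
qed

lemma measurable_lborelI: "f \<in> borel_measurable borel \<Longrightarrow> f \<in> borel_measurable lborel"
  by simp

lemma borel_measurable_compose_fst:
  fixes f :: "'a::euclidean_space \<Rightarrow> 'c::euclidean_space"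
  assumes "f \<in> borel_measurable borel"
  shows "(\<lambda>z. f (fst z)) \<in> borel_measurable (lborel :: ('a \<times> 'b::euclidean_space) measure)"
  by (intro measurable_lborelI measurable_compose[OF _ assms] borel_measurable_continuous_onI continuous_intros)

lemma borel_measurable_compose_snd:
  fixes f :: "'b::euclidean_space \<Rightarrow> 'c::euclidean_space"
  assumes "f \<in> borel_measurable borel"
  shows "(\<lambda>z. f (snd z)) \<in> borel_measurable (lborel :: ('a::euclidean_space \<times> 'b) measure)"
  by (intro measurable_lborelI measurable_compose[OF _ assms] borel_measurable_continuous_onI continuous_intros)

lemma integrable_bounded_mult:
  fixes f :: "'a \<Rightarrow> real"
  assumes f: "integrable M f" and [measurable]: "g \<in> borel_measurable M" and g: "\<And>x. \<bar>g x\<bar> \<le> C"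
  shows "integrable M (\<lambda>x. g x * f x)"
proof (rule Bochner_Integration.integrable_bound)
  show "integrable M (\<lambda>x. C * f x)" using f by simp
  have [measurable]: "f \<in> borel_measurable M" using f by auto
  show "(\<lambda>x. g x * f x) \<in> borel_measurable M" by measurable
  have "C \<ge> 0" for x :: 'a using g[of x] by linarith
  then show "AE x in M. norm (g x * f x) \<le> norm (C * f x)"
    using g by (intro AE_I2) (auto simp: abs_mult intro!: mult_right_mono order_trans[OF g abs_ge_self])
qed

lemma integrable_bounded_inner:
  fixes f g :: "'a \<Rightarrow> 'b::euclidean_space"
  assumes f: "integrable M f" and [measurable]: "g \<in> borel_measurable M" and g: "\<And>x. norm (g x) \<le> C"
  shows "integrable M (\<lambda>x. f x \<bullet> g x)"
proof (rule Bochner_Integration.integrable_bound)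
  show "integrable M (\<lambda>x. C * norm (f x))" using f by simp
  have [measurable]: "f \<in> borel_measurable M" using f by auto
  show "(\<lambda>x. f x \<bullet> g x) \<in> borel_measurable M" by measurable
  show "AE x in M. norm (f x \<bullet> g x) \<le> norm (C * norm (f x))"
  proof (rule AE_I2)
    fix x
    have "\<bar>f x \<bullet> g x\<bar> \<le> norm (f x) * C"
      by (rule order_trans[OF Cauchy_Schwarz_ineq2 mult_left_mono[OF g]]) simp
    then show "norm (f x \<bullet> g x) \<le> norm (C * norm (f x))"
      by (simp add: mult.commute)
  qed
qed

text \<open>On the set Q of finite measure |f| \<le> 1 + |f|^r, and off Q the function
  vanishes.\<close>

lemma integrable_of_powr:
  fixes f :: "'a \<Rightarrow> 'b::euclidean_space"
  assumes [measurable]: "f \<in> borel_measurable M" "Q \<in> sets M" and Q: "emeasure M Q < \<infinity>"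
    and f: "integrable M (\<lambda>x. norm (f x) powr r)" and r: "r \<ge> 1" and zero: "AE x in M. x \<notin> Q \<longrightarrow> f x = 0"
  shows "integrable M f"
proof (rule Bochner_Integration.integrable_bound)
  show "integrable M (\<lambda>x. indicator Q x + norm (f x) powr r)"
    using f Q by (intro Bochner_Integration.integrable_add integrable_real_indicator) auto
  show "AE x in M. norm (f x) \<le> norm (indicator Q x + norm (f x) powr r)"
    using zero
  proof eventually_elim
    case (elim x)
    have "norm (f x) \<le> 1 + norm (f x) powr r"
    proof (cases "norm (f x) \<le> 1")
      case False
      then have "norm (f x) powr 1 \<le> norm (f x) powr r" using r by (intro powr_mono) auto
      then show ?thesis by simp
    qed (simp add: add_increasing2)
    then show ?case using elim by (cases "x \<in> Q") auto
  qed
qed measurable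

text \<open>Product test functions separate the variables. After Fubini the weak form says that the
  continuous function a, the spatial pairing of \<open>w t\<close> with \<phi>, has weak derivative
  - b, which reduces the claim to one dimension.\<close>

lemma weak_form_increment:
  fixes w :: "real \<Rightarrow> real^'n \<Rightarrow> real^'m" and B :: "(real^'n) \<times> real \<Rightarrow> real^'n^'m"
  assumes \<Omega>: "open \<Omega>" and w: "w \<in> C0_L2 T \<Omega>"
    and Wm [measurable]: "W \<in> borel_measurable borel"
    and rep: "AE z in lborel. indicator (cylinder \<Omega> T) z *\<^sub>R w (snd z) (fst z) = W z"
    and W: "integrable lborel W" and B: "integrable lborel B"
    and weak: "\<And>\<phi> \<eta>. \<phi> \<in> test_functions \<Omega> \<Longrightarrow> \<eta> \<in> test_functions {0<..<T} \<Longrightarrow>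
       (LINT z|lborel. deriv \<eta> (snd z) * (W z \<bullet> \<phi> (fst z)) - \<eta> (snd z) * (B z \<bullet> jacobian \<phi> (at (fst z)))) = 0"
    and \<phi>: "\<phi> \<in> test_functions \<Omega>" and t: "0 \<le> t\<^sub>1" "t\<^sub>1 < t\<^sub>2" "t\<^sub>2 < T"
  shows "(LINT x|lebesgue_on \<Omega>. (w t\<^sub>2 x - w t\<^sub>1 x) \<bullet> \<phi> x) =
       - (LINT z|lborel. (indicator {t\<^sub>1<..<t\<^sub>2} (snd z) *\<^sub>R B z) \<bullet> jacobian \<phi> (at (fst z)))"
proof -
  have Q[measurable]: "B \<in> borel_measurable borel" using B by auto
  have S\<Omega>: "\<Omega> \<in> sets lebesgue" using \<Omega> by simp
  have \<phi>L: "\<phi> \<in> Lp_space 2 \<Omega>" by (rule test_function_Lp(1)[OF \<Omega> \<phi>]) simp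
  have wL: "w t \<in> Lp_space 2 \<Omega>" if "t \<in> {0..T}" for t using w that by (simp add: C0_L2_def)
  define a where "a t = (LINT x|lebesgue_on \<Omega>. w t x \<bullet> \<phi> x)" for t
  have a: "continuous_on {0..T} a"
    unfolding a_def by (rule C0_L2_continuous_inner[OF w \<phi>L])
  define P where "P z = W z \<bullet> \<phi> (fst z)" for z
  define R where "R z = B z \<bullet> jacobian \<phi> (at (fst z))" for z
  obtain C1 where C1: "\<And>x. norm (\<phi> x) \<le> C1"
    using test_functions_bounded[OF \<phi>] by auto
  obtain C2 where C2: "\<And>x. norm (jacobian \<phi> (at x)) \<le> C2"
    using jacobian_test_function(4)[OF \<phi>] by auto
  have P: "integrable lborel P"
    unfolding P_def by (rule integrable_bounded_inner[OF W borel_measurable_compose_fst[OF test_functions_borel_measurable[OF \<phi>]] C1])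
  have R: "integrable lborel R"
    unfolding R_def by (rule integrable_bounded_inner[OF B borel_measurable_compose_fst[OF jacobian_test_function(1)[OF \<phi>]] C2])
  define b where "b t = (LINT x|lborel. R (x, t))" for t
  \<comment> \<open>One instance of Fubini for all weights in time that occur: the derivative of
    \<eta>, \<eta> itself, the constant 1 and an indicator.\<close>
  have fub: "integrable lborel (\<lambda>t. g t * (LINT x|lborel. f (x, t)))"
    "(LINT t|lborel. g t * (LINT x|lborel. f (x, t))) = (LINT z|lborel. g (snd z) * f z)"
    "integrable lborel (\<lambda>z. g (snd z) * f z)"
    if f: "integrable lborel f" and g: "g \<in> borel_measurable borel" "\<And>t. \<bar>g t\<bar> \<le> C"
    for f :: "(real^'n) \<times> real \<Rightarrow> real" and g :: "real \<Rightarrow> real" and C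
  proof -
    show i: "integrable lborel (\<lambda>z. g (snd z) * f z)"
      by (rule integrable_bounded_mult[OF f borel_measurable_compose_snd[OF g(1)] g(2)])
    then have "integrable (lborel \<Otimes>\<^sub>M lborel) (\<lambda>z. g (snd z) * f z)"
      by (simp add: lborel_prod)
    then have i': "integrable (lborel \<Otimes>\<^sub>M lborel) (case_prod (\<lambda>x t. g t * f (x, t)))"
      by (simp add: split_beta')
    show "integrable lborel (\<lambda>t. g t * (LINT x|lborel. f (x, t)))"
      using lborel_pair.integrable_snd[OF i'] by simp
    show "(LINT t|lborel. g t * (LINT x|lborel. f (x, t))) = (LINT z|lborel. g (snd z) * f z)"
      using lborel_pair.integral_snd[OF i'] by (simp add: split_beta' lborel_prod)
  qed
  have b: "integrable lborel b"
    using fub(1)[OF R, of "\<lambda>_. 1" 1] by (simp add: b_def[abs_def])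
  have slice: "AE t in lborel. t \<in> {0<..<T} \<longrightarrow> (LINT x|lborel. P (x, t)) = a t"
    using AE_lborel_prod_slices[OF rep]
  proof eventually_elim
    case (elim t)
    show ?case
    proof
      assume t: "t \<in> {0<..<T}"
      have [measurable]: "(\<lambda>x. P (x, t)) \<in> borel_measurable borel"
      proof -
        have "P \<in> borel_measurable borel" using P by auto
        then show ?thesis
          by (rule measurable_compose[rotated]) (intro borel_measurable_continuous_onI continuous_intros)
      qed
      have int: "integrable (lebesgue_on \<Omega>) (\<lambda>x. w t x \<bullet> \<phi> x)"
        using t by (intro Lp_space_two_products(2)[OF wL \<phi>L]) auto
      have "(LINT x|lborel. P (x, t)) = (LINT x|lebesgue. P (x, t))"
        by (rule integral_completion[symmetric]) simp
      also have "\<dots> = (LINT x|lebesgue. indicator \<Omega> x *\<^sub>R (w t x \<bullet> \<phi> x))"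
      proof (rule integral_cong_AE)
        show "(\<lambda>x. P (x, t)) \<in> borel_measurable lebesgue"
          by (rule borel_measurable_lebesgueI) simp
        show "(\<lambda>x. indicator \<Omega> x *\<^sub>R (w t x \<bullet> \<phi> x)) \<in> borel_measurable lebesgue"
          using int S\<Omega> by (subst borel_measurable_restrict_space_iff[symmetric]) auto
        show "AE x in lebesgue. P (x, t) = indicator \<Omega> x *\<^sub>R (w t x \<bullet> \<phi> x)"
          using AE_completion[OF elim]
        proof eventually_elim
          case (elim x)
          show ?case
            unfolding P_def elim[symmetric] using t by (auto simp: cylinder_def split: split_indicator)
        qed
      qed
      also have "\<dots> = a t"
        unfolding a_def using S\<Omega> by (subst integral_restrict_space) auto
      finally show "(LINT x|lborel. P (x, t)) = a t" .
    qed
  qed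
  have weak': "(LINT t|lborel. deriv \<eta> t * a t) = (LINT t|lborel. \<eta> t * b t)" if \<eta>: "\<eta> \<in> test_functions {0<..<T}" for \<eta>
  proof -
    note d\<eta> = deriv_test_function(2)[OF \<eta>]
    note m = test_functions_borel_measurable[OF \<eta>] test_functions_borel_measurable[OF d\<eta>]
    obtain C3 where C3: "\<And>t. \<bar>\<eta> t\<bar> \<le> C3"
      using test_functions_bounded[OF \<eta>] by auto
    obtain C4 where C4: "\<And>t. \<bar>deriv \<eta> t\<bar> \<le> C4"
      using test_functions_bounded[OF d\<eta>] by auto
    note f1 = fub[OF P m(2) C4] and f2 = fub[OF R m(1) C3]
    have "(LINT t|lborel. deriv \<eta> t * a t) = (LINT t|lborel. deriv \<eta> t * (LINT x|lborel. P (x, t)))"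
    proof (rule integral_cong_AE)
      \<comment> \<open>Continuity of a is known on [0, T] only; outside, the factor
        \<open>deriv \<eta>\<close> vanishes.\<close>
      have "(\<lambda>t. indicator {0..T} t *\<^sub>R a t) \<in> borel_measurable borel"
        by (rule borel_measurable_continuous_on_indicator[OF _ a]) simp
      then have "(\<lambda>t. deriv \<eta> t * (indicator {0..T} t *\<^sub>R a t)) \<in> borel_measurable lborel"
        using m(2) by simp
      also have "(\<lambda>t. deriv \<eta> t * (indicator {0..T} t *\<^sub>R a t)) = (\<lambda>t. deriv \<eta> t * a t)"
        using test_functions_zero_outside[OF d\<eta>] by (auto simp: fun_eq_iff split: split_indicator)
      finally show "(\<lambda>t. deriv \<eta> t * a t) \<in> borel_measurable lborel" .
      show "(\<lambda>t. deriv \<eta> t * (LINT x|lborel. P (x, t))) \<in> borel_measurable lborel"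
        using f1(1) by auto
      show "AE t in lborel. deriv \<eta> t * a t = deriv \<eta> t * (LINT x|lborel. P (x, t))"
        using slice
      proof eventually_elim
        case (elim t)
        then show ?case
          using test_functions_zero_outside[OF d\<eta>, of t] by (cases "t \<in> {0<..<T}") auto
      qed
    qed
    also have "\<dots> = (LINT z|lborel. deriv \<eta> (snd z) * P z)" by (rule f1(2))
    also have "\<dots> = (LINT z|lborel. \<eta> (snd z) * R z)"
      using weak[OF \<phi> \<eta>, folded P_def R_def] Bochner_Integration.integral_diff[OF f1(3) f2(3)] by linarith
    also have "\<dots> = (LINT t|lborel. \<eta> t * b t)"
      unfolding b_def by (rule f2(2)[symmetric])
    finally show ?thesis .
  qed
  have "a t\<^sub>2 - a t\<^sub>1 = - (LINT t|lborel. indicator {t\<^sub>1<..<t\<^sub>2} t * b t)"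
    by (rule weak_derivative_imp_increment[OF a b weak' t])
  also have "(LINT t|lborel. indicator {t\<^sub>1<..<t\<^sub>2} t * b t) = (LINT z|lborel. indicator {t\<^sub>1<..<t\<^sub>2} (snd z) * R z)"
    unfolding b_def by (rule fub(2)[OF R, of _ 1]) (auto simp: indicator_def)
  also have "(\<lambda>z. indicator {t\<^sub>1<..<t\<^sub>2} (snd z) * R z) = (\<lambda>z. (indicator {t\<^sub>1<..<t\<^sub>2} (snd z) *\<^sub>R B z) \<bullet> jacobian \<phi> (at (fst z)))"
    by (simp add: R_def)
  also have "a t\<^sub>2 - a t\<^sub>1 = (LINT x|lebesgue_on \<Omega>. (w t\<^sub>2 x - w t\<^sub>1 x) \<bullet> \<phi> x)"
    unfolding a_def using t Lp_space_two_products(2)[OF wL \<phi>L, of t\<^sub>1] Lp_space_two_products(2)[OF wL \<phi>L, of t\<^sub>2]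
    by (simp add: inner_diff_left)
  finally show ?thesis .
qed

lemma product_test_function_derivatives:
  fixes \<phi> :: "real^'n \<Rightarrow> real^'m" and \<eta> :: "real \<Rightarrow> real"
  assumes \<phi>: "\<phi> \<in> test_functions \<Omega>" and \<eta>: "\<eta> \<in> test_functions U"
  shows "vector_derivative (\<lambda>s. \<eta> s *\<^sub>R \<phi> x) (at t) = deriv \<eta> t *\<^sub>R \<phi> x"
    and "jacobian (\<lambda>y. \<eta> t *\<^sub>R \<phi> y) (at x) = \<eta> t *\<^sub>R jacobian \<phi> (at x)"
proof -
  have "((\<lambda>s. \<eta> s *\<^sub>R \<phi> x) has_vector_derivative deriv \<eta> t *\<^sub>R \<phi> x) (at t)"
    using has_vector_derivative_scaleR[OF deriv_test_function(1)[OF \<eta>] has_vector_derivative_const[of "\<phi> x"]] by simp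
  then show "vector_derivative (\<lambda>s. \<eta> s *\<^sub>R \<phi> x) (at t) = deriv \<eta> t *\<^sub>R \<phi> x"
    by (rule vector_derivative_at)
  have "((\<lambda>y. \<eta> t *\<^sub>R \<phi> y) has_derivative (\<lambda>h. \<eta> t *\<^sub>R frechet_derivative \<phi> (at x) h)) (at x)"
    by (rule has_derivative_scaleR_right[OF test_functions_has_derivative[OF \<phi>]])
  from fun_cong[OF frechet_derivative_at[OF this], symmetric]
  show "jacobian (\<lambda>y. \<eta> t *\<^sub>R \<phi> y) (at x) = \<eta> t *\<^sub>R jacobian \<phi> (at x)"
    by (simp add: vec_eq_iff jacobian_def matrix_def)
qed

theorem theorem3p5:
  fixes \<Omega> :: "(real^'n) set"
    and T p L C\<^sub>1 K :: real
    and F :: "real^'n \<Rightarrow> real \<Rightarrow> real \<Rightarrow> real"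
    and f g u v :: "(real^'n) \<times> real \<Rightarrow> real^'m"
  assumes "CARD('n) \<ge> 2"
    and "domain \<Omega>" and "bounded \<Omega>"
    and "T > 0" and "p > 1"
    and "structural_assumptions \<Omega> T p L C\<^sub>1 K F"
    and "f \<in> Lp_space 2 (cylinder \<Omega> T)"
    and "slice g \<in> C0_L2 T \<Omega>"
    and "slice g \<in> Bochner_Lp p T (W1p p \<Omega>) (W1p_norm p \<Omega>)"
    and "weak_solution \<Omega> T p (vector_field F) f g u"
    and "weak_solution \<Omega> T p (vector_field F) f g v"
  shows "\<forall>t\<in>{0..T}. AE x in lebesgue_on \<Omega>. u (x, t) = v (x, t)"
proof -
  let ?Q = "cylinder \<Omega> T"
  let ?M = "lebesgue_on ?Q"
  define A where "A G z = vector_field F (fst z) (snd z) (G z)"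
    for G :: "(real^'n) \<times> real \<Rightarrow> real^'n^'m" and z
  define weak where "weak G y \<longleftrightarrow> (\<forall>\<Phi>\<in>test_functions ?Q.
        integrable ?M (\<lambda>(x, t). y (x, t) \<bullet> vector_derivative (\<lambda>s. \<Phi> (x, s)) (at t) - A G (x, t) \<bullet> jacobian (\<lambda>y. \<Phi> (y, t)) (at x)) \<and>
        (LINT z|?M. (case z of (x, t) \<Rightarrow> y (x, t) \<bullet> vector_derivative (\<lambda>s. \<Phi> (x, s)) (at t) - A G (x, t) \<bullet> jacobian (\<lambda>y. \<Phi> (y, t)) (at x)))
          = - (LINT z|?M. f z \<bullet> \<Phi> z))"
    for G and y :: "(real^'n) \<times> real \<Rightarrow> real^'m"
  have \<Omega>: "open \<Omega>" "bounded \<Omega>" and T: "T > 0" and p: "p > 1"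
    using assms by (auto simp: domain_def)
  have Q: "open ?Q" "?Q \<in> sets lebesgue" "?Q \<in> sets lborel" "emeasure lborel ?Q < \<infinity>"
    using open_cylinder[OF \<Omega>(1)] emeasure_cylinder_finite[OF \<Omega>(2)] by auto
  obtain Du where Du: "has_spatial_gradient \<Omega> T u Du" "weak Du u"
    using assms(10) by (auto simp: weak_solution_def Let_def weak_def A_def)
  obtain Dv where Dv: "has_spatial_gradient \<Omega> T v Dv" "weak Dv v"
    using assms(11) by (auto simp: weak_solution_def Let_def weak_def A_def)
  have um [measurable]: "u \<in> borel_measurable ?M" "v \<in> borel_measurable ?M"
    and uC: "slice u \<in> C0_L2 T \<Omega>" "slice v \<in> C0_L2 T \<Omega>"
    and uB: "slice u \<in> Bochner_Lp p T (W1p p \<Omega>) (W1p_norm p \<Omega>)" "slice v \<in> Bochner_Lp p T (W1p p \<Omega>) (W1p_norm p \<Omega>)"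
    and ug: "slice (\<lambda>z. u z - g z) \<in> Bochner_Lp p T (W1p0 p \<Omega>) (W1p_norm p \<Omega>)"
      "slice (\<lambda>z. v z - g z) \<in> Bochner_Lp p T (W1p0 p \<Omega>) (W1p_norm p \<Omega>)"
    and u0: "((\<lambda>t. Lp_norm 2 \<Omega> (\<lambda>x. u (x, t) - g (x, 0))) \<longlongrightarrow> 0) (at_right 0)"
      "((\<lambda>t. Lp_norm 2 \<Omega> (\<lambda>x. v (x, t) - g (x, 0))) \<longlongrightarrow> 0) (at_right 0)"
    using assms(10,11) by (auto simp: weak_solution_def)
  \<comment> \<open>The flux must be known to be measurable before a Borel representative of its
    difference can be chosen.\<close>
  have Am [measurable]: "A Du \<in> borel_measurable ?M" "A Dv \<in> borel_measurable ?M"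
    using Du(2) Dv(2) unfolding weak_def
    by (intro flux_measurable[OF Q(1) um(1)], blast, intro flux_measurable[OF Q(1) um(2)], blast)
  have Dm [measurable]: "Du \<in> borel_measurable ?M" "Dv \<in> borel_measurable ?M"
    using Du Dv by (auto simp: has_spatial_gradient_def)
  obtain Gu where Gu [measurable]: "Gu \<in> borel_measurable borel" and Gu': "AE z in lborel. indicator ?Q z *\<^sub>R Du z = Gu z"
    by (rule borel_representative[OF Dm(1) Q(2)])
  obtain Gv where Gv [measurable]: "Gv \<in> borel_measurable borel" and Gv': "AE z in lborel. indicator ?Q z *\<^sub>R Dv z = Gv z"
    by (rule borel_representative[OF Dm(2) Q(2)])
  have Am': "(\<lambda>z. A Du z - A Dv z) \<in> borel_measurable ?M" by measurable
  obtain B0 where B0 [measurable]: "B0 \<in> borel_measurable borel" and B0': "AE z in lborel. indicator ?Q z *\<^sub>R (A Du z - A Dv z) = B0 z"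
    by (rule borel_representative[OF Am' Q(2)])
  define w where "w t x = u (x, t) - v (x, t)" for t x
  have wm: "(\<lambda>z. w (snd z) (fst z)) \<in> borel_measurable ?M"
    unfolding w_def by simp
  obtain W where W [measurable]: "W \<in> borel_measurable borel" and W': "AE z in lborel. indicator ?Q z *\<^sub>R w (snd z) (fst z) = W z"
    by (rule borel_representative[OF wm Q(2)])
  \<comment> \<open>The representative B0 vanishes off the cylinder only almost everywhere; the
    extra indicator makes this true at every point, as the energy argument requires.\<close>
  define B where "B z = indicator ?Q z *\<^sub>R B0 z" for z
  define G where "G z = Gu z - Gv z" for z
  have Bm [measurable]: "B \<in> borel_measurable borel"
    unfolding B_def using Q(3) by simp
  have Gm [measurable]: "G \<in> borel_measurable borel" unfolding G_def by measurable
  \<comment> \<open>The conjugate exponent. Since (p - 1) q = p, growth of order p - 1 puts the flux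
    into L^q.\<close>
  define q where "q = p / (p - 1)"
  have pq: "p > 1" "q > 1" "1 / p + 1 / q = 1" "(p - 1) * q = p"
    using p by (auto simp: q_def field_simps)
  have Gup: "integrable lborel (\<lambda>z. norm (Gu z) powr p)"
    by (rule spatial_gradient_integrable[OF \<Omega>(1) p uB(1) Du(1) Gu Gu'])
  have Gvp: "integrable lborel (\<lambda>z. norm (Gv z) powr p)"
    by (rule spatial_gradient_integrable[OF \<Omega>(1) p uB(2) Dv(1) Gv Gv'])
  have Gp: "integrable lborel (\<lambda>z. norm (G z) powr p)"
  proof (rule Bochner_Integration.integrable_bound)
    show "integrable lborel (\<lambda>z. 2 powr p * (norm (Gu z) powr p + norm (Gv z) powr p))"
      using Gup Gvp by simp
    show "AE z in lborel. norm (norm (G z) powr p) \<le> norm (2 powr p * (norm (Gu z) powr p + norm (Gv z) powr p))"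
      unfolding G_def using norm_diff_powr_le[of p] p by (intro AE_I2) simp
  qed measurable
  have struct: "AE z in lborel. z \<in> ?Q \<longrightarrow> (\<forall>\<xi> \<zeta> :: real^'n^'m.
     norm (vector_field F (fst z) (snd z) \<xi>) \<le> C\<^sub>1 * norm \<xi> powr (p - 1) \<and>
     (vector_field F (fst z) (snd z) \<xi> - vector_field F (fst z) (snd z) \<zeta>) \<bullet> (\<xi> - \<zeta>) \<ge> 0)"
    using structural_vector_field[OF assms(6)] unfolding AE_lebesgue_on_iff[OF Q(2)] .
  have C1: "C\<^sub>1 > 0" using assms(6) by (simp add: structural_assumptions_def)
  have mono: "AE z in lborel. B z \<bullet> G z \<ge> 0"
    using struct B0' Gu' Gv'
  proof eventually_elim
    case (elim z)
    show ?case
    proof (cases "z \<in> ?Q")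
      case True
      then have "B z = A Du z - A Dv z" "G z = Du z - Dv z"
        using elim(2-4) by (auto simp: B_def G_def)
      then show ?thesis using elim(1) True by (simp add: A_def)
    qed (simp add: B_def)
  qed
  have Bq: "integrable lborel (\<lambda>z. norm (B z) powr q)"
  proof (rule Bochner_Integration.integrable_bound)
    show "integrable lborel (\<lambda>z. 2 powr q * C\<^sub>1 powr q * (norm (Gu z) powr p + norm (Gv z) powr p))"
      using Gup Gvp by simp
    show "AE z in lborel. norm (norm (B z) powr q) \<le> norm (2 powr q * C\<^sub>1 powr q * (norm (Gu z) powr p + norm (Gv z) powr p))"
      using struct B0' Gu' Gv'
    proof eventually_elim
      case (elim z)
      show ?case
      proof (cases "z \<in> ?Q")
        case True
        then have eq: "B z = A Du z - A Dv z" "Gu z = Du z" "Gv z = Dv z"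
          using elim(2-4) by (auto simp: B_def)
        have bd: "norm (A H z) powr q \<le> C\<^sub>1 powr q * norm (H z) powr p" for H
        proof -
          have "norm (A H z) powr q \<le> (C\<^sub>1 * norm (H z) powr (p - 1)) powr q"
            using elim(1) True pq by (intro powr_mono2) (auto simp: A_def)
          also have "\<dots> = C\<^sub>1 powr q * norm (H z) powr p"
            using C1 by (simp add: powr_mult powr_powr pq(4))
          finally show ?thesis .
        qed
        have "norm (B z) powr q \<le> 2 powr q * (norm (A Du z) powr q + norm (A Dv z) powr q)"
          unfolding eq using pq by (intro norm_diff_powr_le) simp
        also have "\<dots> \<le> 2 powr q * (C\<^sub>1 powr q * norm (Du z) powr p + C\<^sub>1 powr q * norm (Dv z) powr p)"
          by (intro mult_left_mono add_mono bd) simp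
        finally show ?thesis by (simp add: eq algebra_simps)
      qed (simp add: B_def)
    qed
  qed measurable
  have B0off: "B z = 0" if "z \<notin> ?Q" for z using that by (simp add: B_def)
  have wC: "w \<in> C0_L2 T \<Omega>"
    unfolding w_def by (rule C0_L2_diff[OF uC])
  have Wint: "integrable lborel W"
  proof (rule integrable_of_powr[OF _ Q(3,4)])
    show "integrable lborel (\<lambda>z. norm (W z) powr 2)"
      using wC W' by (intro C0_L2_integrable[OF \<Omega>(1) _ W, where u = "\<lambda>z. w (snd z) (fst z)"]) simp_all
    show "AE z in lborel. z \<notin> ?Q \<longrightarrow> W z = 0"
      using W' by eventually_elim auto
  qed simp_all
  have Bint: "integrable lborel B"
    by (rule integrable_of_powr[OF _ Q(3,4) Bq]) (use pq B0off in auto)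
  \<comment> \<open>The source f contributes the same right-hand side to both identities and cancels
    on subtraction.\<close>
  have weak_difference: "(LINT z|lborel. deriv \<eta> (snd z) * (W z \<bullet> \<phi> (fst z)) - \<eta> (snd z) * (B z \<bullet> jacobian \<phi> (at (fst z)))) = 0"
    if \<phi>: "\<phi> \<in> test_functions \<Omega>" and \<eta>: "\<eta> \<in> test_functions {0<..<T}" for \<phi> \<eta>
  proof -
    define I where "I G y z = deriv \<eta> (snd z) * (y z \<bullet> \<phi> (fst z)) - \<eta> (snd z) * (A G z \<bullet> jacobian \<phi> (at (fst z)))"
      for G and y :: "(real^'n) \<times> real \<Rightarrow> real^'m" and z
    note test = test_functions_product[OF \<phi> \<eta>]
    have I: "integrable ?M (I G y) \<and> (LINT z|?M. I G y z) = - (LINT z|?M. f z \<bullet> (\<eta> (snd z) *\<^sub>R \<phi> (fst z)))"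
      if "weak G y" for G y
    proof -
      have "(\<lambda>(x, t). y (x, t) \<bullet> vector_derivative (\<lambda>s. \<eta> (snd (x, s)) *\<^sub>R \<phi> (fst (x, s))) (at t)
          - A G (x, t) \<bullet> jacobian (\<lambda>y. \<eta> (snd (y, t)) *\<^sub>R \<phi> (fst (y, t))) (at x)) = I G y"
        by (simp add: fun_eq_iff I_def product_test_function_derivatives[OF \<phi> \<eta>])
      then show ?thesis
        using that[unfolded weak_def, rule_format, OF test] by simp
    qed
    have int: "integrable ?M (\<lambda>z. I Du u z - I Dv v z)"
      using I[OF Du(2)] I[OF Dv(2)] by simp
    have "(LINT z|?M. I Du u z - I Dv v z) = 0"
      using I[OF Du(2)] I[OF Dv(2)] by simp
    then have zero: "(LINT z|lebesgue. indicator ?Q z *\<^sub>R (I Du u z - I Dv v z)) = 0"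
      using Q(2) by (subst (asm) integral_restrict_space) auto
    let ?D = "\<lambda>z. deriv \<eta> (snd z) * (W z \<bullet> \<phi> (fst z)) - \<eta> (snd z) * (B z \<bullet> jacobian \<phi> (at (fst z)))"
    note tm = test_functions_borel_measurable
    have Dmeas: "?D \<in> borel_measurable lborel"
      by (intro borel_measurable_diff borel_measurable_times borel_measurable_inner measurable_lborelI[OF W] measurable_lborelI[OF Bm]
        borel_measurable_compose_snd[OF tm[OF \<eta>]] borel_measurable_compose_snd[OF tm[OF deriv_test_function(2)[OF \<eta>]]] borel_measurable_compose_fst[OF tm[OF \<phi>]]
        borel_measurable_compose_fst[OF jacobian_test_function(1)[OF \<phi>]])
    have "(LINT z|lborel. ?D z) = (LINT z|lebesgue. ?D z)"
      using Dmeas by (rule integral_completion[symmetric])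
    also have "\<dots> = (LINT z|lebesgue. indicator ?Q z *\<^sub>R (I Du u z - I Dv v z))"
    proof (rule integral_cong_AE)
      show "?D \<in> borel_measurable lebesgue" by (rule measurable_completion[OF Dmeas])
      show "(\<lambda>z. indicator ?Q z *\<^sub>R (I Du u z - I Dv v z)) \<in> borel_measurable lebesgue"
        using int Q(2) by (subst borel_measurable_restrict_space_iff[symmetric]) auto
      show "AE z in lebesgue. ?D z = indicator ?Q z *\<^sub>R (I Du u z - I Dv v z)"
        using AE_completion[OF W'] AE_completion[OF B0']
      proof eventually_elim
        case (elim z)
        show ?case
        proof (cases "z \<in> ?Q")
          case True
          then have "W z = u z - v z" "B z = A Du z - A Dv z"
            using elim by (auto simp: B_def w_def)
          then show ?thesis using True by (simp only: I_def inner_diff_left right_diff_distrib) simp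
        next
          case False
          then have "W z = 0" using elim by auto
          then show ?thesis using False by (simp add: B_def)
        qed
      qed
    qed
    finally show ?thesis using zero by simp
  qed
  have w0: "AE x in lebesgue_on \<Omega>. w 0 x = 0"
  proof -
    have g0: "(\<lambda>x. g (x, 0)) \<in> Lp_space 2 \<Omega>"
      using assms(8) T by (simp add: C0_L2_def)
    show ?thesis
      using initial_value[OF T uC(1) g0 u0(1)] initial_value[OF T uC(2) g0 u0(2)]
      by eventually_elim (simp add: w_def)
  qed
  have approximation: "AE t in lborel. t \<in> {0<..<T} \<longrightarrow> test_approximable \<Omega> p (w t) (\<lambda>x. G (x, t))"
  proof -
    have "AE t in lborel. t \<in> {0<..<T} \<longrightarrow> slice (\<lambda>z. u z - g z) t \<in> W1p0 p \<Omega>"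
      "AE t in lborel. t \<in> {0<..<T} \<longrightarrow> slice (\<lambda>z. v z - g z) t \<in> W1p0 p \<Omega>"
      using ug by (simp_all add: Bochner_Lp_def AE_lebesgue_on_iff)
    moreover have "AE t in lborel. t \<in> {0<..<T} \<longrightarrow> has_weak_gradient \<Omega> (slice u t) (slice Du t)"
      "AE t in lborel. t \<in> {0<..<T} \<longrightarrow> has_weak_gradient \<Omega> (slice v t) (slice Dv t)"
      using Du Dv by (simp_all add: has_spatial_gradient_def AE_lebesgue_on_iff)
    moreover note AE_lborel_prod_slices[OF Gu'] AE_lborel_prod_slices[OF Gv']
    ultimately show ?thesis
    proof eventually_elim
      case (elim t)
      show ?case
      proof
        assume t: "t \<in> {0<..<T}"
        have "has_weak_gradient \<Omega> (\<lambda>x. u (x, t) - v (x, t)) (\<lambda>x. Du (x, t) - Dv (x, t))"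
          using has_weak_gradient_diff[OF \<Omega>(1)] elim(3,4) t by blast
        \<comment> \<open>The boundary datum g cancels in the difference, so \<open>Du\<close> minus
          \<open>Dv\<close> serves directly as the gradient of a difference of two functions with
          zero trace.\<close>
        then have "has_weak_gradient \<Omega> (\<lambda>x. (u (x, t) - g (x, t)) - (v (x, t) - g (x, t))) (\<lambda>x. Du (x, t) - Dv (x, t))"
          by simp
        then obtain \<phi> H where *: "\<And>j::nat. \<phi> j \<in> test_functions \<Omega>" "H \<in> borel_measurable borel"
          "integrable lborel (\<lambda>x. H x powr p)" "\<And>x. H x \<ge> 0"
          "AE x in lborel. x \<in> \<Omega> \<longrightarrow> (\<lambda>j. \<phi> j x) \<longlonglongrightarrow> (u (x, t) - g (x, t)) - (v (x, t) - g (x, t)) \<and>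
             (\<lambda>j. jacobian (\<phi> j) (at x)) \<longlonglongrightarrow> Du (x, t) - Dv (x, t) \<and> (\<forall>j. norm (jacobian (\<phi> j) (at x)) \<le> H x)"
          using W1p0_diff_approximation[OF \<Omega>(1) p elim(1)[rule_format, OF t] elim(2)[rule_format, OF t]]
          unfolding test_approximable_def by blast
        have "AE x in lborel. x \<in> \<Omega> \<longrightarrow> (\<lambda>j. \<phi> j x) \<longlonglongrightarrow> w t x \<and> (\<lambda>j. jacobian (\<phi> j) (at x)) \<longlonglongrightarrow> G (x, t) \<and>
          (\<forall>j. norm (jacobian (\<phi> j) (at x)) \<le> H x)"
          using *(5) elim(5,6)
        proof eventually_elim
          case (elim x)
          show ?case
          proof
            assume "x \<in> \<Omega>"
            then have "G (x, t) = Du (x, t) - Dv (x, t)"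
              using elim(2,3) t by (simp add: G_def cylinder_def flip: elim(2,3))
            then show "(\<lambda>j. \<phi> j x) \<longlonglongrightarrow> w t x \<and> (\<lambda>j. jacobian (\<phi> j) (at x)) \<longlonglongrightarrow> G (x, t) \<and>
              (\<forall>j. norm (jacobian (\<phi> j) (at x)) \<le> H x)"
              using elim(1) \<open>x \<in> \<Omega>\<close> by (simp add: w_def)
          qed
        qed
        with *(1-4) show "test_approximable \<Omega> p (w t) (\<lambda>x. G (x, t))"
          unfolding test_approximable_def by blast
      qed
    qed
  qed
  interpret energy \<Omega> T p q w B G
  proof (unfold_locales, goal_cases)
    case (15 \<psi> t\<^sub>1 t\<^sub>2)
    show ?case
      by (rule weak_form_increment[OF \<Omega>(1) wC W W' Wint Bint _ 15]) (rule weak_difference)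
  next
    case 16
    show ?case by (rule approximation)
  qed (fact \<Omega> T pq(1-3) Bm Gm Bq Gp B0off mono wC w0)+
  show ?thesis
  proof
    fix t assume "t \<in> {0..T}"
    from vanishes[OF this] show "AE x in lebesgue_on \<Omega>. u (x, t) = v (x, t)"
      by eventually_elim (simp add: w_def)
  qed
qed

end
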